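(* Let $L_1=L_1[0,1]$ (complex scalars, Lebesgue measure), let $\mathcal{B}(L_1)$ be the Banach algebra of all bounded linear operators on $L_1$, and let $\mathfrak{R}\subseteq\mathcal{B}(L_1)$ be the set of representable operators from $L_1$ to itself. If $A\subseteq \mathcal{B}(L_1)$ is a closed subalgebra that contains $\mathfrak{R}$, then $A$ is not approximately amenable. In particular, every such $A$ is non-amenable, and $\mathcal{B}(L_1)$ itself is neither approximately amenable nor amenable.
   Context: All algebras are associative, over $\mathbb{C}$, and need not have an identity element. Representable operators: an operator $T\in\mathcal{B}(L_1)$ is representable if there is a bounded, strongly measurable function (with respect to the Borel $\sigma$-algebra of $[0,1]$) $h_T:[0,1]\to L_1$ such that $T(f)=\int_0^1 f(s)h_T(s)\,ds$ for all $f\in L_1$, where the integral is an $L_1$-valued Bochner integral. $\mathfrak{R}$ denotes the set of all such $T$; it is a closed two-sided ideal in $\mathcal{B}(L_1)$. Amenability: for a Banach algebra $A$, let $A\widehat{\otimes}A$ be the projective tensor product, with $A$-bimodule structure determined by $a\cdot(b\otimes c)=ab\otimes c$ and $(b\otimes c)\cdot a=b\otimes ca$, and let $\pi:A\widehat{\otimes}A\to A$ be the bounded linear map with $\pi(a\otimes b)=ab$. An approximate diagonal for $A$ is a net $(d_\alpha)$ in $A\widehat{\otimes}A$ such that, for each $a\in A$, $\|a\cdot d_\alpha-d_\alpha\cdot a\|_{A\widehat{\otimes}A}\to 0$ and $\|a\pi(d_\alpha)-a\|_A\to 0$. $A$ is amenable if it has a bounded approximate diagonal (i.e. the net $(d_\alpha)$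 is norm bounded). Approximate amenability: let $A^\#=A\oplus\mathbb{C}1$ denote the forced unitization of $A$ (an identity is adjoined even if $A$ already has one). $A$ is approximately amenable if $A^\#$ has an approximate diagonal (not necessarily bounded). *)

theory Defs
  imports "HOL-Analysis.Analysis"
begin

section \<open>Complex vector spaces, normed spaces and (not necessarily unital) algebras\<close>

class complex_vector = real_vector +
  fixes scaleC :: "complex \<Rightarrow> 'a \<Rightarrow> 'a" (infixr "*\<^sub>C" 75)
  assumes scaleC_add_right: "c *\<^sub>C (x + y) = c *\<^sub>C x + c *\<^sub>C y"
    and scaleC_add_left: "(c + d) *\<^sub>C x = c *\<^sub>C x + d *\<^sub>C x"
    and scaleC_scaleC [simp]: "c *\<^sub>C d *\<^sub>C x = (c * d) *\<^sub>C x"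
    and scaleC_of_real: "complex_of_real r *\<^sub>C x = r *\<^sub>R x"
lemma scaleC_zero_left [simp]: "0 *\<^sub>C x = (0 :: 'a::complex_vector)"
  using scaleC_of_real[of 0 x] by simp

lemma scaleC_zero_right [simp]: "c *\<^sub>C 0 = (0 :: 'a::complex_vector)"
  using scaleC_add_right[of c 0 "0 :: 'a"] by simp

lemma scaleC_one [simp]: "1 *\<^sub>C x = (x :: 'a::complex_vector)"
  using scaleC_of_real[of 1 x] by simp

lemma scaleC_minus1_left [simp]: "(- 1) *\<^sub>C x = - (x :: 'a::complex_vector)"
  using scaleC_of_real[of "- 1" x] by simp

lemma scaleC_minus_right: "c *\<^sub>C (- x) = - (c *\<^sub>C (x :: 'a::complex_vector))"
  using scaleC_add_right[of c x "- x"] by (simp add: eq_neg_iff_add_eq_0 add.commute)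

lemma scaleC_diff_right: "c *\<^sub>C (x - y) = c *\<^sub>C x - c *\<^sub>C (y :: 'a::complex_vector)"
  using scaleC_add_right[of c x "- y"] by (simp add: scaleC_minus_right)

class complex_normed_vector = complex_vector + real_normed_vector +
  assumes norm_scaleC: "norm (c *\<^sub>C x) = cmod c * norm x"

class complex_banach = complex_normed_vector + banach

class complex_algebra = complex_vector + ring +
  assumes mult_scaleC_left: "(c *\<^sub>C x) * y = c *\<^sub>C (x * y)"
    and mult_scaleC_right: "x * (c *\<^sub>C y) = c *\<^sub>C (x * y)"

class complex_banach_algebra = complex_algebra + complex_banach + real_normed_algebra

definition complex_subspace :: "'a::complex_vector set \<Rightarrow> bool" where
  "complex_subspace A \<longleftrightarrow>
     0 \<in> A \<and> (\<forall>x\<in>A. \<forall>y\<in>A. x + y \<in> A) \<and> (\<forall>c. \<forall>x\<in>A. c *\<^sub>C x \<in> A)"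

definition complex_subalgebra :: "'a::complex_algebra set \<Rightarrow> bool" where
  "complex_subalgebra A \<longleftrightarrow> complex_subspace A \<and> (\<forall>x\<in>A. \<forall>y\<in>A. x * y \<in> A)"


section \<open>The Banach space \<open>L\<^sub>1[0,1]\<close>\<close>

text \<open>
  Every Lebesgue measurable function agrees almost everywhere with a Borel function, so building
  the space of classes from Borel functions gives the usual \<open>L\<^sub>1[0,1]\<close>.
\<close>

abbreviation unit_measure :: "real measure" where
  "unit_measure \<equiv> restrict_space lborel {0..1}"

definition L1_rel :: "(real \<Rightarrow> complex) \<Rightarrow> (real \<Rightarrow> complex) \<Rightarrow> bool" where
  "L1_rel f g \<longleftrightarrow> integrable unit_measure f \<and> integrable unit_measure g \<and>
     (AE s in unit_measure. f s = g s)"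

quotient_type L1 = "real \<Rightarrow> complex" / partial: L1_rel
  morphisms rep_L1 L1_class
proof (rule part_equivpI)
  show "\<exists>f. L1_rel f f"
    by (rule exI[of _ "\<lambda>_. 0"]) (simp add: L1_rel_def)
  show "symp L1_rel"
    by (auto simp: symp_def L1_rel_def eq_commute)
  show "transp L1_rel"
    unfolding transp_def L1_rel_def by auto
qed

instantiation L1 :: complex_normed_vector
begin

lift_definition zero_L1 :: L1 is "\<lambda>_. 0"
  by (simp add: L1_rel_def)

lift_definition plus_L1 :: "L1 \<Rightarrow> L1 \<Rightarrow> L1" is "\<lambda>f g s. f s + g s"
  by (auto simp: L1_rel_def)

lift_definition minus_L1 :: "L1 \<Rightarrow> L1 \<Rightarrow> L1" is "\<lambda>f g s. f s - g s"
  by (auto simp: L1_rel_def)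

lift_definition uminus_L1 :: "L1 \<Rightarrow> L1" is "\<lambda>f s. - f s"
  by (auto simp: L1_rel_def)

lift_definition scaleR_L1 :: "real \<Rightarrow> L1 \<Rightarrow> L1" is "\<lambda>r f s. r *\<^sub>R f s"
  by (auto simp: L1_rel_def)

lift_definition scaleC_L1 :: "complex \<Rightarrow> L1 \<Rightarrow> L1" is "\<lambda>c f s. c * f s"
  by (auto simp: L1_rel_def)

lift_definition norm_L1 :: "L1 \<Rightarrow> real" is "\<lambda>f. LINT s|unit_measure. cmod (f s)"
  unfolding L1_rel_def by (intro integral_cong_AE) auto

definition "dist (x::L1) y = norm (x - y)"
definition "sgn (x::L1) = inverse (norm x) *\<^sub>R x"
definition "(uniformity :: (L1 \<times> L1) filter) = (INF e\<in>{0 <..}. principal {(x, y). dist x y < e})"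
definition "open (U :: L1 set) \<longleftrightarrow> (\<forall>x\<in>U. eventually (\<lambda>(x', y). x' = x \<longrightarrow> y \<in> U) uniformity)"

instance
proof
  fix x y z :: L1 and a b :: real and c d :: complex and U :: "L1 set"
  show "x + y + z = x + (y + z)" "x + y = y + x" "0 + x = x" "- x + x = 0" "x - y = x + - y"
    by (transfer; auto simp: L1_rel_def add_ac)+
  show "a *\<^sub>R (x + y) = a *\<^sub>R x + a *\<^sub>R y" "(a + b) *\<^sub>R x = a *\<^sub>R x + b *\<^sub>R x"
    "a *\<^sub>R b *\<^sub>R x = (a * b) *\<^sub>R x" "1 *\<^sub>R x = x"
    by (transfer; auto simp: L1_rel_def algebra_simps)+
  show "c *\<^sub>C (x + y) = c *\<^sub>C x + c *\<^sub>C y" "(c + d) *\<^sub>C x = c *\<^sub>C x + d *\<^sub>C x"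
    "c *\<^sub>C d *\<^sub>C x = (c * d) *\<^sub>C x"  "complex_of_real a *\<^sub>C x = a *\<^sub>R x"
    by (transfer; auto simp: L1_rel_def algebra_simps scaleR_conv_of_real)+
  show "norm (c *\<^sub>C x) = cmod c * norm x"
    by transfer (simp add: norm_mult)
  show "norm (a *\<^sub>R x) = \<bar>a\<bar> * norm x"
    by transfer simp
  show "norm x = 0 \<longleftrightarrow> x = 0"
    by transfer (auto simp: L1_rel_def integral_nonneg_eq_0_iff_AE)
  show "norm (x + y) \<le> norm x + norm y"
  proof transfer
    fix f g assume "L1_rel f f" "L1_rel g g"
    then have [simp]: "integrable unit_measure f" "integrable unit_measure g"
      by (auto simp: L1_rel_def)
    have "(LINT s|unit_measure. cmod (f s + g s)) \<le> (LINT s|unit_measure. cmod (f s) + cmod (g s))"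
      by (intro integral_mono norm_triangle_ineq) auto
    then show "(LINT s|unit_measure. cmod (f s + g s))
        \<le> (LINT s|unit_measure. cmod (f s)) + (LINT s|unit_measure. cmod (g s))"
      by simp
  qed
  show "dist x y = norm (x - y)" "sgn x = inverse (norm x) *\<^sub>R x"
    by (simp_all add: dist_L1_def sgn_L1_def)
  show "(uniformity :: (L1 \<times> L1) filter) = (INF e\<in>{0 <..}. principal {(x, y). dist x y < e})"
    by (simp add: uniformity_L1_def)
  show "open U \<longleftrightarrow> (\<forall>x\<in>U. eventually (\<lambda>(x', y). x' = x \<longrightarrow> y \<in> U) uniformity)"
    by (simp add: open_L1_def)
qed

end

lemma L1_class_cases: obtains f where "integrable unit_measure f" "x = L1_class f"
proof
  show "integrable unit_measure (rep_L1 x)"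
    using Quotient3_rep_reflp[OF Quotient3_L1, of x] by (simp add: L1_rel_def)
  show "x = L1_class (rep_L1 x)"
    using Quotient3_abs_rep[OF Quotient3_L1, of x] by simp
qed

lemma L1_class_simps:
  assumes "integrable unit_measure f" "integrable unit_measure g"
  shows "L1_class f + L1_class g = L1_class (\<lambda>s. f s + g s)"
    and "L1_class f - L1_class g = L1_class (\<lambda>s. f s - g s)"
    and "L1_class f = L1_class g \<longleftrightarrow> (AE s in unit_measure. f s = g s)"
proof -
  have *: "L1_rel f f" "L1_rel g g"
    using assms by (auto simp: L1_rel_def)
  show "L1_class f + L1_class g = L1_class (\<lambda>s. f s + g s)"
    using * by (simp add: plus_L1.abs_eq)
  show "L1_class f - L1_class g = L1_class (\<lambda>s. f s - g s)"
    using * by (simp add: minus_L1.abs_eq)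
  show "L1_class f = L1_class g \<longleftrightarrow> (AE s in unit_measure. f s = g s)"
    using Quotient3_rel[OF Quotient3_L1, of f g] * assms by (auto simp: L1_rel_def)
qed

lemma norm_L1_class:
  "integrable unit_measure f \<Longrightarrow> norm (L1_class f) = (LINT s|unit_measure. cmod (f s))"
  by (simp add: norm_L1.abs_eq L1_rel_def)

lemma scaleC_L1_class:
  "integrable unit_measure f \<Longrightarrow> c *\<^sub>C L1_class f = L1_class (\<lambda>s. c * f s)"
  by (simp add: scaleC_L1.abs_eq L1_rel_def)

lemma L1_class_sum:
  assumes "\<And>i. i \<in> I \<Longrightarrow> integrable unit_measure (f i)"
  shows "(\<Sum>i\<in>I. L1_class (f i)) = L1_class (\<lambda>s. \<Sum>i\<in>I. f i s)"
  using assms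
proof (induction I rule: infinite_finite_induct)
  case (insert i I)
  then show ?case
    by (simp add: L1_class_simps)
qed (simp_all add: zero_L1_def)

lemma L1_tendsto_dominated:
  assumes "\<And>i. integrable unit_measure (s i)" "integrable unit_measure f" "integrable unit_measure w"
    and "AE x in unit_measure. (\<lambda>i. s i x) \<longlonglongrightarrow> f x"
    and "\<And>i. AE x in unit_measure. norm (s i x - f x) \<le> w x"
  shows "(\<lambda>i. L1_class (s i)) \<longlonglongrightarrow> L1_class f"
proof -
  have "(\<lambda>i. LINT x|unit_measure. cmod (s i x - f x)) \<longlonglongrightarrow> (LINT x|unit_measure. 0)"
  proof (rule integral_dominated_convergence)
    show "AE x in unit_measure. (\<lambda>i. cmod (s i x - f x)) \<longlonglongrightarrow> 0"
      using assms(4) by eventually_elim (simp add: LIM_zero tendsto_norm_zero)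
    show "AE x in unit_measure. norm (cmod (s i x - f x)) \<le> w x" for i
      using assms(5)[of i] by simp
    show "(\<lambda>x. cmod (s i x - f x)) \<in> borel_measurable unit_measure" for i
      using assms(1,2) by (intro borel_measurable_integrable) auto
  qed (use assms in auto)
  then have "(\<lambda>i. norm (L1_class (s i) - L1_class f)) \<longlonglongrightarrow> 0"
    using assms by (simp add: L1_class_simps norm_L1_class)
  then show ?thesis
    by (simp add: LIM_zero_cancel tendsto_norm_zero_iff)
qed

instance L1 :: banach
proof
  fix X :: "nat \<Rightarrow> L1" assume X: "Cauchy X"
  have "\<exists>N. \<forall>m\<ge>N. \<forall>n\<ge>N. norm (X m - X n) < (1/2) ^ k" for k
    using CauchyD[OF X, of "(1/2) ^ k"] by simp
  then obtain N where N: "\<And>k m n. m \<ge> N k \<Longrightarrow> n \<ge> N k \<Longrightarrow> norm (X m - X n) < (1/2) ^ k"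
    by metis
  define r where "r k = (\<Sum>i\<le>k. N i) + k" for k
  have r: "strict_mono r"
    by (rule strict_monoI_Suc) (simp add: r_def)
  have rN: "N k \<le> r k" for k
    using member_le_sum[of k "{..k}" N] by (simp add: r_def)
  have step: "norm (X (r (Suc k)) - X (r k)) < (1/2) ^ k" for k
  proof (rule N)
    show "r (Suc k) \<ge> N k"
      using rN[of k] strict_mono_leD[OF r, of k "Suc k"] by simp
  qed (rule rN)
  have "\<exists>f. integrable unit_measure f \<and> X (r k) = L1_class f" for k
    by (metis L1_class_cases)
  then obtain f where f: "\<And>k. integrable unit_measure (f k)" "\<And>k. X (r k) = L1_class (f k)"
    by metis
  define g where "g k s = f (Suc k) s - f k s" for k s
  have g: "integrable unit_measure (g k)" for k
    unfolding g_def using f by auto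
  have gn: "(LINT s|unit_measure. cmod (g k s)) < (1/2) ^ k" for k
    using step[of k] f by (simp add: L1_class_simps norm_L1_class g_def)
  have sm: "summable (\<lambda>k. LINT s|unit_measure. cmod (g k s))"
  proof (rule summable_comparison_test)
    show "\<exists>N. \<forall>n\<ge>N. norm (LINT s|unit_measure. cmod (g n s)) \<le> (1/2) ^ n"
      using gn by (auto simp: less_imp_le intro!: exI[of _ 0])
  qed (simp add: summable_geometric)
  have "(\<integral>\<^sup>+s. (\<Sum>k. ennreal (cmod (g k s))) \<partial>unit_measure)
      = (\<Sum>k. \<integral>\<^sup>+s. ennreal (cmod (g k s)) \<partial>unit_measure)"
    using g by (intro nn_integral_suminf) auto
  also have "\<dots> = (\<Sum>k. ennreal (LINT s|unit_measure. cmod (g k s)))"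
    using g by (intro arg_cong[where f = suminf] ext nn_integral_eq_integral) auto
  also have "\<dots> < \<infinity>"
    using sm by (simp add: ennreal_suminf_neq_top less_top[symmetric])
  finally have "AE s in unit_measure. (\<Sum>k. ennreal (cmod (g k s))) \<noteq> \<infinity>"
    using g by (intro nn_integral_PInf_AE) auto
  then have ae: "AE s in unit_measure. summable (\<lambda>k. cmod (g k s))"
    by eventually_elim (auto intro: summable_suminf_not_top)
  have w: "integrable unit_measure (\<lambda>s. \<Sum>k. cmod (g k s))"
    by (rule integrable_suminf) (use g ae sm in auto)
  have G: "integrable unit_measure (\<lambda>s. \<Sum>k. g k s)"
    by (rule integrable_suminf) (use g ae sm in auto)
  define h where "h s = f 0 s + (\<Sum>k. g k s)" for s
  have fg: "f n s = f 0 s + (\<Sum>k<n. g k s)" for n s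
    by (induction n) (simp_all add: g_def)
  have "(\<lambda>n. L1_class (f n)) \<longlonglongrightarrow> L1_class h"
  proof (rule L1_tendsto_dominated)
    show "AE s in unit_measure. (\<lambda>n. f n s) \<longlonglongrightarrow> h s"
      using ae
    proof eventually_elim
      case (elim s)
      have "(\<lambda>n. \<Sum>k<n. g k s) \<longlonglongrightarrow> (\<Sum>k. g k s)"
        by (rule summable_LIMSEQ[OF summable_norm_cancel[OF elim]])
      then have "(\<lambda>n. f 0 s + (\<Sum>k<n. g k s)) \<longlonglongrightarrow> f 0 s + (\<Sum>k. g k s)"
        by (intro tendsto_intros)
      then show ?case
        unfolding h_def fg[symmetric] .
    qed
    show "AE s in unit_measure. cmod (f n s - h s) \<le> (\<Sum>k. cmod (g k s))" for n
      using ae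
    proof eventually_elim
      case (elim s)
      have s: "summable (\<lambda>k. g k s)"
        using elim by (rule summable_norm_cancel)
      have "f n s - h s = - (\<Sum>k. g (k + n) s)"
        unfolding h_def fg[of n s] suminf_split_initial_segment[OF s, of n] by simp
      then have "cmod (f n s - h s) \<le> (\<Sum>k. cmod (g (k + n) s))"
        using summable_norm[of "\<lambda>k. g (k + n) s"] summable_ignore_initial_segment[OF elim, of n]
        by simp
      also have "\<dots> \<le> (\<Sum>k. cmod (g k s))"
        using suminf_split_initial_segment[OF elim, of n] by (simp add: sum_nonneg)
      finally show ?case .
    qed
    show "integrable unit_measure h"
      unfolding h_def[abs_def] using f G by (intro Bochner_Integration.integrable_add)
  qed (use f w in auto)
  then have "(X \<circ> r) \<longlonglongrightarrow> L1_class h"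
    using f by (simp add: comp_def)
  then have "X \<longlonglongrightarrow> L1_class h"
    by (rule Cauchy_converges_subseq[OF X r])
  then show "convergent X"
    by (rule convergentI)
qed


lemma countable_dense_imp_subbasis:
  fixes D :: "'a::metric_space set"
  assumes "countable D" "closure D = UNIV"
  shows "\<exists>B::'a set set. countable B \<and> open = generate_topology B"
proof (intro exI conjI)
  let ?B = "(\<lambda>(x, n). ball x (inverse (real (Suc n)))) ` (D \<times> (UNIV :: nat set))"
  show "countable ?B"
    using assms(1) by blast
  have "topological_basis ?B"
  proof (rule topological_basisI)
    fix O' and x :: 'a assume "open O'" "x \<in> O'"
    then obtain e where e: "e > 0" "ball x e \<subseteq> O'"
      by (meson openE)
    obtain n where n: "inverse (real (Suc n)) < e / 2"
      using reals_Archimedean[of "e / 2"] e by auto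
    have "x \<in> closure D"
      using assms(2) by simp
    then obtain y where y: "y \<in> D" "dist y x < inverse (real (Suc n))"
      unfolding closure_approachable using inverse_Suc by blast
    have "ball y (inverse (real (Suc n))) \<subseteq> O'"
    proof
      fix z assume "z \<in> ball y (inverse (real (Suc n)))"
      then have "dist x z < e"
        using dist_triangle[of x z y] y n by (simp add: dist_commute)
      then show "z \<in> O'"
        using e by auto
    qed
    with y show "\<exists>B'\<in>?B. x \<in> B' \<and> B' \<subseteq> O'"
      by (intro bexI[of _ "ball y (inverse (real (Suc n)))"]) auto
  qed auto
  then show "open = generate_topology ?B"
    by (rule topological_basis_imp_subbasis)
qed

instance L1 :: complex_banach ..

instance L1 :: second_countable_topology
proof
  define e :: "rat \<times> rat \<times> rat \<Rightarrow> L1" where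
    "e = (\<lambda>(p, q, a). L1_class (\<lambda>s. indicator {..of_rat a} s *\<^sub>R Complex (of_rat p) (of_rat q)))"
  define D where "D = range (\<lambda>xs. sum_list (map e xs))"
  have fin: "finite_measure unit_measure"
    by (rule finite_measureI) (simp add: space_restrict_space emeasure_restrict_space)
  have int: "integrable unit_measure (\<lambda>s. indicator A s *\<^sub>R c)" if "A \<in> sets borel" for A :: "real set" and c :: complex
  proof (rule finite_measure.integrable_const_bound)
    show "finite_measure unit_measure"
      by (rule fin)
    show "AE s in unit_measure. cmod (indicator A s *\<^sub>R c) \<le> cmod c"
      by (auto simp: indicator_def)
    show "(\<lambda>s. indicator A s *\<^sub>R c) \<in> borel_measurable unit_measure"
      using that
      by (intro measurable_restrict_space1 borel_measurable_scaleR borel_measurable_indicator) auto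
  qed
  have D_add: "x + y \<in> D" if xy: "x \<in> D" "y \<in> D" for x y
  proof -
    from xy obtain xs ys where "x = sum_list (map e xs)" "y = sum_list (map e ys)"
      unfolding D_def by blast
    then have "x + y = sum_list (map e (xs @ ys))"
      by simp
    then show ?thesis
      unfolding D_def by blast
  qed
  have sum_mem: "x + y \<in> closure D" if xy: "x \<in> closure D" "y \<in> closure D" for x y
  proof -
    from xy obtain u v where uv: "\<forall>n. u n \<in> D" "u \<longlonglongrightarrow> x" "\<forall>n. v n \<in> D" "v \<longlonglongrightarrow> y"
      unfolding closure_sequential by blast
    then have "(\<lambda>n. u n + v n) \<longlonglongrightarrow> x + y"
      by (intro tendsto_add)
    then show ?thesis
      unfolding closure_sequential using uv(1,3) D_add
      by (intro exI[of _ "\<lambda>n. u n + v n"]) simp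
  qed
  have lim_mem: "y \<in> closure D" if "u \<longlonglongrightarrow> y" "\<And>n. u n \<in> closure D" for u :: "nat \<Rightarrow> L1" and y
    by (rule closed_sequentially[OF closed_closure that(2,1)])
  have atMost: "L1_class (\<lambda>s. indicator {..a} s *\<^sub>R c) \<in> closure D" for a :: real and c
  proof -
    have dens: "\<exists>q::rat. t < of_rat q \<and> of_rat q < t + inverse (real (Suc n))" for t :: real and n
      using of_rat_dense[of t "t + inverse (real (Suc n))"] by simp
    have seq: "\<exists>q. \<forall>n. t < real_of_rat (q n) \<and> real_of_rat (q n) < t + inverse (real (Suc n))" for t
      by (rule choice) (rule allI, rule dens)
    have lim: "(\<lambda>n. real_of_rat (q n)) \<longlonglongrightarrow> t"
      if "\<forall>n. t < real_of_rat (q n) \<and> real_of_rat (q n) < t + inverse (real (Suc n))" for t q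
    proof (rule tendsto_sandwich[where f = "\<lambda>_. t" and h = "\<lambda>n. t + inverse (real (Suc n))"])
      show "(\<lambda>n. t + inverse (real (Suc n))) \<longlonglongrightarrow> t"
        using tendsto_add[OF tendsto_const LIMSEQ_inverse_real_of_nat, of t] by simp
    qed (use that in \<open>auto intro!: always_eventually less_imp_le simp del: of_nat_Suc\<close>)
    obtain p where p: "\<forall>n. Re c < real_of_rat (p n) \<and> real_of_rat (p n) < Re c + inverse (real (Suc n))"
      using seq by blast
    obtain q where q: "\<forall>n. Im c < real_of_rat (q n) \<and> real_of_rat (q n) < Im c + inverse (real (Suc n))"
      using seq by blast
    obtain b where b: "\<forall>n. a < real_of_rat (b n) \<and> real_of_rat (b n) < a + inverse (real (Suc n))"
      using seq by blast
    define d where "d n = Complex (of_rat (p n)) (of_rat (q n))" for n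
    have d: "d \<longlonglongrightarrow> c"
      unfolding d_def using tendsto_Complex[OF lim[OF p] lim[OF q]] by simp
    then obtain K where K: "\<And>n. norm (d n) \<le> K"
      using convergent_imp_Bseq[OF convergentI, of d c] by (auto simp: Bseq_def)
    have K0: "0 \<le> K"
      using K[of 0] norm_ge_zero[of "d 0"] by linarith
    have "(\<lambda>n. L1_class (\<lambda>s. indicator {..of_rat (b n)} s *\<^sub>R d n)) \<longlonglongrightarrow> L1_class (\<lambda>s. indicator {..a} s *\<^sub>R c)"
    proof (rule L1_tendsto_dominated)
      show "integrable unit_measure (\<lambda>s. K + cmod c)"
        by (rule finite_measure.integrable_const[OF fin])
      show "AE s in unit_measure. (\<lambda>n. indicator {..real_of_rat (b n)} s *\<^sub>R d n) \<longlonglongrightarrow> indicator {..a} s *\<^sub>R c"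
      proof (rule AE_I2)
        fix s
        have "(\<lambda>n. indicator {..real_of_rat (b n)} s :: real) \<longlonglongrightarrow> indicator {..a} s"
        proof (cases "s \<le> a")
          case True
          then have "s \<le> real_of_rat (b n)" for n
            using b by (meson less_imp_le order_trans)
          then show ?thesis
            using True by simp
        next
          case False
          then have "\<forall>\<^sub>F n in sequentially. real_of_rat (b n) < s"
            using order_tendstoD(2)[OF lim[OF b], of s] by simp
          then have "\<forall>\<^sub>F n in sequentially. indicator {..real_of_rat (b n)} s = (indicator {..a} s :: real)"
            by eventually_elim (use False in auto)
          then show ?thesis
            by (rule tendsto_eventually)
        qed
        then show "(\<lambda>n. indicator {..real_of_rat (b n)} s *\<^sub>R d n) \<longlonglongrightarrow> indicator {..a} s *\<^sub>R c"
          using d by (intro tendsto_scaleR)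
      qed
      show "AE s in unit_measure. cmod (indicator {..real_of_rat (b n)} s *\<^sub>R d n - indicator {..a} s *\<^sub>R c)
          \<le> K + cmod c" for n
      proof (rule AE_I2)
        fix s
        have "cmod (indicator {..real_of_rat (b n)} s *\<^sub>R d n - indicator {..a} s *\<^sub>R c)
            \<le> cmod (indicator {..real_of_rat (b n)} s *\<^sub>R d n) + cmod (indicator {..a} s *\<^sub>R c)"
          by (rule norm_triangle_ineq4)
        also have "\<dots> \<le> K + cmod c"
          using K[of n] K0 by (intro add_mono) (auto simp: indicator_def)
        finally show "cmod (indicator {..real_of_rat (b n)} s *\<^sub>R d n - indicator {..a} s *\<^sub>R c)
            \<le> K + cmod c" .
      qed
    qed (auto intro: int)
    moreover have "L1_class (\<lambda>s. indicator {..of_rat (b n)} s *\<^sub>R d n) \<in> closure D" for n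
      unfolding D_def
      by (intro closure_subset[THEN subsetD] range_eqI[of _ _ "[(p n, q n, b n)]"]) (simp add: e_def d_def)
    ultimately show ?thesis
      by (rule lim_mem)
  qed
  have ind: "\<forall>c. L1_class (\<lambda>s. indicator A s *\<^sub>R c) \<in> closure D" if "A \<in> sets borel" for A :: "real set"
  proof -
    have "Int_stable (range (\<lambda>a::real. {..a}))" "range (\<lambda>a::real. {..a}) \<subseteq> Pow UNIV"
      "A \<in> sigma_sets UNIV (range (\<lambda>a::real. {..a}))"
      using that by (auto simp: borel_eq_atMost Int_stable_def)
    then show ?thesis
    proof (induction rule: sigma_sets_induct_disjoint)
      case (basic A)
      then show ?case using atMost by auto
    next
      case empty
      have "L1_class (\<lambda>s. 0) \<in> D"
        unfolding D_def by (rule range_eqI[of _ _ "[]"]) (simp add: zero_L1_def)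
      then show ?case
        using closure_subset by auto
    next
      case (compl A)
      then have [measurable]: "A \<in> sets borel"
        by (simp add: borel_eq_atMost)
      show ?case
      proof
        fix c
        have "L1_class (\<lambda>s. indicator {..1} s *\<^sub>R c) + L1_class (\<lambda>s. indicator A s *\<^sub>R (- c)) \<in> closure D"
          using compl(2) by (intro sum_mem atMost) blast
        also have "L1_class (\<lambda>s. indicator {..1} s *\<^sub>R c) + L1_class (\<lambda>s. indicator A s *\<^sub>R (- c))
            = L1_class (\<lambda>s. indicator {..1} s *\<^sub>R c + indicator A s *\<^sub>R (- c))"
          by (intro L1_class_simps int) auto
        also have "\<dots> = L1_class (\<lambda>s. indicator (UNIV - A) s *\<^sub>R c)"
        proof (subst L1_class_simps(3))
          show "integrable unit_measure (\<lambda>s. indicator {..1} s *\<^sub>R c + indicator A s *\<^sub>R (- c))"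
            by (intro Bochner_Integration.integrable_add int) auto
          show "integrable unit_measure (\<lambda>s. indicator (UNIV - A) s *\<^sub>R c)"
            by (rule int) auto
        qed (auto intro!: AE_I2 simp: indicator_def space_restrict_space)
        finally show "L1_class (\<lambda>s. indicator (UNIV - A) s *\<^sub>R c) \<in> closure D" .
      qed
    next
      case (union A)
      then have [measurable]: "A i \<in> sets borel" for i
        by (auto simp: borel_eq_atMost)
      show ?case
      proof
        fix c
        have "(\<lambda>n. L1_class (\<lambda>s. indicator (\<Union>i<n. A i) s *\<^sub>R c)) \<longlonglongrightarrow> L1_class (\<lambda>s. indicator (\<Union>i. A i) s *\<^sub>R c)"
        proof (rule L1_tendsto_dominated)
          show "integrable unit_measure (\<lambda>s. cmod c)"
            by (rule finite_measure.integrable_const[OF fin])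
          show "AE s in unit_measure. (\<lambda>n. indicator (\<Union>i<n. A i) s *\<^sub>R c) \<longlonglongrightarrow> indicator (\<Union>i. A i) s *\<^sub>R c"
            by (intro AE_I2 tendsto_scaleR LIMSEQ_indicator_UN tendsto_const)
          show "integrable unit_measure (\<lambda>s. indicator (\<Union>i<n. A i) s *\<^sub>R c)" for n
            by (rule int) auto
          show "integrable unit_measure (\<lambda>s. indicator (\<Union>i. A i) s *\<^sub>R c)"
            by (rule int) auto
        qed (auto intro!: AE_I2 simp: indicator_def)
        moreover have "L1_class (\<lambda>s. indicator (\<Union>i<n. A i) s *\<^sub>R c) \<in> closure D" for n
        proof (induction n)
          case 0
          have "L1_class (\<lambda>s. 0) \<in> D"
            unfolding D_def by (rule range_eqI[of _ _ "[]"]) (simp add: zero_L1_def)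
          then show ?case
            using closure_subset by auto
        next
          case (Suc n)
          have "A i \<inter> A n = {}" if "i < n" for i
            using disjoint_family_onD[OF union(1), of i n] that by simp
          then have "indicator (\<Union>i<Suc n. A i) s *\<^sub>R c = indicator (\<Union>i<n. A i) s *\<^sub>R c + indicator (A n) s *\<^sub>R c" for s
            by (auto simp: indicator_def lessThan_Suc)
          then have "L1_class (\<lambda>s. indicator (\<Union>i<Suc n. A i) s *\<^sub>R c)
              = L1_class (\<lambda>s. indicator (\<Union>i<n. A i) s *\<^sub>R c) + L1_class (\<lambda>s. indicator (A n) s *\<^sub>R c)"
          proof (subst L1_class_simps(1))
            show "integrable unit_measure (\<lambda>s. indicator (\<Union>i<n. A i) s *\<^sub>R c)"
              by (rule int) auto
            show "integrable unit_measure (\<lambda>s. indicator (A n) s *\<^sub>R c)"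
              by (rule int) auto
          qed simp
          then show ?case
            using sum_mem[OF Suc spec[OF union(3)[of n]]] by simp
        qed
        ultimately show "L1_class (\<lambda>s. indicator (\<Union>i. A i) s *\<^sub>R c) \<in> closure D"
          by (rule lim_mem)
      qed
    qed
  qed
  have "x \<in> closure D" for x
  proof -
    obtain f where f: "integrable unit_measure f" "x = L1_class f"
      by (rule L1_class_cases)
    from f(1) have "L1_class f \<in> closure D"
    proof (induction f rule: integrable_induct)
      case (base A c)
      then have "A \<in> sets borel"
        by (auto simp: sets_restrict_space)
      then show ?case
        using ind by blast
    next
      case (add f g)
      then show ?case
        using sum_mem[of "L1_class f" "L1_class g"] by (simp add: L1_class_simps)
    next
      case (lim f s)
      have "(\<lambda>i. L1_class (s i)) \<longlonglongrightarrow> L1_class f"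
      proof (rule L1_tendsto_dominated)
        show "integrable unit_measure (\<lambda>x. 3 * cmod (f x))"
          using lim by auto
        show "AE x in unit_measure. cmod (s i x - f x) \<le> 3 * cmod (f x)" for i
        proof (rule AE_I2)
          fix x assume "x \<in> space unit_measure"
          then have "cmod (s i x) \<le> 2 * cmod (f x)"
            using lim by blast
          then show "cmod (s i x - f x) \<le> 3 * cmod (f x)"
            using norm_triangle_ineq4[of "s i x" "f x"] by linarith
        qed
      qed (use lim in auto)
      then show ?case
        by (rule lim_mem) (use lim in blast)
    qed
    with f show ?thesis by simp
  qed
  then have "closure D = UNIV"
    by blast
  moreover have "countable D"
    unfolding D_def by simp
  ultimately show "\<exists>B::L1 set set. countable B \<and> open = generate_topology B"
    by (intro countable_dense_imp_subbasis)
qed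


section \<open>The Banach algebra of bounded operators\<close>

lemma bounded_linear_scaleC: "bounded_linear (\<lambda>x :: 'a::complex_normed_vector. c *\<^sub>C x)"
proof (rule bounded_linear_intro)
  fix x y :: 'a and r :: real
  show "c *\<^sub>C (x + y) = c *\<^sub>C x + c *\<^sub>C y"
    by (rule scaleC_add_right)
  show "c *\<^sub>C (r *\<^sub>R x) = r *\<^sub>R (c *\<^sub>C x)"
    by (simp add: scaleC_of_real[symmetric] mult.commute)
  show "norm (c *\<^sub>C x) \<le> norm x * cmod c"
    by (simp add: norm_scaleC)
qed

lift_definition blinfun_scaleC :: "complex \<Rightarrow> 'a \<Rightarrow>\<^sub>L 'a::complex_normed_vector" is "\<lambda>c x. c *\<^sub>C x"
  by (rule bounded_linear_scaleC)

typedef (overloaded) 'a bop =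
  "{T :: 'a::complex_normed_vector \<Rightarrow>\<^sub>L 'a. \<forall>c x. blinfun_apply T (c *\<^sub>C x) = c *\<^sub>C blinfun_apply T x}"
  morphisms blinfun_of_bop bop_of_blinfun
  by (rule exI[of _ 0]) simp

setup_lifting type_definition_bop

lift_definition bop_apply :: "'a::complex_normed_vector bop \<Rightarrow> 'a \<Rightarrow> 'a" is blinfun_apply .

instantiation bop :: (complex_normed_vector) "{complex_algebra, complex_normed_vector, real_normed_algebra}"
begin

lift_definition zero_bop :: "'a bop" is 0
  by simp

lift_definition plus_bop :: "'a bop \<Rightarrow> 'a bop \<Rightarrow> 'a bop" is "(+)"
  by (simp add: blinfun.add_left scaleC_add_right)

lift_definition minus_bop :: "'a bop \<Rightarrow> 'a bop \<Rightarrow> 'a bop" is "(-)"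
  by (simp add: blinfun.diff_left scaleC_diff_right)

lift_definition uminus_bop :: "'a bop \<Rightarrow> 'a bop" is uminus
  by (simp add: blinfun.minus_left scaleC_minus_right)

lift_definition scaleR_bop :: "real \<Rightarrow> 'a bop \<Rightarrow> 'a bop" is "(*\<^sub>R)"
  by (simp add: blinfun.scaleR_left scaleC_of_real[symmetric] mult.commute)

lift_definition scaleC_bop :: "complex \<Rightarrow> 'a bop \<Rightarrow> 'a bop" is "\<lambda>c T. blinfun_scaleC c o\<^sub>L T"
  by (simp add: blinfun_scaleC.rep_eq mult.commute)

lift_definition times_bop :: "'a bop \<Rightarrow> 'a bop \<Rightarrow> 'a bop" is "(o\<^sub>L)"
  by simp

lift_definition norm_bop :: "'a bop \<Rightarrow> real" is norm .

definition "dist (S :: 'a bop) T = norm (S - T)"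
definition "sgn (T :: 'a bop) = inverse (norm T) *\<^sub>R T"
definition "(uniformity :: ('a bop \<times> 'a bop) filter) = (INF e\<in>{0 <..}. principal {(S, T). dist S T < e})"
definition "open (U :: 'a bop set) \<longleftrightarrow> (\<forall>S\<in>U. eventually (\<lambda>(S', T). S' = S \<longrightarrow> T \<in> U) uniformity)"

instance
proof
  fix R S T :: "'a bop" and a b :: real and c d :: complex and U :: "'a bop set"
  show "R + S + T = R + (S + T)" "R + S = S + R" "0 + R = R" "- R + R = 0" "R - S = R + - S"
    by (transfer; simp)+
  show "a *\<^sub>R (S + T) = a *\<^sub>R S + a *\<^sub>R T" "(a + b) *\<^sub>R S = a *\<^sub>R S + b *\<^sub>R S"
    "a *\<^sub>R b *\<^sub>R S = (a * b) *\<^sub>R S" "1 *\<^sub>R S = S"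
    by (transfer; simp add: scaleR_add_right scaleR_add_left)+
  show "c *\<^sub>C (S + T) = c *\<^sub>C S + c *\<^sub>C T"
    by transfer (auto intro!: blinfun_eqI simp: blinfun_scaleC.rep_eq blinfun.add_left scaleC_add_right)
  show "(c + d) *\<^sub>C S = c *\<^sub>C S + d *\<^sub>C S"
    by transfer (auto intro!: blinfun_eqI simp: blinfun_scaleC.rep_eq blinfun.add_left scaleC_add_left)
  show "c *\<^sub>C d *\<^sub>C S = (c * d) *\<^sub>C S"
    by transfer (auto intro!: blinfun_eqI simp: blinfun_scaleC.rep_eq)
  show "complex_of_real a *\<^sub>C S = a *\<^sub>R S"
    by transfer (auto intro!: blinfun_eqI simp: blinfun_scaleC.rep_eq blinfun.scaleR_left scaleC_of_real)
  show "R * S * T = R * (S * T)"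
    by transfer (auto intro!: blinfun_eqI)
  show "(R + S) * T = R * T + S * T" "R * (S + T) = R * S + R * T"
    by (transfer; auto intro!: blinfun_eqI simp: blinfun.add_left blinfun.add_right)+
  show "(c *\<^sub>C S) * T = c *\<^sub>C (S * T)" "S * (c *\<^sub>C T) = c *\<^sub>C (S * T)"
    by (transfer; auto intro!: blinfun_eqI simp: blinfun_scaleC.rep_eq)+
  show "(a *\<^sub>R S) * T = a *\<^sub>R (S * T)" "S * (a *\<^sub>R T) = a *\<^sub>R (S * T)"
    by (transfer; auto intro!: blinfun_eqI simp: blinfun.scaleR_left blinfun.scaleR_right)+
  show "norm (c *\<^sub>C S) = cmod c * norm S"
  proof -
    have le: "norm (c *\<^sub>C T) \<le> cmod c * norm T" for c and T :: "'a bop"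
      by transfer (auto intro!: norm_blinfun_bound
        simp: blinfun_scaleC.rep_eq norm_scaleC mult.assoc mult_left_mono norm_blinfun)
    show ?thesis
    proof (cases "c = 0")
      case True
      then show ?thesis
        using le[of 0 S] by (simp add: antisym norm_bop.rep_eq)
    next
      case False
      have "inverse c *\<^sub>C c *\<^sub>C S = S"
        using False by transfer (auto intro!: blinfun_eqI simp: blinfun_scaleC.rep_eq)
      then have "norm S \<le> inverse (cmod c) * norm (c *\<^sub>C S)"
        using le[of "inverse c" "c *\<^sub>C S"] by (simp add: norm_inverse)
      then have "cmod c * norm S \<le> norm (c *\<^sub>C S)"
        using False by (simp add: field_simps)
      with le[of c S] show ?thesis by simp
    qed
  qed
  show "norm (a *\<^sub>R S) = \<bar>a\<bar> * norm S"
    by transfer simp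
  show "norm S = 0 \<longleftrightarrow> S = 0"
    by transfer simp
  show "norm (S + T) \<le> norm S + norm T"
    by transfer (rule norm_triangle_ineq)
  show "norm (S * T) \<le> norm S * norm T"
    by transfer (rule norm_blinfun_compose)
  show "dist S T = norm (S - T)" "sgn S = inverse (norm S) *\<^sub>R S"
    by (simp_all add: dist_bop_def sgn_bop_def)
  show "(uniformity :: ('a bop \<times> 'a bop) filter) = (INF e\<in>{0 <..}. principal {(x, y). dist x y < e})"
    by (simp add: uniformity_bop_def)
  show "open U \<longleftrightarrow> (\<forall>x\<in>U. eventually (\<lambda>(x', y). x' = x \<longrightarrow> y \<in> U) uniformity)"
    by (simp add: open_bop_def)
qed

end

instance bop :: (complex_banach) complex_banach_algebra
proof
  fix X :: "nat \<Rightarrow> 'a bop" assume X: "Cauchy X"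
  have dist: "dist (blinfun_of_bop S) (blinfun_of_bop T) = dist S T" for S T :: "'a bop"
    by (simp add: dist_norm norm_bop.rep_eq minus_bop.rep_eq)
  have "Cauchy (\<lambda>n. blinfun_of_bop (X n))"
    using X by (simp add: Cauchy_def dist)
  then obtain L where L: "(\<lambda>n. blinfun_of_bop (X n)) \<longlonglongrightarrow> L"
    using Cauchy_convergent convergent_def by blast
  have "blinfun_apply L (c *\<^sub>C x) = c *\<^sub>C blinfun_apply L x" for c x
  proof (rule LIMSEQ_unique)
    show "(\<lambda>n. blinfun_apply (blinfun_of_bop (X n)) (c *\<^sub>C x)) \<longlonglongrightarrow> blinfun_apply L (c *\<^sub>C x)"
      using L by (intro tendsto_intros)
    have "(\<lambda>n. c *\<^sub>C blinfun_apply (blinfun_of_bop (X n)) x) \<longlonglongrightarrow> c *\<^sub>C blinfun_apply L x"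
      using L by (intro bounded_linear.tendsto[OF bounded_linear_scaleC] tendsto_intros)
    then show "(\<lambda>n. blinfun_apply (blinfun_of_bop (X n)) (c *\<^sub>C x)) \<longlonglongrightarrow> c *\<^sub>C blinfun_apply L x"
      using blinfun_of_bop[of "X n" for n] by simp
  qed
  then have "blinfun_of_bop (bop_of_blinfun L) = L"
    by (intro bop_of_blinfun_inverse) simp
  then have "X \<longlonglongrightarrow> bop_of_blinfun L"
    using L unfolding tendsto_iff by (simp add: dist[symmetric])
  then show "convergent X"
    by (rule convergentI)
qed


section \<open>Representable operators\<close>

definition strongly_measurable :: "'a measure \<Rightarrow> ('a \<Rightarrow> 'b::topological_space) \<Rightarrow> bool" where
  "strongly_measurable M h \<longleftrightarrow>
     (\<exists>s. (\<forall>n::nat. simple_function M (s n)) \<and> (\<forall>x\<in>space M. (\<lambda>n. s n x) \<longlonglongrightarrow> h x))"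

definition representable :: "L1 bop \<Rightarrow> bool" where
  "representable T \<longleftrightarrow>
     (\<exists>h :: real \<Rightarrow> L1. (\<exists>C. \<forall>s\<in>{0..1}. norm (h s) \<le> C) \<and> strongly_measurable unit_measure h \<and>
        (\<forall>f. integrable unit_measure f \<longrightarrow>
           bop_apply T (L1_class f) = (LINT s|unit_measure. f s *\<^sub>C h s)))"

lemma representable_integrand_integrable:
  fixes h :: "real \<Rightarrow> L1"
  assumes "integrable unit_measure f" "strongly_measurable unit_measure h" "\<forall>s\<in>{0..1}. norm (h s) \<le> C"
  shows "integrable unit_measure (\<lambda>s. f s *\<^sub>C h s)"
proof (rule Bochner_Integration.integrable_bound)
  obtain u where u: "\<And>n. simple_function unit_measure (u n)"
      "\<And>x. x \<in> space unit_measure \<Longrightarrow> (\<lambda>n. u n x) \<longlonglongrightarrow> h x"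
    using assms(2) unfolding strongly_measurable_def by blast
  have h: "h \<in> borel_measurable unit_measure"
    by (rule borel_measurable_LIMSEQ_metric[of u])
      (use u in \<open>auto intro: borel_measurable_simple_function\<close>)
  have "bounded_bilinear (\<lambda>(c :: complex) (x :: L1). c *\<^sub>C x)"
  proof
    show "(a + a') *\<^sub>C b = a *\<^sub>C b + a' *\<^sub>C b" "a *\<^sub>C (b + b') = a *\<^sub>C b + a *\<^sub>C b'"
      for a a' :: complex and b b' :: L1
      by (rule scaleC_add_left scaleC_add_right)+
    show "(r *\<^sub>R a) *\<^sub>C b = r *\<^sub>R (a *\<^sub>C b)" "a *\<^sub>C (r *\<^sub>R b) = r *\<^sub>R (a *\<^sub>C b)"
      for a :: complex and b :: L1 and r
      by (simp_all add: scaleC_of_real[symmetric] scaleR_conv_of_real mult.commute)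
    show "\<exists>K. \<forall>(a :: complex) (b :: L1). norm (a *\<^sub>C b) \<le> norm a * norm b * K"
      by (rule exI[of _ 1]) (simp add: norm_scaleC)
  qed
  then have cont: "continuous_on UNIV (\<lambda>p :: complex \<times> L1. fst p *\<^sub>C snd p)"
    by (rule bounded_bilinear.continuous_on[OF _ continuous_on_fst[OF continuous_on_id]
          continuous_on_snd[OF continuous_on_id]])
  show "(\<lambda>s. f s *\<^sub>C h s) \<in> borel_measurable unit_measure"
    by (rule borel_measurable_continuous_Pair[OF borel_measurable_integrable[OF assms(1)] h cont])
  show "integrable unit_measure (\<lambda>s. C * cmod (f s))"
    using assms(1) by auto
  show "AE s in unit_measure. norm (f s *\<^sub>C h s) \<le> norm (C * cmod (f s))"
  proof (rule AE_I2)
    fix s assume "s \<in> space unit_measure"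
    then have "norm (h s) \<le> C"
      using assms(3) by (auto simp: space_restrict_space)
    then have "norm (f s) * norm (h s) \<le> norm (f s) * \<bar>C\<bar>"
      by (intro mult_left_mono) auto
    then show "norm (f s *\<^sub>C h s) \<le> norm (C * cmod (f s))"
      by (simp add: norm_scaleC abs_mult mult.commute)
  qed
qed


section \<open>Algebraic tensor products\<close>

text \<open>
  A multiset of pairs stands for the formal sum of the corresponding elementary tensors; the
  relation below is the congruence generated by bilinearity. Scalars are absorbed into the factors.
\<close>

inductive tensor_eq ::
  "('a::complex_vector \<times> 'b::complex_vector) multiset \<Rightarrow> ('a \<times> 'b) multiset \<Rightarrow> bool" where
  refl: "tensor_eq M M"
| sym: "tensor_eq M N \<Longrightarrow> tensor_eq N M"
| trans: "tensor_eq L M \<Longrightarrow> tensor_eq M N \<Longrightarrow> tensor_eq L N"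
| plus: "tensor_eq M M' \<Longrightarrow> tensor_eq N N' \<Longrightarrow> tensor_eq (M + N) (M' + N')"
| add_left: "tensor_eq {#(a + a', b)#} {#(a, b), (a', b)#}"
| add_right: "tensor_eq {#(a, b + b')#} {#(a, b), (a, b')#}"
| scale: "tensor_eq {#(c *\<^sub>C a, b)#} {#(a, c *\<^sub>C b)#}"
| zero: "tensor_eq {#(0, 0)#} {#}"

lemma tensor_eq_zero_left: "tensor_eq {#(0, b)#} {#}"
  using tensor_eq.trans[OF _ tensor_eq.zero] tensor_eq.scale[of 0 0 b] by simp

lemma tensor_eq_minus: "tensor_eq (image_mset (\<lambda>(a, b). (- a, b)) M + M) {#}"
proof (induction M)
  case empty
  show ?case by (simp add: tensor_eq.refl)
next
  case (add p M)
  obtain a b where p: "p = (a, b)" by (cases p)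
  have "tensor_eq {#(- a, b), (a, b)#} {#(0, b)#}"
    using tensor_eq.sym[OF tensor_eq.add_left[of "- a" a b]] by simp
  then have "tensor_eq {#(- a, b), (a, b)#} {#}"
    using tensor_eq_zero_left by (rule tensor_eq.trans)
  from tensor_eq.plus[OF this add] show ?case
    by (simp add: p add_ac)
qed

quotient_type (overloaded) ('a, 'b) tensor =
    "('a::complex_vector \<times> 'b::complex_vector) multiset" / tensor_eq
  morphisms rep_tensor tensor_of
  by (auto intro!: equivpI reflpI sympI transpI intro: tensor_eq.intros)

lemma tensor_eq_hom:
  assumes "tensor_eq M N"
    and "\<And>M N. h (M + N) = h M + h N" "h {#} = {#}"
    and "\<And>a a' b. tensor_eq (h {#(a + a', b)#}) (h {#(a, b), (a', b)#})"
    and "\<And>a b b'. tensor_eq (h {#(a, b + b')#}) (h {#(a, b), (a, b')#})"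
    and "\<And>c a b. tensor_eq (h {#(c *\<^sub>C a, b)#}) (h {#(a, c *\<^sub>C b)#})"
    and "tensor_eq (h {#(0, 0)#}) {#}"
  shows "tensor_eq (h M) (h N)"
  using assms(1)
proof induction
  case (plus M M' N N')
  then show ?case
    by (simp add: assms(2) tensor_eq.plus)
qed (use assms in \<open>auto intro: tensor_eq.refl tensor_eq.sym tensor_eq.trans\<close>)

lemma tensor_eq_image_left:
  assumes "tensor_eq M N" "\<And>a a'. f (a + a') = f a + f a'" "\<And>c a. f (c *\<^sub>C a) = c *\<^sub>C f a"
  shows "tensor_eq (image_mset (\<lambda>(a, b). (f a, b)) M) (image_mset (\<lambda>(a, b). (f a, b)) N)"
proof -
  have "f 0 = 0"
    using assms(3)[of 0 0] by simp
  then show ?thesis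
    by (intro tensor_eq_hom[OF assms(1)]) (simp_all add: assms tensor_eq.intros)
qed

lemma tensor_eq_image_right:
  assumes "tensor_eq M N" "\<And>b b'. f (b + b') = f b + f b'" "\<And>c b. f (c *\<^sub>C b) = c *\<^sub>C f b"
  shows "tensor_eq (image_mset (\<lambda>(a, b). (a, f b)) M) (image_mset (\<lambda>(a, b). (a, f b)) N)"
proof -
  have "f 0 = 0"
    using assms(3)[of 0 0] by simp
  then show ?thesis
    by (intro tensor_eq_hom[OF assms(1)]) (simp_all add: assms tensor_eq.intros)
qed

instantiation tensor :: (complex_vector, complex_vector) complex_vector
begin

lift_definition zero_tensor :: "('a, 'b) tensor" is "{#}" .

lift_definition plus_tensor :: "('a, 'b) tensor \<Rightarrow> ('a, 'b) tensor \<Rightarrow> ('a, 'b) tensor" is "(+)"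
  by (rule tensor_eq.plus)

lift_definition scaleC_tensor :: "complex \<Rightarrow> ('a, 'b) tensor \<Rightarrow> ('a, 'b) tensor" is
  "\<lambda>c. image_mset (\<lambda>(a, b). (c *\<^sub>C a, b))"
  by (rule tensor_eq_image_left) (simp_all add: scaleC_add_right mult.commute)

definition uminus_tensor :: "('a, 'b) tensor \<Rightarrow> ('a, 'b) tensor" where
  "uminus_tensor u = (- 1) *\<^sub>C u"

definition minus_tensor :: "('a, 'b) tensor \<Rightarrow> ('a, 'b) tensor \<Rightarrow> ('a, 'b) tensor" where
  "minus_tensor u v = u + - v"

definition scaleR_tensor :: "real \<Rightarrow> ('a, 'b) tensor \<Rightarrow> ('a, 'b) tensor" where
  "scaleR_tensor r u = complex_of_real r *\<^sub>C u"

instance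
proof
  fix u v w :: "('a, 'b) tensor" and a b :: real and c d :: complex
  show "u + v + w = u + (v + w)" "u + v = v + u" "0 + u = u"
    by (transfer; simp add: add_ac tensor_eq.refl)+
  show "- u + u = 0"
    unfolding uminus_tensor_def by transfer (use tensor_eq_minus in simp)
  show "u - v = u + - v"
    by (simp add: minus_tensor_def)
  have add: "c *\<^sub>C (u + v) = c *\<^sub>C u + c *\<^sub>C v" for c and u v :: "('a, 'b) tensor"
    by transfer (simp add: tensor_eq.refl)
  have add': "(c + d) *\<^sub>C u = c *\<^sub>C u + d *\<^sub>C u" for c d and u :: "('a, 'b) tensor"
  proof transfer
    fix c d and M :: "('a \<times> 'b) multiset"
    show "tensor_eq (image_mset (\<lambda>(a, b). ((c + d) *\<^sub>C a, b)) M)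
      (image_mset (\<lambda>(a, b). (c *\<^sub>C a, b)) M + image_mset (\<lambda>(a, b). (d *\<^sub>C a, b)) M)"
    proof (induction M)
      case (add p M)
      obtain a b where p: "p = (a, b)" by (cases p)
      from tensor_eq.plus[OF tensor_eq.add_left[of "c *\<^sub>C a" "d *\<^sub>C a" b] add] show ?case
        by (simp add: p scaleC_add_left add_ac add_mset_commute)
    qed (simp add: tensor_eq.refl)
  qed
  have assoc: "c *\<^sub>C d *\<^sub>C u = (c * d) *\<^sub>C u" for c d and u :: "('a, 'b) tensor"
    by transfer (simp add: multiset.map_comp comp_def case_prod_unfold tensor_eq.refl)
  show "c *\<^sub>C (u + v) = c *\<^sub>C u + c *\<^sub>C v" "(c + d) *\<^sub>C u = c *\<^sub>C u + d *\<^sub>C u"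
    "c *\<^sub>C d *\<^sub>C u = (c * d) *\<^sub>C u" "complex_of_real a *\<^sub>C u = a *\<^sub>R u"
    by (fact add add' assoc scaleR_tensor_def[symmetric])+
  show "a *\<^sub>R (u + v) = a *\<^sub>R u + a *\<^sub>R v" "(a + b) *\<^sub>R u = a *\<^sub>R u + b *\<^sub>R u"
    "a *\<^sub>R b *\<^sub>R u = (a * b) *\<^sub>R u"
    by (simp_all add: scaleR_tensor_def add add' assoc)
  show "1 *\<^sub>R u = u"
    unfolding scaleR_tensor_def by transfer (simp add: tensor_eq.refl)
qed

end

lift_definition tensor_lmul ::
  "'a::complex_algebra \<Rightarrow> ('a, 'b::complex_vector) tensor \<Rightarrow> ('a, 'b) tensor" is
  "\<lambda>a. image_mset (\<lambda>(b, c). (a * b, c))"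
  by (rule tensor_eq_image_left) (simp_all add: distrib_left mult_scaleC_right)

lift_definition tensor_rmul ::
  "('a::complex_vector, 'b::complex_algebra) tensor \<Rightarrow> 'b \<Rightarrow> ('a, 'b) tensor" is
  "\<lambda>M a. image_mset (\<lambda>(b, c). (b, c * a)) M"
  by (rule tensor_eq_image_right) (simp_all add: distrib_right mult_scaleC_left)

lift_definition tensor_mult :: "('a::complex_algebra, 'a) tensor \<Rightarrow> 'a" is
  "\<lambda>M. \<Sum>(b, c)\<in>#M. b * c"
  subgoal for M N
    by (induction rule: tensor_eq.induct)
      (simp_all add: distrib_left distrib_right mult_scaleC_left mult_scaleC_right)
  done

text \<open>
  For complex subspaces \<open>A\<close>, \<open>B\<close> of vector spaces, the canonical map from the tensor product of
  \<open>A\<close> and \<open>B\<close> into the tensor product of the ambient spaces is injective, so the former can be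
  identified with the following subspace of the latter. In the projective norm, only
  representations with factors in \<open>A\<close> and \<open>B\<close> are admitted, so that it is the norm
  of the tensor product of \<open>A\<close> and \<open>B\<close>, not the one induced from the ambient spaces.
\<close>

definition algebraic_tensor ::
  "'a::complex_vector set \<Rightarrow> 'b::complex_vector set \<Rightarrow> ('a, 'b) tensor set" where
  "algebraic_tensor A B = {tensor_of M | M. set_mset M \<subseteq> A \<times> B}"

definition projective_norm ::
  "'a::complex_normed_vector set \<Rightarrow> 'b::complex_normed_vector set \<Rightarrow> ('a, 'b) tensor \<Rightarrow> real" where
  "projective_norm A B u =
     Inf {(\<Sum>(a, b)\<in>#M. norm a * norm b) | M. set_mset M \<subseteq> A \<times> B \<and> tensor_of M = u}"

lemma projective_reps:
  assumes "u \<in> algebraic_tensor A B"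
  shows "{(\<Sum>(a, b)\<in>#M. norm a * norm b) | M. set_mset M \<subseteq> A \<times> B \<and> tensor_of M = u} \<noteq> {}"
    and "bdd_below {(\<Sum>(a, b)\<in>#M. norm a * norm b) | M. set_mset M \<subseteq> A \<times> B \<and> tensor_of M = u}"
    and "0 \<le> projective_norm A B u"
proof -
  have nonneg: "0 \<le> (\<Sum>(a, b)\<in>#M. norm a * norm b)" for M :: "('a \<times> 'b) multiset"
    by (induction M) auto
  show ne: "{(\<Sum>(a, b)\<in>#M. norm a * norm b) | M. set_mset M \<subseteq> A \<times> B \<and> tensor_of M = u} \<noteq> {}"
    using assms by (auto simp: algebraic_tensor_def)
  show "bdd_below {(\<Sum>(a, b)\<in>#M. norm a * norm b) | M. set_mset M \<subseteq> A \<times> B \<and> tensor_of M = u}"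
    using nonneg by (intro bdd_belowI[of _ 0]) auto
  show "0 \<le> projective_norm A B u"
    unfolding projective_norm_def using ne nonneg by (intro cInf_greatest) auto
qed

lemma projective_norm_le:
  assumes "set_mset M \<subseteq> A \<times> B"
  shows "projective_norm A B (tensor_of M) \<le> (\<Sum>(a, b)\<in>#M. norm a * norm b)"
proof -
  have "tensor_of M \<in> algebraic_tensor A B"
    using assms by (auto simp: algebraic_tensor_def)
  then show ?thesis
    unfolding projective_norm_def using projective_reps(2) assms
    by (intro cInf_lower) auto
qed

lemma projective_norm_approx:
  assumes "u \<in> algebraic_tensor A B" "0 < e"
  obtains M where "set_mset M \<subseteq> A \<times> B" "tensor_of M = u"
    "(\<Sum>(a, b)\<in>#M. norm a * norm b) < projective_norm A B u + e"
proof -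
  have "Inf {(\<Sum>(a, b)\<in>#M. norm a * norm b) | M. set_mset M \<subseteq> A \<times> B \<and> tensor_of M = u}
      < projective_norm A B u + e"
    using assms(2) by (simp add: projective_norm_def)
  then show thesis
    using that by (subst (asm) cInf_less_iff) (use projective_reps[OF assms(1)] in auto)
qed

lemma projective_norm_leI:
  assumes "u \<in> algebraic_tensor A B"
    and "\<And>M. set_mset M \<subseteq> A \<times> B \<Longrightarrow> tensor_of M = u \<Longrightarrow> r \<le> K * (\<Sum>(a, b)\<in>#M. norm a * norm b)"
    and "0 \<le> K"
  shows "r \<le> K * projective_norm A B u"
proof (rule field_le_epsilon)
  fix e :: real assume "0 < e"
  with assms(3) have "0 < e / (K + 1)"
    by simp
  then obtain M where M: "set_mset M \<subseteq> A \<times> B" "tensor_of M = u"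
      "(\<Sum>(a, b)\<in>#M. norm a * norm b) < projective_norm A B u + e / (K + 1)"
    using projective_norm_approx[OF assms(1)] by blast
  have "r \<le> K * (\<Sum>(a, b)\<in>#M. norm a * norm b)"
    using assms(2) M by blast
  also have "\<dots> \<le> K * (projective_norm A B u + e / (K + 1))"
    using M(3) assms(3) by (intro mult_left_mono) auto
  also have "\<dots> \<le> K * projective_norm A B u + e"
    using \<open>0 < e\<close> assms(3) by (simp add: field_simps)
  finally show "r \<le> K * projective_norm A B u + e" .
qed

lemma algebraic_tensorI: "set_mset M \<subseteq> A \<times> B \<Longrightarrow> tensor_of M \<in> algebraic_tensor A B"
  by (auto simp: algebraic_tensor_def)

lemma algebraic_tensorE:
  assumes "u \<in> algebraic_tensor A B"
  obtains M where "set_mset M \<subseteq> A \<times> B" "u = tensor_of M"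
  using assms by (auto simp: algebraic_tensor_def)

lemma algebraic_tensor_add:
  "u \<in> algebraic_tensor A B \<Longrightarrow> v \<in> algebraic_tensor A B \<Longrightarrow> u + v \<in> algebraic_tensor A B"
  by (elim algebraic_tensorE) (simp add: plus_tensor.abs_eq algebraic_tensorI)

lemma algebraic_tensor_scaleC:
  assumes "complex_subspace A" "u \<in> algebraic_tensor A B"
  shows "c *\<^sub>C u \<in> algebraic_tensor A B"
  using assms(2)
proof (rule algebraic_tensorE)
  fix M assume M: "set_mset M \<subseteq> A \<times> B" "u = tensor_of M"
  show ?thesis
    unfolding M(2) scaleC_tensor.abs_eq
    by (rule algebraic_tensorI) (use M(1) assms(1) in \<open>auto simp: complex_subspace_def\<close>)
qed

lemma algebraic_tensor_diff:
  "complex_subspace A \<Longrightarrow> u \<in> algebraic_tensor A B \<Longrightarrow> v \<in> algebraic_tensor A B \<Longrightarrow>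
    u - v \<in> algebraic_tensor A B"
  unfolding minus_tensor_def uminus_tensor_def
  by (intro algebraic_tensor_add algebraic_tensor_scaleC)

lemma projective_norm_triangle:
  assumes "u \<in> algebraic_tensor A B" "v \<in> algebraic_tensor A B"
  shows "projective_norm A B (u + v) \<le> projective_norm A B u + projective_norm A B v"
proof (rule field_le_epsilon)
  fix e :: real assume "0 < e"
  then have "0 < e / 2" by simp
  from projective_norm_approx[OF assms(1) this] obtain M where M: "set_mset M \<subseteq> A \<times> B"
      "tensor_of M = u" "(\<Sum>(a, b)\<in>#M. norm a * norm b) < projective_norm A B u + e / 2" .
  from projective_norm_approx[OF assms(2) \<open>0 < e / 2\<close>] obtain N where N: "set_mset N \<subseteq> A \<times> B"
      "tensor_of N = v" "(\<Sum>(a, b)\<in>#N. norm a * norm b) < projective_norm A B v + e / 2" .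
  from M N show "projective_norm A B (u + v) \<le> projective_norm A B u + projective_norm A B v + e"
    using projective_norm_le[of "M + N" A B] by (auto simp: plus_tensor.abs_eq)
qed

lemma projective_norm_scaleC_le:
  assumes "complex_subspace A" "u \<in> algebraic_tensor A B"
  shows "projective_norm A B (c *\<^sub>C u) \<le> cmod c * projective_norm A B u"
proof (rule projective_norm_leI[OF assms(2)])
  fix M assume M: "set_mset M \<subseteq> A \<times> B" "tensor_of M = u"
  have "set_mset (image_mset (\<lambda>(a, b). (c *\<^sub>C a, b)) M) \<subseteq> A \<times> B"
    using M(1) assms(1) by (auto simp: complex_subspace_def)
  from projective_norm_le[OF this]
  show "projective_norm A B (c *\<^sub>C u) \<le> cmod c * (\<Sum>(a, b)\<in>#M. norm a * norm b)"
    unfolding M(2)[symmetric]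
    by (simp add: scaleC_tensor.abs_eq multiset.map_comp comp_def case_prod_unfold norm_scaleC
        sum_mset_distrib_left mult.assoc)
qed simp

lemma projective_norm_minus_commute:
  assumes "complex_subspace A" "u \<in> algebraic_tensor A B" "v \<in> algebraic_tensor A B"
  shows "projective_norm A B (u - v) = projective_norm A B (v - u)"
proof -
  have "projective_norm A B (u - v) \<le> projective_norm A B (v - u)"
    if "u \<in> algebraic_tensor A B" "v \<in> algebraic_tensor A B" for u v
    using projective_norm_scaleC_le[OF assms(1) algebraic_tensor_diff[OF assms(1) that(2,1)], of "- 1"]
    by simp
  then show ?thesis
    using assms by (simp add: antisym)
qed

lemma projective_norm_triangle_diff:
  assumes "complex_subspace A" "u \<in> algebraic_tensor A B" "v \<in> algebraic_tensor A B"
  shows "\<bar>projective_norm A B u - projective_norm A B v\<bar> \<le> projective_norm A B (u - v)"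
proof -
  note diff = algebraic_tensor_diff[OF assms(1)]
  have "projective_norm A B u \<le> projective_norm A B (u - v) + projective_norm A B v"
    using projective_norm_triangle[OF diff[OF assms(2,3)] assms(3)] by simp
  moreover have "projective_norm A B v \<le> projective_norm A B (v - u) + projective_norm A B u"
    using projective_norm_triangle[OF diff[OF assms(3,2)] assms(2)] by simp
  ultimately show ?thesis
    using projective_norm_minus_commute[OF assms] by linarith
qed

lemma algebraic_tensor_lmul:
  assumes "complex_subalgebra A" "a \<in> A" "u \<in> algebraic_tensor A B"
  shows "tensor_lmul a u \<in> algebraic_tensor A B"
  using assms(3)
proof (rule algebraic_tensorE)
  fix M assume M: "set_mset M \<subseteq> A \<times> B" "u = tensor_of M"
  show ?thesis
    unfolding M(2) tensor_lmul.abs_eq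
    by (rule algebraic_tensorI) (use M(1) assms in \<open>auto simp: complex_subalgebra_def\<close>)
qed

lemma algebraic_tensor_rmul:
  assumes "complex_subalgebra B" "b \<in> B" "u \<in> algebraic_tensor A B"
  shows "tensor_rmul u b \<in> algebraic_tensor A B"
  using assms(3)
proof (rule algebraic_tensorE)
  fix M assume M: "set_mset M \<subseteq> A \<times> B" "u = tensor_of M"
  show ?thesis
    unfolding M(2) tensor_rmul.abs_eq
    by (rule algebraic_tensorI) (use M(1) assms in \<open>auto simp: complex_subalgebra_def\<close>)
qed

lemma projective_norm_lmul_le:
  assumes "complex_subalgebra A" "a \<in> A" "u \<in> algebraic_tensor A B"
  shows "projective_norm A B (tensor_lmul a u)
    \<le> norm (a :: 'a::complex_banach_algebra) * projective_norm A B u"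
proof (rule projective_norm_leI[OF assms(3)])
  fix M assume M: "set_mset M \<subseteq> A \<times> B" "tensor_of M = u"
  have "set_mset (image_mset (\<lambda>(b, c). (a * b, c)) M) \<subseteq> A \<times> B"
    using M(1) assms by (auto simp: complex_subalgebra_def)
  from projective_norm_le[OF this]
  have "projective_norm A B (tensor_lmul a u) \<le> (\<Sum>(b, c)\<in>#M. norm (a * b) * norm c)"
    unfolding M(2)[symmetric]
    by (simp add: tensor_lmul.abs_eq multiset.map_comp comp_def case_prod_unfold)
  also have "\<dots> \<le> (\<Sum>(b, c)\<in>#M. norm a * (norm b * norm c))"
  proof (rule sum_mset_mono)
    fix p show "(case p of (b, c) \<Rightarrow> norm (a * b) * norm c) \<le> (case p of (b, c) \<Rightarrow> norm a * (norm b * norm c))"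
      by (cases p) (simp add: mult.assoc[symmetric] mult_right_mono norm_mult_ineq)
  qed
  finally show "projective_norm A B (tensor_lmul a u) \<le> norm a * (\<Sum>(a, b)\<in>#M. norm a * norm b)"
    by (simp add: sum_mset_distrib_left case_prod_unfold)
qed simp

lemma projective_norm_rmul_le:
  assumes "complex_subalgebra B" "b \<in> B" "u \<in> algebraic_tensor A B"
  shows "projective_norm A B (tensor_rmul u b)
    \<le> norm (b :: 'b::complex_banach_algebra) * projective_norm A B u"
proof (rule projective_norm_leI[OF assms(3)])
  fix M assume M: "set_mset M \<subseteq> A \<times> B" "tensor_of M = u"
  have "set_mset (image_mset (\<lambda>(a, c). (a, c * b)) M) \<subseteq> A \<times> B"
    using M(1) assms by (auto simp: complex_subalgebra_def)
  from projective_norm_le[OF this]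
  have "projective_norm A B (tensor_rmul u b) \<le> (\<Sum>(a, c)\<in>#M. norm a * norm (c * b))"
    unfolding M(2)[symmetric]
    by (simp add: tensor_rmul.abs_eq multiset.map_comp comp_def case_prod_unfold)
  also have "\<dots> \<le> (\<Sum>(a, c)\<in>#M. norm b * (norm a * norm c))"
  proof (rule sum_mset_mono)
    fix p show "(case p of (a, c) \<Rightarrow> norm a * norm (c * b)) \<le> (case p of (a, c) \<Rightarrow> norm b * (norm a * norm c))"
    proof (cases p)
      case (Pair a c)
      have "norm a * norm (c * b) \<le> norm a * (norm c * norm b)"
        by (intro mult_left_mono norm_mult_ineq) simp
      then show ?thesis
        by (simp add: Pair mult_ac)
    qed
  qed
  finally show "projective_norm A B (tensor_rmul u b) \<le> norm b * (\<Sum>(a, b)\<in>#M. norm a * norm b)"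
    by (simp add: sum_mset_distrib_left case_prod_unfold)
qed simp

lemma norm_tensor_mult_le:
  assumes "u \<in> algebraic_tensor A A"
  shows "norm (tensor_mult u :: 'a::complex_banach_algebra) \<le> projective_norm A A u"
proof -
  have "norm (tensor_mult u) \<le> 1 * projective_norm A A u"
  proof (rule projective_norm_leI[OF assms])
    fix M assume M: "set_mset M \<subseteq> A \<times> A" "tensor_of M = u"
    have "norm (\<Sum>(b, c)\<in>#M. b * c) \<le> (\<Sum>(b, c)\<in>#M. norm b * norm c)"
    proof (induction M)
      case (add p M)
      show ?case
        by (cases p) (use add in \<open>auto intro!: norm_triangle_mono norm_mult_ineq\<close>)
    qed simp
    then show "norm (tensor_mult u) \<le> 1 * (\<Sum>(a, b)\<in>#M. norm a * norm b)"
      unfolding M(2)[symmetric] by (simp add: tensor_mult.abs_eq)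
  qed simp
  then show ?thesis by simp
qed

lemma tensor_op_diff:
  shows "tensor_lmul a (u - v) = tensor_lmul a u - tensor_lmul a v"
    and "tensor_rmul (w - x) b = tensor_rmul w b - tensor_rmul x b"
    and "tensor_mult (y - z) = tensor_mult y - tensor_mult z"
proof -
  have add: "tensor_lmul a (u + v) = tensor_lmul a u + tensor_lmul a v"
    "tensor_rmul (w + x) b = tensor_rmul w b + tensor_rmul x b"
    "tensor_mult (y + z) = tensor_mult y + tensor_mult z" for u v w x y z
    by (transfer; simp add: tensor_eq.refl)+
  show "tensor_lmul a (u - v) = tensor_lmul a u - tensor_lmul a v"
    using add(1)[of "u - v" v] by (simp add: algebra_simps)
  show "tensor_rmul (w - x) b = tensor_rmul w b - tensor_rmul x b"
    using add(2)[of "w - x" x] by (simp add: algebra_simps)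
  show "tensor_mult (y - z) = tensor_mult y - tensor_mult z"
    using add(3)[of "y - z" z] by (simp add: algebra_simps)
qed


section \<open>Projective tensor products\<close>

text \<open>
  The completion of the algebraic tensor product in the projective norm: its elements are the
  classes of Cauchy sequences, modulo sequences tending to zero.
\<close>

type_synonym ('a, 'b) completed_tensor = "(nat \<Rightarrow> ('a, 'b) tensor) set"

definition projective_Cauchy ::
  "'a::complex_normed_vector set \<Rightarrow> 'b::complex_normed_vector set \<Rightarrow> (nat \<Rightarrow> ('a, 'b) tensor) \<Rightarrow> bool" where
  "projective_Cauchy A B u \<longleftrightarrow> (\<forall>n. u n \<in> algebraic_tensor A B) \<and>
     (\<forall>e>0. \<exists>N. \<forall>m\<ge>N. \<forall>n\<ge>N. projective_norm A B (u m - u n) < e)"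

definition projective_rel ::
  "'a::complex_normed_vector set \<Rightarrow> 'b::complex_normed_vector set \<Rightarrow>
    ((nat \<Rightarrow> ('a, 'b) tensor) \<times> (nat \<Rightarrow> ('a, 'b) tensor)) set" where
  "projective_rel A B = {(u, v). projective_Cauchy A B u \<and> projective_Cauchy A B v \<and>
     (\<lambda>n. projective_norm A B (u n - v n)) \<longlonglongrightarrow> 0}"

definition projective_tensor ::
  "'a::complex_normed_vector set \<Rightarrow> 'b::complex_normed_vector set \<Rightarrow> ('a, 'b) completed_tensor set" where
  "projective_tensor A B = {u. projective_Cauchy A B u} // projective_rel A B"

definition completed_norm ::
  "'a::complex_normed_vector set \<Rightarrow> 'b::complex_normed_vector set \<Rightarrow> ('a, 'b) completed_tensor \<Rightarrow> real" where
  "completed_norm A B d = (THE r. \<forall>u\<in>d. (\<lambda>n. projective_norm A B (u n)) \<longlonglongrightarrow> r)"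

definition completed_diff ::
  "'a::complex_normed_vector set \<Rightarrow> 'b::complex_normed_vector set \<Rightarrow>
    ('a, 'b) completed_tensor \<Rightarrow> ('a, 'b) completed_tensor \<Rightarrow> ('a, 'b) completed_tensor" where
  "completed_diff A B d e = (\<Union>u\<in>d. \<Union>v\<in>e. projective_rel A B `` {\<lambda>n. u n - v n})"

definition completed_lmul ::
  "'a::complex_banach_algebra set \<Rightarrow> 'a \<Rightarrow> ('a, 'a) completed_tensor \<Rightarrow> ('a, 'a) completed_tensor" where
  "completed_lmul A a d = (\<Union>u\<in>d. projective_rel A A `` {\<lambda>n. tensor_lmul a (u n)})"

definition completed_rmul ::
  "'a::complex_banach_algebra set \<Rightarrow> ('a, 'a) completed_tensor \<Rightarrow> 'a \<Rightarrow> ('a, 'a) completed_tensor" where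
  "completed_rmul A d a = (\<Union>u\<in>d. projective_rel A A `` {\<lambda>n. tensor_rmul (u n) a})"

definition completed_mult :: "('a::complex_banach_algebra, 'a) completed_tensor \<Rightarrow> 'a" where
  "completed_mult d = (THE x. \<forall>u\<in>d. (\<lambda>n. tensor_mult (u n)) \<longlonglongrightarrow> x)"

lemma projective_CauchyD: "projective_Cauchy A B u \<Longrightarrow> u n \<in> algebraic_tensor A B"
  by (simp add: projective_Cauchy_def)

lemma equiv_projective_rel:
  assumes A: "complex_subspace A"
  shows "equiv {u. projective_Cauchy A B u} (projective_rel A B)"
proof (rule equivI)
  show "projective_rel A B \<subseteq> {u. projective_Cauchy A B u} \<times> {u. projective_Cauchy A B u}"
    by (auto simp: projective_rel_def)
  have zero: "projective_norm A B 0 = 0"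
  proof (rule antisym)
    show "projective_norm A B 0 \<le> 0"
      using projective_norm_le[of "{#}" A B] by (simp add: zero_tensor_def)
    show "0 \<le> projective_norm A B 0"
      by (rule projective_reps) (auto simp: algebraic_tensor_def zero_tensor_def intro!: exI[of _ "{#}"])
  qed
  show "refl_on {u. projective_Cauchy A B u} (projective_rel A B)"
    by (auto simp: refl_on_def projective_rel_def zero)
  show "sym (projective_rel A B)"
  proof (rule symI)
    fix u v assume uv: "(u, v) \<in> projective_rel A B"
    then have "u n \<in> algebraic_tensor A B" "v n \<in> algebraic_tensor A B" for n
      by (auto simp: projective_rel_def projective_CauchyD)
    then have "projective_norm A B (v n - u n) = projective_norm A B (u n - v n)" for n
      by (intro projective_norm_minus_commute A)
    with uv show "(v, u) \<in> projective_rel A B"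
      by (simp add: projective_rel_def)
  qed
  show "trans (projective_rel A B)"
  proof (rule transI)
    fix u v w assume uv: "(u, v) \<in> projective_rel A B" and vw: "(v, w) \<in> projective_rel A B"
    then have uvw: "u n \<in> algebraic_tensor A B" "v n \<in> algebraic_tensor A B" "w n \<in> algebraic_tensor A B" for n
      by (auto simp: projective_rel_def projective_CauchyD)
    have "(\<lambda>n. projective_norm A B (u n - w n)) \<longlonglongrightarrow> 0"
    proof (rule tendsto_sandwich)
      show "\<forall>\<^sub>F n in sequentially. 0 \<le> projective_norm A B (u n - w n)"
        using uvw A by (auto intro!: always_eventually projective_reps(3) algebraic_tensor_diff)
      have "projective_norm A B (u n - w n) \<le> projective_norm A B (u n - v n) + projective_norm A B (v n - w n)" for n
        using projective_norm_triangle[of "u n - v n" A B "v n - w n"] uvw A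
        by (simp add: algebraic_tensor_diff)
      then show "\<forall>\<^sub>F n in sequentially. projective_norm A B (u n - w n)
          \<le> projective_norm A B (u n - v n) + projective_norm A B (v n - w n)"
        by simp
      show "(\<lambda>n. projective_norm A B (u n - v n) + projective_norm A B (v n - w n)) \<longlonglongrightarrow> 0"
        using uv vw tendsto_add[of _ 0 _ _ 0] by (fastforce simp: projective_rel_def)
    qed simp
    then show "(u, w) \<in> projective_rel A B"
      using uv vw by (auto simp: projective_rel_def)
  qed
qed

lemma projective_Cauchy_norm:
  assumes A: "complex_subspace A" and u: "projective_Cauchy A B u"
  shows "convergent (\<lambda>n. projective_norm A B (u n))"
proof (rule real_Cauchy_convergent[OF CauchyI])
  fix e :: real assume "0 < e"
  then obtain N where "\<forall>m\<ge>N. \<forall>n\<ge>N. projective_norm A B (u m - u n) < e"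
    using u by (auto simp: projective_Cauchy_def)
  then show "\<exists>N. \<forall>m\<ge>N. \<forall>n\<ge>N. norm (projective_norm A B (u m) - projective_norm A B (u n)) < e"
    using projective_norm_triangle_diff[OF A projective_CauchyD[OF u] projective_CauchyD[OF u]]
    by (metis order_le_less_trans real_norm_def)
qed

lemma completed_norm_class:
  assumes A: "complex_subspace A" and u: "projective_Cauchy A B u"
  shows "completed_norm A B (projective_rel A B `` {u}) = lim (\<lambda>n. projective_norm A B (u n))"
proof -
  have lim: "(\<lambda>n. projective_norm A B (u n)) \<longlonglongrightarrow> lim (\<lambda>n. projective_norm A B (u n))"
    using projective_Cauchy_norm[OF assms] by (simp add: convergent_LIMSEQ_iff)
  have uu: "u \<in> projective_rel A B `` {u}"
    using equiv_class_self[OF equiv_projective_rel[OF A]] u by blast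
  have "(\<lambda>n. projective_norm A B (v n)) \<longlonglongrightarrow> lim (\<lambda>n. projective_norm A B (u n))"
    if v: "v \<in> projective_rel A B `` {u}" for v
  proof -
    from v have v': "projective_Cauchy A B v" "(\<lambda>n. projective_norm A B (u n - v n)) \<longlonglongrightarrow> 0"
      by (auto simp: projective_rel_def)
    have "(\<lambda>n. projective_norm A B (u n) - projective_norm A B (v n)) \<longlonglongrightarrow> 0"
    proof (rule Lim_null_comparison[OF _ v'(2)])
      show "\<forall>\<^sub>F n in sequentially. norm (projective_norm A B (u n) - projective_norm A B (v n))
          \<le> projective_norm A B (u n - v n)"
        using projective_norm_triangle_diff[OF A projective_CauchyD[OF u] projective_CauchyD[OF v'(1)]]
        by simp
    qed
    from tendsto_diff[OF lim this] show ?thesis by simp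
  qed
  then show ?thesis
    unfolding completed_norm_def using uu LIMSEQ_unique by (intro the_equality) blast+
qed

lemma projective_rel_map:
  assumes "complex_subspace A" "(u, v) \<in> projective_rel A B"
    and "\<And>x. x \<in> algebraic_tensor A B \<Longrightarrow> f x \<in> algebraic_tensor A B"
    and "\<And>x. x \<in> algebraic_tensor A B \<Longrightarrow> projective_norm A B (f x) \<le> K * projective_norm A B x"
    and "\<And>x y. f (x - y) = f x - f y" and "0 \<le> K"
  shows "(\<lambda>n. f (u n), \<lambda>n. f (v n)) \<in> projective_rel A B"
proof -
  have C: "projective_Cauchy A B (\<lambda>n. f (w n))" if w: "projective_Cauchy A B w" for w
    unfolding projective_Cauchy_def
  proof (intro conjI allI impI)
    show "f (w n) \<in> algebraic_tensor A B" for n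
      using assms(3) projective_CauchyD[OF w] by blast
    fix e :: real assume e: "0 < e"
    then have "0 < e / (K + 1)"
      using assms(6) by simp
    then obtain N where N: "\<And>m n. m \<ge> N \<Longrightarrow> n \<ge> N \<Longrightarrow> projective_norm A B (w m - w n) < e / (K + 1)"
      using w unfolding projective_Cauchy_def by blast
    have "projective_norm A B (f (w m) - f (w n)) < e" if "m \<ge> N" "n \<ge> N" for m n
    proof -
      have mn: "w m - w n \<in> algebraic_tensor A B"
        by (intro algebraic_tensor_diff assms projective_CauchyD[OF w])
      have "projective_norm A B (f (w m) - f (w n)) \<le> K * projective_norm A B (w m - w n)"
        using assms(4)[OF mn] assms(5) by simp
      also have "\<dots> \<le> (K + 1) * projective_norm A B (w m - w n)"
        using projective_reps(3)[OF mn] by (intro mult_right_mono) auto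
      also have "\<dots> < (K + 1) * (e / (K + 1))"
        using N[OF that] assms(6) by (intro mult_strict_left_mono) auto
      finally show ?thesis
        using assms(6) by simp
    qed
    then show "\<exists>N. \<forall>m\<ge>N. \<forall>n\<ge>N. projective_norm A B (f (w m) - f (w n)) < e"
      by blast
  qed
  from assms(2) have uv: "projective_Cauchy A B u" "projective_Cauchy A B v"
      "(\<lambda>n. projective_norm A B (u n - v n)) \<longlonglongrightarrow> 0"
    by (auto simp: projective_rel_def)
  have mn: "u n - v n \<in> algebraic_tensor A B" for n
    by (intro algebraic_tensor_diff assms projective_CauchyD[OF uv(1)] projective_CauchyD[OF uv(2)])
  have "(\<lambda>n. projective_norm A B (f (u n) - f (v n))) \<longlonglongrightarrow> 0"
  proof (rule Lim_null_comparison)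
    show "\<forall>\<^sub>F n in sequentially. norm (projective_norm A B (f (u n) - f (v n)))
        \<le> K * projective_norm A B (u n - v n)"
      using assms(4)[OF mn] projective_reps(3)[OF assms(3)[OF mn]] assms(5) by simp
    show "(\<lambda>n. K * projective_norm A B (u n - v n)) \<longlonglongrightarrow> 0"
      using tendsto_mult_left[OF uv(3), of K] by simp
  qed
  then show ?thesis
    using C uv by (simp add: projective_rel_def)
qed

lemma completed_diff_class:
  assumes A: "complex_subspace A" and u: "projective_Cauchy A B u" and v: "projective_Cauchy A B v"
  shows "projective_Cauchy A B (\<lambda>n. u n - v n)"
    and "completed_diff A B (projective_rel A B `` {u}) (projective_rel A B `` {v}) =
      projective_rel A B `` {\<lambda>n. u n - v n}"
proof -
  have tri: "projective_norm A B ((x - y) - (x' - y')) \<le> projective_norm A B (x - x') + projective_norm A B (y - y')"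
    if "x \<in> algebraic_tensor A B" "y \<in> algebraic_tensor A B" "x' \<in> algebraic_tensor A B" "y' \<in> algebraic_tensor A B"
    for x y x' y'
  proof -
    have eq: "(x - y) - (x' - y') = (x - x') + (y' - y)"
      by simp
    have "projective_norm A B ((x - x') + (y' - y))
        \<le> projective_norm A B (x - x') + projective_norm A B (y' - y)"
      by (intro projective_norm_triangle algebraic_tensor_diff A that)
    then show ?thesis
      unfolding eq projective_norm_minus_commute[OF A that(2,4)] .
  qed
  have C: "projective_Cauchy A B (\<lambda>n. u n - v n)"
    if u: "projective_Cauchy A B u" and v: "projective_Cauchy A B v" for u v
    unfolding projective_Cauchy_def
  proof (intro conjI allI impI)
    show "u n - v n \<in> algebraic_tensor A B" for n
      by (intro algebraic_tensor_diff A projective_CauchyD[OF u] projective_CauchyD[OF v])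
    fix e :: real assume "0 < e"
    then have e: "0 < e / 2" by simp
    obtain N where N: "\<And>m n. m \<ge> N \<Longrightarrow> n \<ge> N \<Longrightarrow> projective_norm A B (u m - u n) < e / 2"
      using u e unfolding projective_Cauchy_def by blast
    obtain N' where N': "\<And>m n. m \<ge> N' \<Longrightarrow> n \<ge> N' \<Longrightarrow> projective_norm A B (v m - v n) < e / 2"
      using v e unfolding projective_Cauchy_def by blast
    show "\<exists>N. \<forall>m\<ge>N. \<forall>n\<ge>N. projective_norm A B (u m - v m - (u n - v n)) < e"
    proof (intro exI[of _ "max N N'"] allI impI)
      fix m n assume mn: "max N N' \<le> m" "max N N' \<le> n"
      then show "projective_norm A B (u m - v m - (u n - v n)) < e"
        using tri[OF projective_CauchyD[OF u] projective_CauchyD[OF v] projective_CauchyD[OF u]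
            projective_CauchyD[OF v], of m m n n] N[of m n] N'[of m n]
        by auto
    qed
  qed
  show "projective_Cauchy A B (\<lambda>n. u n - v n)"
    using C u v .
  have rel: "(\<lambda>n. u n - v n, \<lambda>n. u' n - v' n) \<in> projective_rel A B"
    if "(u, u') \<in> projective_rel A B" "(v, v') \<in> projective_rel A B" for u u' v v'
  proof -
    from that have uv: "projective_Cauchy A B u" "projective_Cauchy A B v"
        "projective_Cauchy A B u'" "projective_Cauchy A B v'"
        "(\<lambda>n. projective_norm A B (u n - u' n)) \<longlonglongrightarrow> 0" "(\<lambda>n. projective_norm A B (v n - v' n)) \<longlonglongrightarrow> 0"
      by (auto simp: projective_rel_def)
    have "(\<lambda>n. projective_norm A B ((u n - v n) - (u' n - v' n))) \<longlonglongrightarrow> 0"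
    proof (rule Lim_null_comparison)
      have "0 \<le> projective_norm A B ((u n - v n) - (u' n - v' n))" for n
        by (intro projective_reps(3) algebraic_tensor_diff A uv(1-4)[THEN projective_CauchyD])
      then show "\<forall>\<^sub>F n in sequentially. norm (projective_norm A B ((u n - v n) - (u' n - v' n)))
          \<le> projective_norm A B (u n - u' n) + projective_norm A B (v n - v' n)"
        using tri[OF uv(1-4)[THEN projective_CauchyD]] by simp
      show "(\<lambda>n. projective_norm A B (u n - u' n) + projective_norm A B (v n - v' n)) \<longlonglongrightarrow> 0"
        using tendsto_add[OF uv(5,6)] by simp
    qed
    then show ?thesis
      using C uv by (simp add: projective_rel_def)
  qed
  note eq = equiv_projective_rel[OF A, of B]
  have "congruent2 (projective_rel A B) (projective_rel A B) (\<lambda>u v. projective_rel A B `` {\<lambda>n. u n - v n})"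
    by (rule congruent2I') (use rel equiv_class_eq[OF eq] in blast)
  then show "completed_diff A B (projective_rel A B `` {u}) (projective_rel A B `` {v}) =
      projective_rel A B `` {\<lambda>n. u n - v n}"
    unfolding completed_diff_def using UN_equiv_class2[OF eq eq] u v by blast
qed

lemma completed_mul_class:
  assumes A: "complex_subalgebra A" and a: "a \<in> A" and u: "projective_Cauchy A A u"
  shows "projective_Cauchy A A (\<lambda>n. tensor_lmul a (u n))"
    and "projective_Cauchy A A (\<lambda>n. tensor_rmul (u n) a)"
    and "completed_lmul A a (projective_rel A A `` {u}) = projective_rel A A `` {\<lambda>n. tensor_lmul a (u n)}"
    and "completed_rmul A (projective_rel A A `` {u}) a = projective_rel A A `` {\<lambda>n. tensor_rmul (u n) a}"
proof -
  have A': "complex_subspace A"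
    using A by (simp add: complex_subalgebra_def)
  note eq = equiv_projective_rel[OF A', of A]
  have l: "(\<lambda>n. tensor_lmul a (u n), \<lambda>n. tensor_lmul a (v n)) \<in> projective_rel A A"
    if "(u, v) \<in> projective_rel A A" for u v
    by (rule projective_rel_map[OF A' that, of _ "norm a"])
      (use A a in \<open>auto intro: algebraic_tensor_lmul projective_norm_lmul_le tensor_op_diff\<close>)
  have r: "(\<lambda>n. tensor_rmul (u n) a, \<lambda>n. tensor_rmul (v n) a) \<in> projective_rel A A"
    if "(u, v) \<in> projective_rel A A" for u v
    by (rule projective_rel_map[OF A' that, of "\<lambda>x. tensor_rmul x a" "norm a"])
      (use A a in \<open>auto intro: algebraic_tensor_rmul projective_norm_rmul_le tensor_op_diff\<close>)
  have "(u, u) \<in> projective_rel A A"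
    using eq u by (auto simp: equiv_def refl_on_def)
  from l[OF this] r[OF this] show "projective_Cauchy A A (\<lambda>n. tensor_lmul a (u n))"
    "projective_Cauchy A A (\<lambda>n. tensor_rmul (u n) a)"
    by (auto simp: projective_rel_def)
  have "congruent (projective_rel A A) (\<lambda>u. projective_rel A A `` {\<lambda>n. tensor_lmul a (u n)})"
    by (rule congruentI) (use l equiv_class_eq[OF eq] in blast)
  then show "completed_lmul A a (projective_rel A A `` {u}) = projective_rel A A `` {\<lambda>n. tensor_lmul a (u n)}"
    unfolding completed_lmul_def using UN_equiv_class[OF eq] u by blast
  have "congruent (projective_rel A A) (\<lambda>u. projective_rel A A `` {\<lambda>n. tensor_rmul (u n) a})"
    by (rule congruentI) (use r equiv_class_eq[OF eq] in blast)
  then show "completed_rmul A (projective_rel A A `` {u}) a = projective_rel A A `` {\<lambda>n. tensor_rmul (u n) a}"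
    unfolding completed_rmul_def using UN_equiv_class[OF eq] u by blast
qed

lemma completed_mult_class:
  assumes A: "complex_subspace A" and u: "projective_Cauchy A A u"
  shows "(\<lambda>n. tensor_mult (u n)) \<longlonglongrightarrow> completed_mult (projective_rel A A `` {u})"
proof -
  have "Cauchy (\<lambda>n. tensor_mult (u n))"
  proof (rule CauchyI)
    fix e :: real assume "0 < e"
    then obtain N where N: "\<And>m n. m \<ge> N \<Longrightarrow> n \<ge> N \<Longrightarrow> projective_norm A A (u m - u n) < e"
      using u unfolding projective_Cauchy_def by blast
    have "norm (tensor_mult (u m) - tensor_mult (u n)) \<le> projective_norm A A (u m - u n)" for m n
      unfolding tensor_op_diff(3)[symmetric]
      by (intro norm_tensor_mult_le algebraic_tensor_diff A projective_CauchyD[OF u])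
    then show "\<exists>N. \<forall>m\<ge>N. \<forall>n\<ge>N. norm (tensor_mult (u m) - tensor_mult (u n)) < e"
      using N order_le_less_trans by blast
  qed
  then obtain x where x: "(\<lambda>n. tensor_mult (u n)) \<longlonglongrightarrow> x"
    using Cauchy_convergent convergent_def by blast
  have uu: "u \<in> projective_rel A A `` {u}"
    using equiv_class_self[OF equiv_projective_rel[OF A]] u by blast
  have "(\<lambda>n. tensor_mult (v n)) \<longlonglongrightarrow> x" if v: "v \<in> projective_rel A A `` {u}" for v
  proof -
    from v have v': "projective_Cauchy A A v" "(\<lambda>n. projective_norm A A (u n - v n)) \<longlonglongrightarrow> 0"
      by (auto simp: projective_rel_def)
    have "norm (tensor_mult (u n) - tensor_mult (v n)) \<le> projective_norm A A (u n - v n)" for n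
      unfolding tensor_op_diff(3)[symmetric]
      by (intro norm_tensor_mult_le algebraic_tensor_diff A projective_CauchyD[OF u] projective_CauchyD[OF v'(1)])
    then have "(\<lambda>n. tensor_mult (u n) - tensor_mult (v n)) \<longlonglongrightarrow> 0"
      by (intro Lim_null_comparison[OF _ v'(2)]) simp
    from tendsto_diff[OF x this] show ?thesis by simp
  qed
  then have "completed_mult (projective_rel A A `` {u}) = x"
    unfolding completed_mult_def using uu LIMSEQ_unique by (intro the_equality) blast+
  with x show ?thesis by simp
qed


section \<open>Amenability and approximate amenability\<close>

text \<open>
  A net is rendered as a family together with a proper filter on its index type: a net over a
  directed set gives the filter generated by its tails, and every proper filter arises from a net.
  The set \<open>A\<close> is meant to be a closed subalgebra of the ambient Banach algebra.
\<close>

definition approximate_diagonal ::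
  "'a::complex_banach_algebra set \<Rightarrow> 'i filter \<Rightarrow> ('i \<Rightarrow> ('a, 'a) completed_tensor) \<Rightarrow> bool" where
  "approximate_diagonal A F d \<longleftrightarrow> F \<noteq> bot \<and> (\<forall>i. d i \<in> projective_tensor A A) \<and>
     (\<forall>a\<in>A. ((\<lambda>i. completed_norm A A
                (completed_diff A A (completed_lmul A a (d i)) (completed_rmul A (d i) a))) \<longlongrightarrow> 0) F) \<and>
     (\<forall>a\<in>A. ((\<lambda>i. norm (a * completed_mult (d i) - a)) \<longlongrightarrow> 0) F)"

text \<open>
  A definition cannot quantify over the index type; \<open>approximate_diagonal_reindex\<close> shows that
  using the elements of the tensor product themselves as indices loses no generality.
\<close>

definition has_approximate_diagonal :: "'a::complex_banach_algebra set \<Rightarrow> bool" where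
  "has_approximate_diagonal A \<longleftrightarrow>
     (\<exists>(F :: ('a, 'a) completed_tensor filter) d. approximate_diagonal A F d)"

definition amenable :: "'a::complex_banach_algebra set \<Rightarrow> bool" where
  "amenable A \<longleftrightarrow>
     (\<exists>(F :: ('a, 'a) completed_tensor filter) d.
        approximate_diagonal A F d \<and> (\<exists>C. \<forall>i. completed_norm A A (d i) \<le> C))"

lemma approximate_diagonal_reindex:
  fixes A :: "'a::complex_banach_algebra set"
  assumes "approximate_diagonal A (F :: 'i filter) d"
  obtains G :: "('a, 'a) completed_tensor filter" and e
  where "approximate_diagonal A G e" "range e \<subseteq> range d"
proof -
  define e where "e x = (if x \<in> range d then x else d undefined)" for x
  have ed: "e (d i) = d i" for i
    by (simp add: e_def)
  have er: "e x \<in> range d" for x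
    by (simp add: e_def)
  have "\<forall>i. d i \<in> projective_tensor A A"
    using assms by (simp add: approximate_diagonal_def)
  then have "\<forall>x. e x \<in> projective_tensor A A"
    by (auto simp: e_def)
  then have "approximate_diagonal A (filtermap d F) e"
    using assms by (simp add: approximate_diagonal_def filtermap_bot_iff filterlim_filtermap ed)
  moreover have "range e \<subseteq> range d"
    using er by auto
  ultimately show thesis
    using that[of "filtermap d F" e] by blast
qed

text \<open>The forced unitization, with the norm \<open>\<parallel>a\<parallel> + \<bar>c\<bar>\<close>.\<close>

datatype 'a unitization = Unitization (vector_part: 'a) (scalar_part: complex)

instantiation unitization :: (complex_banach_algebra)
  "{complex_algebra, complex_normed_vector, real_normed_algebra, ring_1}"
begin

definition "0 = Unitization 0 0"
definition "1 = Unitization 0 1"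
definition "x + y = Unitization (vector_part x + vector_part y) (scalar_part x + scalar_part y)"
definition "x - y = Unitization (vector_part x - vector_part y) (scalar_part x - scalar_part y)"
definition "- x = Unitization (- vector_part x) (- scalar_part x)"
definition "r *\<^sub>R x = Unitization (r *\<^sub>R vector_part x) (r *\<^sub>R scalar_part x)"
definition "c *\<^sub>C x = Unitization (c *\<^sub>C vector_part x) (c * scalar_part x)"
definition "x * y = Unitization
  (vector_part x * vector_part y + scalar_part x *\<^sub>C vector_part y + scalar_part y *\<^sub>C vector_part x)
  (scalar_part x * scalar_part y)"
definition "norm x = norm (vector_part x) + cmod (scalar_part x)"
definition "dist (x :: 'a unitization) y = norm (x - y)"
definition "sgn (x :: 'a unitization) = inverse (norm x) *\<^sub>R x"
definition "(uniformity :: ('a unitization \<times> 'a unitization) filter) =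
  (INF e\<in>{0 <..}. principal {(x, y). dist x y < e})"
definition "open (U :: 'a unitization set) \<longleftrightarrow>
  (\<forall>x\<in>U. eventually (\<lambda>(x', y). x' = x \<longrightarrow> y \<in> U) uniformity)"

lemmas unitization_ops =
  zero_unitization_def one_unitization_def plus_unitization_def minus_unitization_def
  uminus_unitization_def scaleR_unitization_def scaleC_unitization_def times_unitization_def
  norm_unitization_def

instance
proof
  fix x y z :: "'a unitization" and a b :: real and c d :: complex and U :: "'a unitization set"
  show "x + y + z = x + (y + z)" "x + y = y + x" "0 + x = x" "- x + x = 0" "x - y = x + - y"
    "(0 :: 'a unitization) \<noteq> 1"
    by (simp_all add: unitization_ops add_ac)
  show "a *\<^sub>R (x + y) = a *\<^sub>R x + a *\<^sub>R y" "(a + b) *\<^sub>R x = a *\<^sub>R x + b *\<^sub>R x"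
    "a *\<^sub>R b *\<^sub>R x = (a * b) *\<^sub>R x" "1 *\<^sub>R x = x"
    by (simp_all add: unitization_ops algebra_simps)
  show "c *\<^sub>C (x + y) = c *\<^sub>C x + c *\<^sub>C y" "(c + d) *\<^sub>C x = c *\<^sub>C x + d *\<^sub>C x"
    "c *\<^sub>C d *\<^sub>C x = (c * d) *\<^sub>C x" "complex_of_real a *\<^sub>C x = a *\<^sub>R x"
    by (simp_all add: unitization_ops scaleC_add_left scaleC_add_right scaleC_of_real
        algebra_simps scaleR_conv_of_real)
  note alg = unitization_ops scaleC_add_left scaleC_add_right mult_scaleC_left mult_scaleC_right
    distrib_left distrib_right mult.assoc
  show "x * y * z = x * (y * z)"
    by (simp add: alg add_ac mult_ac)
  show "(x + y) * z = x * z + y * z" "x * (y + z) = x * y + x * z"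
    by (simp_all add: alg add_ac)
  show "1 * x = x" "x * 1 = x"
    by (simp_all add: alg)
  have mult_scaleC: "(c *\<^sub>C x) * y = c *\<^sub>C (x * y)" "x * (c *\<^sub>C y) = c *\<^sub>C (x * y)" for c
    by (simp_all add: alg mult_ac)
  then show "(c *\<^sub>C x) * y = c *\<^sub>C (x * y)" "x * (c *\<^sub>C y) = c *\<^sub>C (x * y)" .
  have scaleR: "a *\<^sub>R x = complex_of_real a *\<^sub>C x" for x :: "'a unitization"
    by (simp add: unitization_ops scaleC_of_real scaleR_conv_of_real)
  show "(a *\<^sub>R x) * y = a *\<^sub>R (x * y)" "x * (a *\<^sub>R y) = a *\<^sub>R (x * y)"
    by (simp_all only: scaleR mult_scaleC)
  show "norm (c *\<^sub>C x) = cmod c * norm x" "norm (a *\<^sub>R x) = \<bar>a\<bar> * norm x"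
    by (simp_all add: unitization_ops norm_scaleC norm_mult distrib_left)
  show "norm x = 0 \<longleftrightarrow> x = 0"
    by (cases x) (simp add: unitization_ops add_nonneg_eq_0_iff)
  show "norm (x + y) \<le> norm x + norm y"
    using norm_triangle_ineq[of "vector_part x" "vector_part y"]
      norm_triangle_ineq[of "scalar_part x" "scalar_part y"]
    by (simp add: unitization_ops)
  show "norm (x * y) \<le> norm x * norm y"
  proof -
    have "norm (vector_part (x * y)) \<le> norm (vector_part x * vector_part y)
        + norm (scalar_part x *\<^sub>C vector_part y) + norm (scalar_part y *\<^sub>C vector_part x)"
      by (simp add: times_unitization_def) (intro norm_triangle_mono order_refl)
    also have "\<dots> \<le> norm (vector_part x) * norm (vector_part y)
        + cmod (scalar_part x) * norm (vector_part y) + cmod (scalar_part y) * norm (vector_part x)"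
      by (simp add: norm_scaleC norm_mult_ineq)
    finally show ?thesis
      by (simp add: norm_unitization_def times_unitization_def norm_mult algebra_simps)
  qed
  show "dist x y = norm (x - y)" "sgn x = inverse (norm x) *\<^sub>R x"
    by (simp_all add: dist_unitization_def sgn_unitization_def)
  show "(uniformity :: ('a unitization \<times> 'a unitization) filter)
      = (INF e\<in>{0 <..}. principal {(x, y). dist x y < e})"
    by (simp add: uniformity_unitization_def)
  show "open U \<longleftrightarrow> (\<forall>x\<in>U. eventually (\<lambda>(x', y). x' = x \<longrightarrow> y \<in> U) uniformity)"
    by (simp add: open_unitization_def)
qed

end

instance unitization :: (complex_banach_algebra) complex_banach_algebra
proof
  fix X :: "nat \<Rightarrow> 'a unitization" assume X: "Cauchy X"
  have dist: "dist x y = dist (vector_part x) (vector_part y) + dist (scalar_part x) (scalar_part y)"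
    for x y :: "'a unitization"
    by (simp add: dist_unitization_def unitization_ops dist_norm)
  have le: "dist (vector_part x) (vector_part y) \<le> dist x y" "dist (scalar_part x) (scalar_part y) \<le> dist x y"
    for x y :: "'a unitization"
    by (simp_all add: dist)
  have "Cauchy (\<lambda>n. vector_part (X n))" "Cauchy (\<lambda>n. scalar_part (X n))"
    using X le unfolding Cauchy_def by (meson order_le_less_trans)+
  then obtain v c where vc: "(\<lambda>n. vector_part (X n)) \<longlonglongrightarrow> v" "(\<lambda>n. scalar_part (X n)) \<longlonglongrightarrow> c"
    by (meson Cauchy_convergent convergent_def)
  have "(\<lambda>n. dist (vector_part (X n)) v + dist (scalar_part (X n)) c) \<longlonglongrightarrow> 0 + 0"
    by (intro tendsto_add) (use vc in \<open>simp_all add: tendsto_dist_iff[symmetric]\<close>)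
  then have "X \<longlonglongrightarrow> Unitization v c"
    by (subst tendsto_dist_iff) (simp add: dist)
  then show "convergent X"
    by (rule convergentI)
qed

definition unitization_set :: "'a set \<Rightarrow> 'a unitization set" where
  "unitization_set A = {x. vector_part x \<in> A}"

definition approximately_amenable :: "'a::complex_banach_algebra set \<Rightarrow> bool" where
  "approximately_amenable A \<longleftrightarrow> has_approximate_diagonal (unitization_set A)"

end

theory Submission
  imports Defs
begin

text \<open>
  Every representable \<open>T\<close> is approximated in norm by \<open>T P\<close> with \<open>P\<close> a contractive representable
  projection averaging over a countable measurable partition, and one \<open>P\<close> serves finitely many
  \<open>T\<close>; so the ideal of representable operators has a bounded right approximate identity. If
  \<open>\<Sum> a\<^sub>k \<otimes> b\<^sub>k\<close> is an almost diagonal element, then, with \<open>P\<close> chosen for the finitely many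
  representable operators \<open>T a\<^sub>k\<close>, the operator \<open>U = \<Sum> a\<^sub>k P b\<^sub>k\<close> is representable, almost commutes
  with \<open>T\<close>, and \<open>T U\<close> is close to \<open>\<Sum> T a\<^sub>k b\<^sub>k\<close>, hence to \<open>T\<close>. So \<open>U T\<close> is close to \<open>T\<close>. If
  \<open>T\<close> maps the unit ball onto a set whose closure contains the unit ball, this makes \<open>U\<close> close to
  the identity. But the kernel of a representable \<open>U\<close> is almost constant on some set of positive
  measure, so \<open>U\<close> almost identifies the normalized indicators of two disjoint parts of this set,
  which are at distance \<open>2\<close>.
\<close>

section \<open>Bounded operators on complex Banach spaces\<close>

lemma bop_eqI: "(\<And>x. bop_apply S x = bop_apply T x) \<Longrightarrow> S = T"
  by transfer (auto intro: blinfun_eqI)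

lemma bop_apply_simps [simp]:
  "bop_apply (S + T) x = bop_apply S x + bop_apply T x"
  "bop_apply (S - T) x = bop_apply S x - bop_apply T x"
  "bop_apply (S * T) x = bop_apply S (bop_apply T x)"
  "bop_apply 0 x = 0"
  by (transfer; simp add: blinfun.add_left blinfun.diff_left)+

lemma bop_apply_scaleC: "bop_apply T (c *\<^sub>C x) = c *\<^sub>C bop_apply T x"
  by transfer simp

lemma bounded_linear_bop_apply: "bounded_linear (bop_apply T)"
  by transfer (rule blinfun.bounded_linear_right)

lemma norm_bop_apply: "norm (bop_apply T x) \<le> norm T * norm x"
  by transfer (rule norm_blinfun)

lemma norm_bop_le: "0 \<le> K \<Longrightarrow> (\<And>x. norm (bop_apply T x) \<le> K * norm x) \<Longrightarrow> norm T \<le> K"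
  by transfer (rule norm_blinfun_bound)

lemma bop_exists:
  assumes "\<And>x y. F (x + y) = F x + F y" "\<And>c x. F (c *\<^sub>C x) = c *\<^sub>C F x" "\<And>x. norm (F x) \<le> norm x * K"
  obtains T where "\<And>x. bop_apply T x = F x"
proof
  have F: "bounded_linear F"
    by (rule bounded_linear_intro[of _ K]) (use assms in \<open>simp_all add: scaleC_of_real[symmetric]\<close>)
  show "bop_apply (bop_of_blinfun (Blinfun F)) x = F x" for x
    unfolding bop_apply.rep_eq
    by (subst bop_of_blinfun_inverse) (simp_all add: bounded_linear_Blinfun_apply F assms(2))
qed

section \<open>Integrals of vector-valued kernels\<close>

lemma finite_measure_unit: "finite_measure unit_measure"
  by (rule finite_measureI) (simp add: space_restrict_space emeasure_restrict_space)

interpretation unit: finite_measure unit_measure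
  by (rule finite_measure_unit)

lemma space_unit [simp]: "space unit_measure = {0..1}"
  by (simp add: space_restrict_space)

text \<open>Borel measurability stands in for strong measurability: \<open>L1\<close> is second
  countable, so for \<open>L1\<close>-valued functions the two notions coincide, and the Borel one
  passes directly through limits and compositions.\<close>

definition bounded_kernel :: "(real \<Rightarrow> 'a::real_normed_vector) \<Rightarrow> real \<Rightarrow> bool" where
  "bounded_kernel h C \<longleftrightarrow> h \<in> borel_measurable unit_measure \<and> (\<forall>s\<in>{0..1}. norm (h s) \<le> C)"

lemma bounded_bilinear_scaleC:
  "bounded_bilinear (\<lambda>(c :: complex) (x :: 'a::complex_normed_vector). c *\<^sub>C x)"
proof
  show "(a + a') *\<^sub>C b = a *\<^sub>C b + a' *\<^sub>C b" "a *\<^sub>C (b + b') = a *\<^sub>C b + a *\<^sub>C b'"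
    for a a' :: complex and b b' :: 'a
    by (rule scaleC_add_left scaleC_add_right)+
  show "(r *\<^sub>R a) *\<^sub>C b = r *\<^sub>R (a *\<^sub>C b)" "a *\<^sub>C (r *\<^sub>R b) = r *\<^sub>R (a *\<^sub>C b)"
    for a :: complex and b :: 'a and r
    by (simp_all add: scaleC_of_real[symmetric] scaleR_conv_of_real mult.commute)
  show "\<exists>K. \<forall>(a :: complex) (b :: 'a). norm (a *\<^sub>C b) \<le> norm a * norm b * K"
    by (rule exI[of _ 1]) (simp add: norm_scaleC)
qed

lemma borel_measurable_imp_strongly_measurable:
  fixes h :: "'a \<Rightarrow> 'b::{second_countable_topology, metric_space}"
  assumes "h \<in> borel_measurable M"
  shows "strongly_measurable M h"
  using borel_measurable_implies_sequence_metric[OF assms, of undefined]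
  unfolding strongly_measurable_def by blast

lemma strongly_measurable_imp_borel_measurable:
  fixes h :: "'a \<Rightarrow> 'b::metric_space"
  assumes "strongly_measurable M h"
  shows "h \<in> borel_measurable M"
proof -
  obtain u where u: "\<And>n. simple_function M (u n)" "\<And>x. x \<in> space M \<Longrightarrow> (\<lambda>n. u n x) \<longlonglongrightarrow> h x"
    using assms unfolding strongly_measurable_def by blast
  show ?thesis
    by (rule borel_measurable_LIMSEQ_metric[of u]) (use u in \<open>auto intro: borel_measurable_simple_function\<close>)
qed

lemma kernel_integrable:
  fixes h :: "real \<Rightarrow> L1"
  assumes "integrable unit_measure f" "bounded_kernel h C"
  shows "integrable unit_measure (\<lambda>s. f s *\<^sub>C h s)"
  using assms borel_measurable_imp_strongly_measurable
  by (intro representable_integrand_integrable[of f h C]) (auto simp: bounded_kernel_def)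

text \<open>The bound on \<open>h\<close> holds only almost everywhere so that the estimate applies
  to averaging operators, which control a kernel only off the null fibres of a partition.\<close>

lemma norm_kernel_integral_le:
  fixes h :: "real \<Rightarrow> L1"
  assumes f: "integrable unit_measure f" and h: "AE s in unit_measure. norm (h s) \<le> C" and C: "0 \<le> C"
  shows "norm (LINT s|unit_measure. f s *\<^sub>C h s) \<le> C * norm (L1_class f)"
proof -
  have "norm (LINT s|unit_measure. f s *\<^sub>C h s) \<le> (LINT s|unit_measure. norm (f s *\<^sub>C h s))"
    by (rule integral_norm_bound)
  also have "\<dots> \<le> (LINT s|unit_measure. C * cmod (f s))"
  proof (rule integral_mono_AE')
    show "integrable unit_measure (\<lambda>s. C * cmod (f s))"
      using f by auto
    show "AE s in unit_measure. norm (f s *\<^sub>C h s) \<le> C * cmod (f s)"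
      using h by eventually_elim (simp add: norm_scaleC mult.commute mult_right_mono)
  qed (simp add: C)
  finally show ?thesis
    using f by (simp add: norm_L1_class)
qed

lemma rep_L1: "integrable unit_measure (rep_L1 x)" "L1_class (rep_L1 x) = x"
  using Quotient3_rep_reflp[OF Quotient3_L1, of x] Quotient3_abs_rep[OF Quotient3_L1, of x]
  by (auto simp: L1_rel_def)

text \<open>Makes integration against a kernel well defined on classes, so that the representative
  picked by \<open>rep_L1\<close> may be exchanged for any other.\<close>

lemma kernel_integral_L1_class_cong:
  assumes "integrable unit_measure f" "integrable unit_measure g" "L1_class f = L1_class g"
    and "h \<in> borel_measurable unit_measure"
  shows "(LINT s|unit_measure. f s *\<^sub>C (h s :: L1)) = (LINT s|unit_measure. g s *\<^sub>C h s)"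
proof (rule integral_cong_AE)
  have [measurable]: "f \<in> borel_measurable unit_measure" "g \<in> borel_measurable unit_measure"
    "h \<in> borel_measurable unit_measure"
    using assms by auto
  have cont: "continuous_on UNIV (\<lambda>p :: complex \<times> L1. fst p *\<^sub>C snd p)"
    by (rule bounded_bilinear.continuous_on[OF bounded_bilinear_scaleC]) (auto intro: continuous_intros)
  have "(\<lambda>s. f s *\<^sub>C (h s :: L1)) \<in> borel_measurable unit_measure"
    if [measurable]: "f \<in> borel_measurable unit_measure" for f
    by (rule borel_measurable_continuous_Pair[OF that assms(4) cont])
  then show "(\<lambda>s. f s *\<^sub>C h s) \<in> borel_measurable unit_measure"
    "(\<lambda>s. g s *\<^sub>C h s) \<in> borel_measurable unit_measure"
    by simp_all
  show "AE s in unit_measure. f s *\<^sub>C h s = g s *\<^sub>C h s"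
    using L1_class_simps(3)[OF assms(1,2)] assms(3) by auto
qed

section \<open>Kernels and the operators they represent\<close>

lemma representable_kernel:
  assumes h: "bounded_kernel h C"
  obtains T where "representable T"
    "\<And>f. integrable unit_measure f \<Longrightarrow> bop_apply T (L1_class f) = (LINT s|unit_measure. f s *\<^sub>C h s)"
proof -
  note [simp] = kernel_integrable[OF _ h]
  define F where "F x = (LINT s|unit_measure. rep_L1 x s *\<^sub>C h s)" for x
  have F: "F (L1_class f) = (LINT s|unit_measure. f s *\<^sub>C h s)" if "integrable unit_measure f" for f
    unfolding F_def using h that
    by (intro kernel_integral_L1_class_cong) (simp_all add: rep_L1 bounded_kernel_def)
  have C: "0 \<le> C"
    using h norm_ge_zero[of "h 0"] unfolding bounded_kernel_def
    by (metis atLeastAtMost_iff order_refl order_trans zero_le_one)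
  obtain T where T: "\<And>x. bop_apply T x = F x"
  proof (rule bop_exists[of F C])
    fix x y :: L1 and c
    obtain f where f: "integrable unit_measure f" "x = L1_class f" by (rule L1_class_cases)
    obtain g where g: "integrable unit_measure g" "y = L1_class g" by (rule L1_class_cases)
    show "F (x + y) = F x + F y"
      using f g by (simp add: L1_class_simps F scaleC_add_left)
    show "F (c *\<^sub>C x) = c *\<^sub>C F x"
      using f integral_bounded_linear[OF bounded_linear_scaleC[of c], of unit_measure "\<lambda>s. f s *\<^sub>C h s"]
      by (simp add: scaleC_L1_class F)
    show "norm (F x) \<le> norm x * C"
      using norm_kernel_integral_le[OF f(1) AE_I2, of h C] h C f
      by (simp add: F bounded_kernel_def mult.commute)
  qed blast
  show thesis
  proof
    show "bop_apply T (L1_class f) = (LINT s|unit_measure. f s *\<^sub>C h s)" if "integrable unit_measure f" for f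
      using T F that by simp
    then show "representable T"
      using h unfolding representable_def bounded_kernel_def
      by (metis borel_measurable_imp_strongly_measurable)
  qed
qed

lemma representableE:
  assumes "representable T"
  obtains h C where "bounded_kernel h C"
    "\<And>f. integrable unit_measure f \<Longrightarrow> bop_apply T (L1_class f) = (LINT s|unit_measure. f s *\<^sub>C h s)"
  using assms strongly_measurable_imp_borel_measurable
  unfolding representable_def bounded_kernel_def by metis

lemma representableI:
  assumes "bounded_kernel h C"
    "\<And>f. integrable unit_measure f \<Longrightarrow> bop_apply T (L1_class f) = (LINT s|unit_measure. f s *\<^sub>C h s)"
  shows "representable T"
  using assms unfolding representable_def bounded_kernel_def
  by (metis borel_measurable_imp_strongly_measurable)

lemma representable_add:
  assumes "representable S" "representable T"
  shows "representable (S + T)"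
proof -
  obtain h C where h: "bounded_kernel h C"
    "\<And>f. integrable unit_measure f \<Longrightarrow> bop_apply S (L1_class f) = (LINT s|unit_measure. f s *\<^sub>C h s)"
    using representableE[OF assms(1)] by metis
  obtain k D where k: "bounded_kernel k D"
    "\<And>f. integrable unit_measure f \<Longrightarrow> bop_apply T (L1_class f) = (LINT s|unit_measure. f s *\<^sub>C k s)"
    using representableE[OF assms(2)] by metis
  show ?thesis
  proof (rule representableI)
    show "bounded_kernel (\<lambda>s. h s + k s) (C + D)"
      using h(1) k(1) unfolding bounded_kernel_def by (auto intro: norm_triangle_mono)
    show "bop_apply (S + T) (L1_class f) = (LINT s|unit_measure. f s *\<^sub>C (h s + k s))"
      if "integrable unit_measure f" for f
      using that h k by (simp add: scaleC_add_right kernel_integrable)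
  qed
qed

lemma bop_apply_kernel_integral:
  fixes h :: "real \<Rightarrow> L1"
  assumes "integrable unit_measure f" "bounded_kernel h C"
  shows "bop_apply S (LINT s|unit_measure. f s *\<^sub>C h s) = (LINT s|unit_measure. f s *\<^sub>C bop_apply S (h s))"
  using integral_bounded_linear[OF bounded_linear_bop_apply kernel_integrable[OF assms], of S]
  by (simp add: bop_apply_scaleC)

lemma bounded_kernel_bop_apply:
  fixes h :: "real \<Rightarrow> L1"
  assumes "bounded_kernel h C"
  shows "bounded_kernel (\<lambda>s. bop_apply S (h s)) (norm S * C)"
  unfolding bounded_kernel_def
proof (intro conjI ballI)
  have "bop_apply S \<in> borel_measurable borel"
    by (intro borel_measurable_continuous_onI linear_continuous_on bounded_linear_bop_apply)
  with assms show "(\<lambda>s. bop_apply S (h s)) \<in> borel_measurable unit_measure"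
    unfolding bounded_kernel_def by (blast intro: measurable_compose)
  show "norm (bop_apply S (h s)) \<le> norm S * C" if "s \<in> {0..1}" for s
    using norm_bop_apply[of S "h s"] assms that unfolding bounded_kernel_def
    by (meson mult_left_mono norm_ge_zero order_trans)
qed

text \<open>A bounded operator passes inside the Bochner integral, so \<open>S\<close> applied
  pointwise to a kernel of \<open>T\<close> is a kernel of the product.\<close>

lemma representable_mult_left:
  assumes "representable T"
  shows "representable (S * T)"
proof -
  obtain h C where h: "bounded_kernel h C"
    "\<And>f. integrable unit_measure f \<Longrightarrow> bop_apply T (L1_class f) = (LINT s|unit_measure. f s *\<^sub>C h s)"
    using representableE[OF assms] by metis
  show ?thesis
    using bounded_kernel_bop_apply[OF h(1)] by (rule representableI) (simp add: h bop_apply_kernel_integral[OF _ h(1)])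
qed

section \<open>Densities of functionals on \<open>L\<^sub>1\<close>\<close>

definition L1_indicator :: "real set \<Rightarrow> L1" where
  "L1_indicator E = L1_class (indicator E)"

lemma integrable_indicator_unit [simp]:
  "E \<in> sets unit_measure \<Longrightarrow> integrable unit_measure (indicator E :: real \<Rightarrow> 'a::{banach, second_countable_topology, real_normed_algebra_1})"
  by (rule unit.integrable_const_bound[of _ 1]) (auto simp: indicator_def)

lemma norm_L1_indicator: "E \<in> sets unit_measure \<Longrightarrow> norm (L1_indicator E) = measure unit_measure E"
proof -
  assume E: "E \<in> sets unit_measure"
  have "(\<lambda>s. cmod (indicator E s)) = indicator E"
    by (auto simp: indicator_def)
  then show ?thesis
    using E sets.sets_into_space[OF E] by (simp add: L1_indicator_def norm_L1_class Int_absorb2)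
qed

lemma L1_indicator_Un:
  assumes "A \<in> sets unit_measure" "B \<in> sets unit_measure" "A \<inter> B = {}"
  shows "L1_indicator (A \<union> B) = L1_indicator A + L1_indicator B"
proof -
  have "(indicator (A \<union> B) :: real \<Rightarrow> complex) = (\<lambda>s. indicator A s + indicator B s)"
    using assms(3) by (auto simp: indicator_def fun_eq_iff)
  then show ?thesis
    using assms unfolding L1_indicator_def by (simp add: L1_class_simps)
qed

lemma L1_indicator_empty [simp]: "L1_indicator {} = 0"
  by (simp add: L1_indicator_def zero_L1_def indicator_def[abs_def])

text \<open>Dominated convergence with majorant 1 gives convergence in norm; applying a bounded
  functional then yields countable additivity of its set function.\<close>

lemma L1_indicator_sums:
  assumes A: "\<And>i. A i \<in> sets unit_measure" and disj: "disjoint_family A"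
  shows "(\<lambda>i. L1_indicator (A i)) sums L1_indicator (\<Union>i. A i)"
proof -
  have "(\<Sum>i<n. L1_indicator (A i)) = L1_indicator (\<Union>i<n. A i)" for n
  proof (induction n)
    case (Suc n)
    have "A i \<inter> A n = {}" if "i < n" for i
      using disjoint_family_onD[OF disj, of i n] that by simp
    then have "(\<Union>i<n. A i) \<inter> A n = {}"
      by blast
    then have "L1_indicator ((\<Union>i<n. A i) \<union> A n) = L1_indicator (\<Union>i<n. A i) + L1_indicator (A n)"
      using A by (intro L1_indicator_Un) auto
    moreover have "(\<Union>i<Suc n. A i) = (\<Union>i<n. A i) \<union> A n"
      by (auto simp: lessThan_Suc)
    ultimately show ?case
      using Suc by simp
  qed simp
  moreover have "(\<lambda>n. L1_class (indicator (\<Union>i<n. A i))) \<longlonglongrightarrow> L1_class (indicator (\<Union>i. A i))"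
  proof (rule L1_tendsto_dominated)
    show "AE s in unit_measure. (\<lambda>n. indicator (\<Union>i<n. A i) s :: complex) \<longlonglongrightarrow> indicator (\<Union>i. A i) s"
      by (intro AE_I2 LIMSEQ_indicator_UN)
    show "AE s in unit_measure. cmod (indicator (\<Union>i<n. A i) s - indicator (\<Union>i. A i) s) \<le> 1" for n
      by (auto simp: indicator_def)
  qed (use A in \<open>auto intro!: sets.countable_UN\<close>)
  ultimately show ?thesis
    by (simp add: sums_def L1_indicator_def)
qed

text \<open>Adding \<open>C\<close> times Lebesgue measure to the set function of the functional makes it a positive
  measure, to which the Radon--Nikodym theorem applies.\<close>

lemma real_functional_density:
  assumes \<psi>: "bounded_linear \<psi>" and bound: "\<And>x. \<bar>\<psi> x\<bar> \<le> C * norm (x :: L1)"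
  obtains g :: "real \<Rightarrow> real" where "integrable unit_measure g"
    "\<And>E. E \<in> sets unit_measure \<Longrightarrow> \<psi> (L1_indicator E) = (LINT s|unit_measure. indicator E s * g s)"
proof -
  define \<nu> where "\<nu> E = \<psi> (L1_indicator E) + C * measure unit_measure E" for E
  define N where "N = measure_of {0..1} (sets unit_measure) (\<lambda>E. ennreal (\<nu> E))"
  have \<nu>_nonneg: "0 \<le> \<nu> E" if "E \<in> sets unit_measure" for E
    using bound[of "L1_indicator E"] that by (simp add: \<nu>_def norm_L1_indicator abs_le_iff)
  have sets_N [simp]: "sets N = sets unit_measure"
    unfolding N_def using sets.sigma_sets_eq[of unit_measure] sets.space_closed[of unit_measure] by simp
  have emeasure_N: "emeasure N E = ennreal (\<nu> E)" if E: "E \<in> sets unit_measure" for E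
  proof (rule emeasure_measure_of[OF N_def])
    show "sets unit_measure \<subseteq> Pow {0..1}"
      using sets.space_closed[of unit_measure] by simp
    show "positive (sets N) (\<lambda>E. ennreal (\<nu> E))"
      by (simp add: positive_def \<nu>_def linear_0[OF bounded_linear.linear[OF \<psi>]])
    show "countably_additive (sets N) (\<lambda>E. ennreal (\<nu> E))"
      unfolding countably_additive_def
    proof (intro allI impI)
      fix A :: "nat \<Rightarrow> real set"
      assume "range A \<subseteq> sets N" and disj: "disjoint_family A"
      then have A: "A i \<in> sets unit_measure" for i by auto
      have "(\<lambda>i. \<nu> (A i)) sums \<nu> (\<Union>i. A i)"
        unfolding \<nu>_def
      proof (intro sums_add sums_mult)
        show "(\<lambda>i. \<psi> (L1_indicator (A i))) sums \<psi> (L1_indicator (\<Union>i. A i))"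
          by (rule bounded_linear.sums[OF \<psi> L1_indicator_sums[OF A disj]])
        show "(\<lambda>i. measure unit_measure (A i)) sums measure unit_measure (\<Union>i. A i)"
          using A disj by (intro unit.finite_measure_UNION) auto
      qed
      then show "(\<Sum>i. ennreal (\<nu> (A i))) = ennreal (\<nu> (\<Union>i. A i))"
        using \<nu>_nonneg[OF A] by (intro suminf_ennreal_eq)
    qed
  qed (use E in simp)
  interpret N: finite_measure N
    by (rule finite_measureI)
      (use emeasure_N[OF sets.top] sets_eq_imp_space_eq[OF sets_N] in simp)
  have "absolutely_continuous unit_measure N"
    unfolding absolutely_continuous_def
  proof
    fix E assume "E \<in> null_sets unit_measure"
    then have E: "E \<in> sets unit_measure" "measure unit_measure E = 0"
      by (auto simp: measure_def)
    with bound[of "L1_indicator E"] have "\<nu> E = 0"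
      by (simp add: \<nu>_def norm_L1_indicator)
    with E show "E \<in> null_sets N"
      by (intro null_setsI) (simp_all add: emeasure_N)
  qed
  then obtain f where f: "f \<in> borel_measurable unit_measure" "density unit_measure f = N"
    using unit.Radon_Nikodym_finite_measure[of N] N.finite_measure_axioms by auto
  have f_int: "(\<integral>\<^sup>+ s. f s * indicator E s \<partial>unit_measure) = ennreal (\<nu> E)" if "E \<in> sets unit_measure" for E
    using emeasure_N[OF that] emeasure_density[OF f(1) that] f(2) by simp
  have "(\<integral>\<^sup>+ s. f s \<partial>unit_measure) = (\<integral>\<^sup>+ s. f s * indicator {0..1} s \<partial>unit_measure)"
    by (intro nn_integral_cong) simp
  then have "(\<integral>\<^sup>+ s. f s \<partial>unit_measure) \<noteq> \<infinity>"
    using f_int[OF sets.top] by simp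
  \<comment> \<open>The total mass is finite, so replacing \<open>f\<close> by its real-valued
    version \<open>enn2real (f s)\<close> loses information only on a null set.\<close>
  then have fin: "AE s in unit_measure. f s \<noteq> \<infinity>"
    using f(1) by (intro nn_integral_PInf_AE) auto
  have int: "integrable unit_measure (\<lambda>s. indicator E s * enn2real (f s))"
    "(LINT s|unit_measure. indicator E s * enn2real (f s)) = \<nu> E" if E: "E \<in> sets unit_measure" for E
  proof -
    have "(\<integral>\<^sup>+ s. ennreal (indicator E s * enn2real (f s)) \<partial>unit_measure)
        = (\<integral>\<^sup>+ s. f s * indicator E s \<partial>unit_measure)"
    proof (rule nn_integral_cong_AE)
      show "AE s in unit_measure. ennreal (indicator E s * enn2real (f s)) = f s * indicator E s"
        using fin by eventually_elim (auto simp: indicator_def less_top)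
    qed
    then have eq: "(\<integral>\<^sup>+ s. ennreal (indicator E s * enn2real (f s)) \<partial>unit_measure) = ennreal (\<nu> E)"
      using f_int[OF E] by simp
    have meas: "(\<lambda>s. indicator E s * enn2real (f s)) \<in> borel_measurable unit_measure"
      using E f(1) by measurable
    show "integrable unit_measure (\<lambda>s. indicator E s * enn2real (f s))"
      by (rule integrableI_nonneg[OF meas]) (use eq in \<open>auto simp: indicator_def\<close>)
    show "(LINT s|unit_measure. indicator E s * enn2real (f s)) = \<nu> E"
      using eq \<nu>_nonneg[OF E] by (subst integral_eq_nn_integral[OF meas]) (auto simp: indicator_def)
  qed
  show thesis
  proof
    have "integrable unit_measure (\<lambda>s. indicator {0..1} s * enn2real (f s))"
      using int(1)[OF sets.top] by simp
    then have int_f: "integrable unit_measure (\<lambda>s. enn2real (f s))"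
      by (subst Bochner_Integration.integrable_cong[of _ unit_measure _ "\<lambda>s. indicator {0..1} s * enn2real (f s)"]) auto
    \<comment> \<open>Subtracting \<open>C\<close> undoes the shift that made the set function
      positive.\<close>
    then show "integrable unit_measure (\<lambda>s. enn2real (f s) - C)" by auto
    fix E assume E: "E \<in> sets unit_measure"
    have "(LINT s|unit_measure. indicator E s * (enn2real (f s) - C))
        = (LINT s|unit_measure. indicator E s * enn2real (f s) - C * indicator E s)"
      by (intro Bochner_Integration.integral_cong) (auto simp: algebra_simps)
    also have "\<dots> = \<nu> E - C * measure unit_measure E"
      using int[OF E] E sets.sets_into_space[OF E]
      by (subst Bochner_Integration.integral_diff) (auto simp: Int_absorb2)
    finally show "\<psi> (L1_indicator E) = (LINT s|unit_measure. indicator E s * (enn2real (f s) - C))"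
      by (simp add: \<nu>_def)
  qed
qed

text \<open>On a set where every \<open>g i\<close> has constant sign, absolute values move through
  the integrals. Cutting an arbitrary set along the signs gives the bound for the integrals of the
  absolute values, and then the set where the pointwise estimate fails must be null.\<close>

lemma sum_abs_le_AE_of_integral:
  fixes g :: "nat \<Rightarrow> real \<Rightarrow> real"
  assumes g: "\<And>i. integrable unit_measure (g i)"
    and bound: "\<And>E. E \<in> sets unit_measure \<Longrightarrow>
      (\<Sum>i<M. \<bar>LINT s|unit_measure. indicator E s * g i s\<bar>) \<le> C * measure unit_measure E"
  shows "AE s in unit_measure. (\<Sum>i<M. \<bar>g i s\<bar>) \<le> C"
proof -
  have g_meas [measurable]: "g i \<in> borel_measurable unit_measure" for i
    using g by auto
  have int: "integrable unit_measure (\<lambda>s. indicator E s * \<bar>g i s\<bar>)"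
    "integrable unit_measure (\<lambda>s. indicator E s * g i s)" if "E \<in> sets unit_measure" for E i
    using g integrable_real_mult_indicator[OF that, of "g i"]
      integrable_real_mult_indicator[OF that, of "\<lambda>s. \<bar>g i s\<bar>"]
    by (simp_all add: mult.commute)
  \<comment> \<open>Peel off the functions of non-constant sign one at a time, splitting the set at each step.\<close>
  have "(\<Sum>i<M. LINT s|unit_measure. indicator E s * \<bar>g i s\<bar>) \<le> C * measure unit_measure E"
    if "E \<in> sets unit_measure" "\<And>i. N \<le> i \<Longrightarrow> (\<forall>s\<in>E. 0 \<le> g i s) \<or> (\<forall>s\<in>E. g i s \<le> 0) \<or> M \<le> i" for N E
    using that
  proof (induction N arbitrary: E)
    case 0
    have "(LINT s|unit_measure. indicator E s * \<bar>g i s\<bar>) = \<bar>LINT s|unit_measure. indicator E s * g i s\<bar>"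
      if "i < M" for i
    proof -
      from 0(2)[of i] that consider "\<forall>s\<in>E. 0 \<le> g i s" | "\<forall>s\<in>E. g i s \<le> 0"
        by auto
      then show ?thesis
      proof cases
        case 1
        then have eq: "(\<lambda>s. indicator E s * \<bar>g i s\<bar>) = (\<lambda>s. indicator E s * g i s)"
          by (auto simp: indicator_def fun_eq_iff)
        have "0 \<le> (LINT s|unit_measure. indicator E s * g i s)"
          using 1 by (intro Bochner_Integration.integral_nonneg) (auto simp: indicator_def)
        then show ?thesis
          unfolding eq by simp
      next
        case 2
        then have eq: "(\<lambda>s. indicator E s * \<bar>g i s\<bar>) = (\<lambda>s. - (indicator E s * g i s))"
          by (auto simp: indicator_def fun_eq_iff)
        have "0 \<le> (LINT s|unit_measure. - (indicator E s * g i s))"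
          using 2 by (intro Bochner_Integration.integral_nonneg) (auto simp: indicator_def)
        then show ?thesis
          unfolding eq by simp
      qed
    qed
    then show ?case
      using bound[OF 0(1)] by simp
  next
    case (Suc N)
    define P where "P = {s \<in> space unit_measure. 0 \<le> g N s}"
    have [measurable]: "P \<in> sets unit_measure"
      unfolding P_def by measurable
    note E = \<open>E \<in> sets unit_measure\<close>
    have EP: "E \<inter> P \<in> sets unit_measure" "E - P \<in> sets unit_measure"
      using E by auto
    have split: "(LINT s|unit_measure. indicator E s * \<bar>g i s\<bar>)
      = (LINT s|unit_measure. indicator (E \<inter> P) s * \<bar>g i s\<bar>) + (LINT s|unit_measure. indicator (E - P) s * \<bar>g i s\<bar>)" for i
      unfolding Bochner_Integration.integral_add[OF int(1)[OF EP(1)] int(1)[OF EP(2)], symmetric]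
      by (intro Bochner_Integration.integral_cong) (auto simp: indicator_def)
    have const: "(\<forall>s\<in>E \<inter> P. 0 \<le> g i s) \<or> (\<forall>s\<in>E \<inter> P. g i s \<le> 0) \<or> M \<le> i"
      "(\<forall>s\<in>E - P. 0 \<le> g i s) \<or> (\<forall>s\<in>E - P. g i s \<le> 0) \<or> M \<le> i" if "N \<le> i" for i
    proof -
      have "E - P \<subseteq> {s. g N s \<le> 0}"
        using sets.sets_into_space[OF E] by (auto simp: P_def)
      then show "(\<forall>s\<in>E \<inter> P. 0 \<le> g i s) \<or> (\<forall>s\<in>E \<inter> P. g i s \<le> 0) \<or> M \<le> i"
        "(\<forall>s\<in>E - P. 0 \<le> g i s) \<or> (\<forall>s\<in>E - P. g i s \<le> 0) \<or> M \<le> i"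
        using Suc.prems(2)[of i] that by (cases "i = N"; auto simp: P_def)+
    qed
    have "(\<Sum>i<M. LINT s|unit_measure. indicator E s * \<bar>g i s\<bar>)
        \<le> C * measure unit_measure (E \<inter> P) + C * measure unit_measure (E - P)"
      unfolding split sum.distrib by (intro add_mono Suc.IH EP const)
    also have "\<dots> = C * measure unit_measure ((E \<inter> P) \<union> (E - P))"
      using EP by (subst unit.finite_measure_Union) (auto simp: distrib_left)
    also have "(E \<inter> P) \<union> (E - P) = E" by auto
    finally show ?case .
  qed
  \<comment> \<open>With \<open>N = M\<close> the sign condition is vacuous, so every measurable set
    is covered.\<close>
  from this[of _ M] have abs_bound:
    "(\<Sum>i<M. LINT s|unit_measure. indicator E s * \<bar>g i s\<bar>) \<le> C * measure unit_measure E"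
    if "E \<in> sets unit_measure" for E
    using that by auto
  define F where "F s = (\<Sum>i<M. \<bar>g i s\<bar>)" for s
  have [measurable]: "F \<in> borel_measurable unit_measure"
    unfolding F_def by measurable
  \<comment> \<open>On \<open>B\<close> the function \<open>F - C\<close> is positive, yet its
    integral over \<open>B\<close> turns out to be at most 0.\<close>
  define B where "B = {s \<in> space unit_measure. C < F s}"
  have B: "B \<in> sets unit_measure"
    unfolding B_def by measurable
  have int_B: "integrable unit_measure (\<lambda>s. indicator B s * (F s - C))"
    using g unfolding F_def
    by (subst mult.commute, intro integrable_real_mult_indicator B) auto
  have "(LINT s|unit_measure. indicator B s * (F s - C))
      = (LINT s|unit_measure. (\<Sum>i<M. indicator B s * \<bar>g i s\<bar>) - C * indicator B s)"
    by (intro Bochner_Integration.integral_cong) (auto simp: F_def indicator_def)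
  also have "\<dots> = (\<Sum>i<M. LINT s|unit_measure. indicator B s * \<bar>g i s\<bar>) - C * measure unit_measure B"
    using B sets.sets_into_space[OF B]
    by (subst Bochner_Integration.integral_diff)
      (simp_all add: Int_absorb2 int Bochner_Integration.integral_sum Bochner_Integration.integrable_sum
        del: sum_mult_indicator sum_indicator_mult)
  also have "\<dots> \<le> 0"
    using abs_bound[OF B] by simp
  finally have le: "(LINT s|unit_measure. indicator B s * (F s - C)) \<le> 0" .
  have nonneg: "0 \<le> indicator B s * (F s - C)" for s
    by (auto simp: indicator_def B_def)
  then have "AE s in unit_measure. indicator B s * (F s - C) = 0"
    using le integral_nonneg_eq_0_iff_AE[OF int_B] by (simp add: antisym)
  then show ?thesis
  proof (rule AE_mp, intro AE_I2 impI)
    fix s assume "s \<in> space unit_measure" "indicator B s * (F s - C) = 0"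
    then show "(\<Sum>i<M. \<bar>g i s\<bar>) \<le> C"
      by (cases "s \<in> B") (auto simp: B_def F_def)
  qed
qed

section \<open>Functionals given by bounded densities\<close>

lemma integrable_mult_bounded:
  fixes f g :: "real \<Rightarrow> complex"
  assumes "integrable unit_measure f" "g \<in> borel_measurable unit_measure" "\<And>s. cmod (g s) \<le> K"
  shows "integrable unit_measure (\<lambda>s. f s * g s)"
proof (rule Bochner_Integration.integrable_bound)
  show "integrable unit_measure (\<lambda>s. K * cmod (f s))" "(\<lambda>s. f s * g s) \<in> borel_measurable unit_measure"
    using assms by auto
  have "cmod (f s) * cmod (g s) \<le> cmod (f s) * \<bar>K\<bar>" for s
    using assms(3)[of s] by (intro mult_left_mono) auto
  then show "AE s in unit_measure. cmod (f s * g s) \<le> norm (K * cmod (f s))"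
    by (simp add: norm_mult abs_mult mult.commute)
qed

text \<open>Both sides are additive and continuous for the \<open>L\<^sub>1\<close> norm, so
  agreement on indicators spreads through simple functions to all integrable ones; the bound on
  \<open>g\<close> supplies the majorant in the limit case.\<close>

lemma functional_eq_integral:
  fixes \<phi> :: "L1 \<Rightarrow> complex"
  assumes \<phi>: "bounded_linear \<phi>" "\<And>c x. \<phi> (c *\<^sub>C x) = c * \<phi> x"
    and g: "g \<in> borel_measurable unit_measure" "\<And>s. cmod (g s) \<le> K"
    and ind: "\<And>E. E \<in> sets unit_measure \<Longrightarrow> \<phi> (L1_indicator E) = (LINT s|unit_measure. indicator E s * g s)"
    and f: "integrable unit_measure f"
  shows "\<phi> (L1_class f) = (LINT s|unit_measure. f s * g s)"
  using f
proof (induction f rule: integrable_induct)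
  case (base A c)
  have "L1_class (\<lambda>s. indicator A s *\<^sub>R c) = c *\<^sub>C L1_indicator A"
  proof -
    have "(\<lambda>s. indicator A s *\<^sub>R c) = (\<lambda>s. c * indicator A s)"
      by (auto simp: indicator_def fun_eq_iff)
    then show ?thesis
      using base by (simp add: L1_indicator_def scaleC_L1_class)
  qed
  then have "\<phi> (L1_class (\<lambda>s. indicator A s *\<^sub>R c)) = (LINT s|unit_measure. c * (indicator A s * g s))"
    using base by (simp add: \<phi>(2) ind)
  also have "\<dots> = (LINT s|unit_measure. (indicator A s *\<^sub>R c) * g s)"
    by (intro Bochner_Integration.integral_cong) (auto simp: indicator_def)
  finally show ?case .
next
  case (add f h)
  have "\<phi> (L1_class (\<lambda>s. f s + h s)) = \<phi> (L1_class f) + \<phi> (L1_class h)"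
    using add by (simp add: L1_class_simps(1)[symmetric] linear_add[OF bounded_linear.linear[OF \<phi>(1)]])
  then show ?case
    using add by (simp add: distrib_right integrable_mult_bounded[OF _ g])
next
  case (lim f s)
  have le: "cmod (s i x) \<le> 2 * cmod (f x)" if "x \<in> space unit_measure" for i x
    using lim that by blast
  have "(\<lambda>i. L1_class (s i)) \<longlonglongrightarrow> L1_class f"
  proof (rule L1_tendsto_dominated)
    show "integrable unit_measure (\<lambda>x. 3 * cmod (f x))"
      using lim by auto
    show "AE x in unit_measure. cmod (s i x - f x) \<le> 3 * cmod (f x)" for i
    proof (rule AE_I2)
      fix x assume "x \<in> space unit_measure"
      from le[OF this, of i] show "cmod (s i x - f x) \<le> 3 * cmod (f x)"
        using norm_triangle_ineq4[of "s i x" "f x"] by linarith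
    qed
  qed (use lim in auto)
  then have "(\<lambda>i. \<phi> (L1_class (s i))) \<longlonglongrightarrow> \<phi> (L1_class f)"
    by (rule bounded_linear.tendsto[OF \<phi>(1)])
  moreover have "(\<lambda>i. LINT x|unit_measure. s i x * g x) \<longlonglongrightarrow> (LINT x|unit_measure. f x * g x)"
  proof (rule integral_dominated_convergence)
    show "integrable unit_measure (\<lambda>x. 2 * cmod (f x) * K)"
      using lim by auto
    show "AE x in unit_measure. (\<lambda>i. s i x * g x) \<longlonglongrightarrow> f x * g x"
      using lim by (auto intro!: AE_I2 tendsto_intros)
    show "AE x in unit_measure. cmod (s i x * g x) \<le> 2 * cmod (f x) * K" for i
      using le g(2) by (auto intro!: AE_I2 mult_mono simp: norm_mult)
  qed (use lim g in auto)
  ultimately show ?case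
    using lim LIMSEQ_unique by (simp del: space_unit) blast
qed

text \<open>The hypotheses say that the sequence \<open>\<phi>\<close> is a bounded operator from
  \<open>L\<^sub>1\<close> to \<open>\<ell>\<^sub>1\<close>. The conclusion is the Radon-Nikodym
  property of \<open>\<ell>\<^sub>1\<close> in coordinates: the densities together form a bounded
  \<open>\<ell>\<^sub>1\<close>-valued function. The factor 2 arises from estimating real and
  imaginary parts separately.\<close>

lemma functionals_density:
  fixes \<phi> :: "nat \<Rightarrow> L1 \<Rightarrow> complex"
  assumes \<phi>: "\<And>i. bounded_linear (\<phi> i)" "\<And>i c x. \<phi> i (c *\<^sub>C x) = c * \<phi> i x"
    and bound: "\<And>M x. (\<Sum>i<M. cmod (\<phi> i x)) \<le> C * norm x"
  obtains g :: "nat \<Rightarrow> real \<Rightarrow> complex" where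
    "\<And>i. g i \<in> borel_measurable unit_measure" "\<And>M s. (\<Sum>i<M. cmod (g i s)) \<le> 2 * C"
    "\<And>i f. integrable unit_measure f \<Longrightarrow> \<phi> i (L1_class f) = (LINT s|unit_measure. f s * g i s)"
proof -
  have le: "cmod (\<phi> i x) \<le> C * norm x" for i x
  proof -
    have "cmod (\<phi> i x) \<le> (\<Sum>j<Suc i. cmod (\<phi> j x))"
      by (rule member_le_sum) auto
    also note bound
    finally show ?thesis .
  qed
  have C: "0 \<le> C"
  proof -
    have "measure unit_measure {0..1} = 1"
      by (simp add: measure_restrict_space)
    then have "norm (L1_indicator {0..1}) = 1"
      using sets.top[of unit_measure] by (subst norm_L1_indicator) auto
    then show ?thesis
      using le[of 0 "L1_indicator {0..1}"] norm_ge_zero[of "\<phi> 0 (L1_indicator {0..1})"]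
      by (simp del: norm_ge_zero)
  qed
  have "\<exists>u. integrable unit_measure u \<and> (\<forall>E\<in>sets unit_measure.
    Re (\<phi> i (L1_indicator E)) = (LINT s|unit_measure. indicator E s * u s))" for i
    using real_functional_density[of "\<lambda>x. Re (\<phi> i x)" C]
      bounded_linear_compose[OF bounded_linear_Re \<phi>(1)] le abs_Re_le_cmod
    by (metis order_trans)
  then obtain u where u: "\<And>i. integrable unit_measure (u i)"
    "\<And>i E. E \<in> sets unit_measure \<Longrightarrow>
      Re (\<phi> i (L1_indicator E)) = (LINT s|unit_measure. indicator E s * u i s)"
    by metis
  have "\<exists>u. integrable unit_measure u \<and> (\<forall>E\<in>sets unit_measure.
    Im (\<phi> i (L1_indicator E)) = (LINT s|unit_measure. indicator E s * u s))" for i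
    using real_functional_density[of "\<lambda>x. Im (\<phi> i x)" C]
      bounded_linear_compose[OF bounded_linear_Im \<phi>(1)] le abs_Im_le_cmod
    by (metis order_trans)
  then obtain v where v: "\<And>i. integrable unit_measure (v i)"
    "\<And>i E. E \<in> sets unit_measure \<Longrightarrow>
      Im (\<phi> i (L1_indicator E)) = (LINT s|unit_measure. indicator E s * v i s)"
    by metis
  have [measurable]: "u i \<in> borel_measurable unit_measure" "v i \<in> borel_measurable unit_measure" for i
    using u v by auto
  have bound_u: "AE s in unit_measure. (\<Sum>i<M. \<bar>u i s\<bar>) \<le> C" for M
  proof (rule sum_abs_le_AE_of_integral[OF u(1)])
    fix E assume E: "E \<in> sets unit_measure"
    have "(\<Sum>i<M. \<bar>LINT s|unit_measure. indicator E s * u i s\<bar>) \<le> (\<Sum>i<M. cmod (\<phi> i (L1_indicator E)))"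
      by (intro sum_mono) (simp add: u(2)[OF E, symmetric] abs_Re_le_cmod)
    with bound[where x = "L1_indicator E" and M = M]
    show "(\<Sum>i<M. \<bar>LINT s|unit_measure. indicator E s * u i s\<bar>) \<le> C * measure unit_measure E"
      by (simp add: norm_L1_indicator[OF E])
  qed
  have bound_v: "AE s in unit_measure. (\<Sum>i<M. \<bar>v i s\<bar>) \<le> C" for M
  proof (rule sum_abs_le_AE_of_integral[OF v(1)])
    fix E assume E: "E \<in> sets unit_measure"
    have "(\<Sum>i<M. \<bar>LINT s|unit_measure. indicator E s * v i s\<bar>) \<le> (\<Sum>i<M. cmod (\<phi> i (L1_indicator E)))"
      by (intro sum_mono) (simp add: v(2)[OF E, symmetric] abs_Im_le_cmod)
    with bound[where x = "L1_indicator E" and M = M]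
    show "(\<Sum>i<M. \<bar>LINT s|unit_measure. indicator E s * v i s\<bar>) \<le> C * measure unit_measure E"
      by (simp add: norm_L1_indicator[OF E])
  qed
  \<comment> \<open>The countably many almost sure bounds hold together on one measurable set of
    full measure; setting the densities to 0 off this set makes their bound valid at every
    point.\<close>
  define G where "G s \<longleftrightarrow> (\<forall>M. (\<Sum>i<M. \<bar>u i s\<bar>) \<le> C \<and> (\<Sum>i<M. \<bar>v i s\<bar>) \<le> C)" for s
  have [measurable]: "Measurable.pred unit_measure G"
    unfolding G_def by measurable
  have G: "AE s in unit_measure. G s"
    unfolding G_def AE_all_countable using bound_u bound_v by auto
  define g where "g i s = (if G s then Complex (u i s) (v i s) else 0)" for i s
  show thesis
  proof
    show g_meas: "g i \<in> borel_measurable unit_measure" for i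
      unfolding g_def[abs_def] Complex_eq by measurable
    show g_sum: "(\<Sum>i<M. cmod (g i s)) \<le> 2 * C" for M s
    proof (cases "G s")
      case True
      have "(\<Sum>i<M. cmod (g i s)) \<le> (\<Sum>i<M. \<bar>u i s\<bar> + \<bar>v i s\<bar>)"
        using True cmod_le[of "Complex (u i s) (v i s)" for i] by (intro sum_mono) (simp add: g_def)
      also have "\<dots> \<le> C + C"
        using True unfolding sum.distrib G_def by (intro add_mono) blast+
      finally show ?thesis by simp
    qed (simp add: g_def C)
    have g_le: "cmod (g i s) \<le> 2 * C" for i s
    proof -
      have "cmod (g i s) \<le> (\<Sum>j<Suc i. cmod (g j s))"
        by (rule member_le_sum) auto
      also note g_sum
      finally show ?thesis .
    qed
    show "\<phi> i (L1_class f) = (LINT s|unit_measure. f s * g i s)" if "integrable unit_measure f" for i f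
    proof (rule functional_eq_integral[OF \<phi> g_meas g_le _ that])
      fix E assume E: "E \<in> sets unit_measure"
      have int: "integrable unit_measure (\<lambda>s. indicator E s * g i s)"
        using E by (intro integrable_mult_bounded[OF _ g_meas g_le]) auto
      have "Re (LINT s|unit_measure. indicator E s * g i s) = (LINT s|unit_measure. Re (indicator E s * g i s))"
        "Im (LINT s|unit_measure. indicator E s * g i s) = (LINT s|unit_measure. Im (indicator E s * g i s))"
        using int by (simp_all only: integral_Re integral_Im)
      moreover have "(LINT s|unit_measure. Re (indicator E s * g i s)) = (LINT s|unit_measure. indicator E s * u i s)"
      proof (rule integral_cong_AE)
        show "(\<lambda>s. Re (indicator E s * g i s)) \<in> borel_measurable unit_measure"
          by (rule measurable_compose[OF borel_measurable_integrable[OF int] borel_measurable_Re])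
        show "(\<lambda>s. indicator E s * u i s) \<in> borel_measurable unit_measure"
          using E by measurable
        show "AE s in unit_measure. Re (indicator E s * g i s) = indicator E s * u i s"
          using G by eventually_elim (auto simp: indicator_def g_def)
      qed
      moreover have "(LINT s|unit_measure. Im (indicator E s * g i s)) = (LINT s|unit_measure. indicator E s * v i s)"
      proof (rule integral_cong_AE)
        show "(\<lambda>s. Im (indicator E s * g i s)) \<in> borel_measurable unit_measure"
          by (rule measurable_compose[OF borel_measurable_integrable[OF int] borel_measurable_Im])
        show "(\<lambda>s. indicator E s * v i s) \<in> borel_measurable unit_measure"
          using E by measurable
        show "AE s in unit_measure. Im (indicator E s * g i s) = indicator E s * v i s"
          using G by eventually_elim (auto simp: indicator_def g_def)
      qed
      ultimately show "\<phi> i (L1_indicator E) = (LINT s|unit_measure. indicator E s * g i s)"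
        by (simp add: complex_eq_iff u(2)[OF E] v(2)[OF E])
    qed
  qed
qed

section \<open>Bilinear maps on tensors\<close>

text \<open>\<open>rep_tensor\<close> picks an arbitrary representing multiset; for bilinear
  \<open>\<beta>\<close> the value is independent of the choice, as \<open>tensor_eval_of\<close>
  shows.\<close>

definition tensor_eval ::
  "('a::complex_vector \<Rightarrow> 'b::complex_vector \<Rightarrow> 'c::complex_vector) \<Rightarrow> ('a, 'b) tensor \<Rightarrow> 'c" where
  "tensor_eval \<beta> u = (\<Sum>(a, b)\<in>#rep_tensor u. \<beta> a b)"

locale complex_bilinear =
  fixes \<beta> :: "'a::complex_normed_vector \<Rightarrow> 'b::complex_normed_vector \<Rightarrow> 'c::complex_normed_vector"
  assumes add_left: "\<beta> (a + a') b = \<beta> a b + \<beta> a' b"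
    and add_right: "\<beta> a (b + b') = \<beta> a b + \<beta> a b'"
    and scale_left: "\<beta> (c *\<^sub>C a) b = c *\<^sub>C \<beta> a b"
    and scale_right: "\<beta> a (c *\<^sub>C b) = c *\<^sub>C \<beta> a b"
begin

lemma tensor_eval_of: "tensor_eval \<beta> (tensor_of M) = (\<Sum>(a, b)\<in>#M. \<beta> a b)"
proof -
  have "tensor_eq M N \<Longrightarrow> (\<Sum>(a, b)\<in>#M. \<beta> a b) = (\<Sum>(a, b)\<in>#N. \<beta> a b)" for M N
    by (induction rule: tensor_eq.induct)
      (use scale_left[of 0] in \<open>simp_all add: add_left add_right scale_left scale_right\<close>)
  moreover have "tensor_eq (rep_tensor (tensor_of M)) M"
    by (rule Quotient3_rep_abs[OF Quotient3_tensor tensor_eq.refl])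
  ultimately show ?thesis
    by (simp add: tensor_eval_def)
qed

lemma tensor_eval_diff: "tensor_eval \<beta> (u - v) = tensor_eval \<beta> u - tensor_eval \<beta> v"
proof -
  have "tensor_eval \<beta> (u + v) = tensor_eval \<beta> u + tensor_eval \<beta> v" for u v
  proof -
    obtain M N where "u = tensor_of M" "v = tensor_of N"
      using Quotient3_abs_rep[OF Quotient3_tensor] by metis
    then show ?thesis
      by (simp add: plus_tensor.abs_eq tensor_eval_of)
  qed
  from this[of "u - v" v] show ?thesis
    by simp
qed

text \<open>The triangle inequality bounds the value by \<open>K\<close> times the cost of every
  representation of \<open>u\<close>, hence by \<open>K\<close> times their infimum.\<close>

lemma norm_tensor_eval_le:
  assumes "u \<in> algebraic_tensor A B" "0 \<le> K" "\<And>a b. norm (\<beta> a b) \<le> K * (norm a * norm b)"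
  shows "norm (tensor_eval \<beta> u) \<le> K * projective_norm A B u"
proof (rule projective_norm_leI[OF assms(1) _ assms(2)])
  fix M assume "tensor_of M = u"
  then have "tensor_eval \<beta> u = (\<Sum>(a, b)\<in>#M. \<beta> a b)"
    using tensor_eval_of by blast
  moreover have "norm (\<Sum>(a, b)\<in>#M. \<beta> a b) \<le> K * (\<Sum>(a, b)\<in>#M. norm a * norm b)"
  proof (induction M)
    case (add p M)
    show ?case
      by (cases p) (use add assms(3) in \<open>auto intro!: norm_triangle_mono simp: distrib_left\<close>)
  qed simp
  ultimately show "norm (tensor_eval \<beta> u) \<le> K * (\<Sum>(a, b)\<in>#M. norm a * norm b)"
    by simp
qed

end

text \<open>Leaves the completion behind. For a single \<open>t\<close> the two limits along the
  filter yield an index \<open>i\<close> with strict inequalities, and these persist for a late term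
  of any Cauchy sequence representing \<open>d i\<close>. What remains is a finite sum of elementary
  tensors, to which later choices can be adapted.\<close>

lemma approximate_diagonal_imp_tensor:
  fixes A :: "'a::complex_banach_algebra set"
  assumes A: "complex_subalgebra A" and d: "approximate_diagonal A F d" and t: "t \<in> A" and \<epsilon>: "0 < \<epsilon>"
  obtains w where "w \<in> algebraic_tensor A A"
    "projective_norm A A (tensor_lmul t w - tensor_rmul w t) < \<epsilon>"
    "norm (t * tensor_mult w - t) < \<epsilon>"
proof -
  have A': "complex_subspace A"
    using A by (simp add: complex_subalgebra_def)
  let ?D = "\<lambda>i. completed_norm A A (completed_diff A A (completed_lmul A t (d i)) (completed_rmul A (d i) t))"
  have F: "F \<noteq> bot" and lim: "(?D \<longlongrightarrow> 0) F" "((\<lambda>i. norm (t * completed_mult (d i) - t)) \<longlongrightarrow> 0) F"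
    using d t by (auto simp: approximate_diagonal_def)
  have "eventually (\<lambda>i. ?D i < \<epsilon> \<and> norm (t * completed_mult (d i) - t) < \<epsilon>) F"
    using order_tendstoD(2)[OF lim(1) \<epsilon>] order_tendstoD(2)[OF lim(2) \<epsilon>] by eventually_elim simp
  then obtain i where i: "?D i < \<epsilon>" "norm (t * completed_mult (d i) - t) < \<epsilon>"
    using F eventually_happens' by blast
  have "d i \<in> projective_tensor A A"
    using d by (simp add: approximate_diagonal_def)
  then obtain u where u: "projective_Cauchy A A u" "d i = projective_rel A A `` {u}"
    by (auto simp: projective_tensor_def elim: quotientE)
  note mul = completed_mul_class[OF A t u(1)]
  note diff = completed_diff_class[OF A' mul(1,2)]
  have "(\<lambda>n. projective_norm A A (tensor_lmul t (u n) - tensor_rmul (u n) t)) \<longlonglongrightarrow> ?D i"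
    unfolding u(2) mul(3,4) diff(2) completed_norm_class[OF A' diff(1)]
    using projective_Cauchy_norm[OF A' diff(1)] by (simp add: convergent_LIMSEQ_iff)
  from order_tendstoD(2)[OF this i(1)]
  have "eventually (\<lambda>n. projective_norm A A (tensor_lmul t (u n) - tensor_rmul (u n) t) < \<epsilon>) sequentially" .
  moreover have "(\<lambda>n. norm (t * tensor_mult (u n) - t)) \<longlonglongrightarrow> norm (t * completed_mult (d i) - t)"
    using completed_mult_class[OF A' u(1)] unfolding u(2) by (intro tendsto_intros)
  from order_tendstoD(2)[OF this i(2)]
  have "eventually (\<lambda>n. norm (t * tensor_mult (u n) - t) < \<epsilon>) sequentially" .
  ultimately have "eventually (\<lambda>n. projective_norm A A (tensor_lmul t (u n) - tensor_rmul (u n) t) < \<epsilon>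
      \<and> norm (t * tensor_mult (u n) - t) < \<epsilon>) sequentially"
    by (rule eventually_conj)
  then obtain n where "projective_norm A A (tensor_lmul t (u n) - tensor_rmul (u n) t) < \<epsilon>"
    "norm (t * tensor_mult (u n) - t) < \<epsilon>"
    using eventually_happens' sequentially_bot by blast
  then show thesis
    using projective_CauchyD[OF u(1)] that by blast
qed

text \<open>Allows one argument for both kinds of amenability: the algebra itself is treated with
  the identity map, its unitization with the map that sends the adjoined unit to the identity
  operator.\<close>

locale contractive_homomorphism =
  fixes \<theta> :: "'a::complex_banach_algebra \<Rightarrow> 'b::complex_banach_algebra"
  assumes add: "\<theta> (x + y) = \<theta> x + \<theta> y"
    and scale: "\<theta> (c *\<^sub>C x) = c *\<^sub>C \<theta> x"
    and mult: "\<theta> (x * y) = \<theta> x * \<theta> y"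
    and norm_le: "norm (\<theta> x) \<le> norm x"
begin

lemma diff: "\<theta> (x - y) = \<theta> x - \<theta> y"
  using add[of "x - y" y] by simp

text \<open>For fixed \<open>P\<close> the map sending \<open>(a, b)\<close> to
  \<open>\<theta> a * P * \<theta> b\<close> is bilinear and contractive, and it turns the two
  module actions of \<open>t\<close> into left and right multiplication by
  \<open>\<theta> t\<close>. The projective norm makes the first estimate uniform over all
  contractions \<open>P\<close>, so that \<open>P\<close> may be chosen after
  \<open>M\<close>.\<close>

lemma approximate_diagonal_imp_commuting_sum:
  assumes A: "complex_subalgebra A" and d: "approximate_diagonal A F d" and t: "t \<in> A" and \<epsilon>: "0 < \<epsilon>"
  obtains M where
    "\<And>P. norm P \<le> 1 \<Longrightarrow> norm (\<theta> t * (\<Sum>(a, b)\<in>#M. \<theta> a * P * \<theta> b) - (\<Sum>(a, b)\<in>#M. \<theta> a * P * \<theta> b) * \<theta> t) < \<epsilon>"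
    "norm (\<theta> t * (\<Sum>(a, b)\<in>#M. \<theta> a * \<theta> b) - \<theta> t) < \<epsilon>"
proof -
  obtain w where w: "w \<in> algebraic_tensor A A"
    "projective_norm A A (tensor_lmul t w - tensor_rmul w t) < \<epsilon>"
    "norm (t * tensor_mult w - t) < \<epsilon>"
    using approximate_diagonal_imp_tensor[OF assms] .
  obtain M where M: "w = tensor_of M"
    using w(1) by (rule algebraic_tensorE)
  show thesis
  proof
    fix P :: 'b assume P: "norm P \<le> 1"
    define \<beta> where "\<beta> a b = \<theta> a * P * \<theta> b" for a b
    interpret \<beta>: complex_bilinear \<beta>
      by unfold_locales
        (simp_all add: \<beta>_def add scale distrib_left distrib_right mult_scaleC_left mult_scaleC_right)
    let ?U = "\<Sum>(a, b)\<in>#M. \<beta> a b"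
    have "tensor_eval \<beta> (tensor_lmul t w) = (\<Sum>(a, b)\<in>#M. \<beta> (t * a) b)"
      unfolding M tensor_lmul.abs_eq \<beta>.tensor_eval_of
      by (simp add: multiset.map_comp comp_def case_prod_unfold)
    also have "\<dots> = \<theta> t * ?U"
      by (simp add: \<beta>_def mult mult.assoc sum_mset_distrib_left case_prod_unfold)
    finally have left: "tensor_eval \<beta> (tensor_lmul t w) = \<theta> t * ?U" .
    have "tensor_eval \<beta> (tensor_rmul w t) = (\<Sum>(a, b)\<in>#M. \<beta> a (b * t))"
      unfolding M tensor_rmul.abs_eq \<beta>.tensor_eval_of
      by (simp add: multiset.map_comp comp_def case_prod_unfold)
    also have "\<dots> = ?U * \<theta> t"
      by (simp add: \<beta>_def mult mult.assoc sum_mset_distrib_right case_prod_unfold)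
    finally have right: "tensor_eval \<beta> (tensor_rmul w t) = ?U * \<theta> t" .
    have "norm (\<beta> a b) \<le> 1 * (norm a * norm b)" for a b
    proof -
      have "norm (\<beta> a b) \<le> norm (\<theta> a) * norm P * norm (\<theta> b)"
        unfolding \<beta>_def by (meson norm_mult_ineq mult_right_mono norm_ge_zero order_trans)
      also have "\<dots> \<le> norm a * 1 * norm b"
        using P by (intro mult_mono norm_le) auto
      finally show ?thesis by simp
    qed
    then have "norm (tensor_eval \<beta> (tensor_lmul t w - tensor_rmul w t))
        \<le> 1 * projective_norm A A (tensor_lmul t w - tensor_rmul w t)"
      using A t w(1) by (intro \<beta>.norm_tensor_eval_le algebraic_tensor_diff algebraic_tensor_lmul algebraic_tensor_rmul)
        (auto simp: complex_subalgebra_def)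
    then show "norm (\<theta> t * (\<Sum>(a, b)\<in>#M. \<theta> a * P * \<theta> b) - (\<Sum>(a, b)\<in>#M. \<theta> a * P * \<theta> b) * \<theta> t) < \<epsilon>"
      using w(2) unfolding \<beta>.tensor_eval_diff left right \<beta>_def by simp
  next
    have "\<theta> (\<Sum>(a, b)\<in>#M. a * b) = (\<Sum>(a, b)\<in>#M. \<theta> a * \<theta> b)"
    proof (induction M)
      case empty
      show ?case using scale[of 0 0] by simp
    qed (auto simp: add mult)
    then have "\<theta> (t * tensor_mult w - t) = \<theta> t * (\<Sum>(a, b)\<in>#M. \<theta> a * \<theta> b) - \<theta> t"
      by (simp add: M tensor_mult.abs_eq diff mult)
    with w(3) norm_le[of "t * tensor_mult w - t"]
    show "norm (\<theta> t * (\<Sum>(a, b)\<in>#M. \<theta> a * \<theta> b) - \<theta> t) < \<epsilon>"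
      by simp
  qed
qed

end

section \<open>Ideal properties of representable operators\<close>

lemma integral_indicator_cong:
  assumes "integrable unit_measure f" "integrable unit_measure g" "L1_class f = L1_class g"
    and E: "E \<in> sets unit_measure"
  shows "(LINT s|unit_measure. indicator E s *\<^sub>R (f s :: complex)) = (LINT s|unit_measure. indicator E s *\<^sub>R g s)"
proof (rule integral_cong_AE)
  show "(\<lambda>s. indicator E s *\<^sub>R f s) \<in> borel_measurable unit_measure"
    "(\<lambda>s. indicator E s *\<^sub>R g s) \<in> borel_measurable unit_measure"
    using assms by auto
  show "AE s in unit_measure. indicator E s *\<^sub>R f s = indicator E s *\<^sub>R g s"
    using L1_class_simps(3)[OF assms(1,2)] assms(3) by auto
qed

definition L1_integral :: "real set \<Rightarrow> L1 \<Rightarrow> complex" where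
  "L1_integral E x = (LINT s|unit_measure. indicator E s *\<^sub>R rep_L1 x s)"

context
  fixes E assumes E: "E \<in> sets unit_measure"
begin

lemma L1_integral_class:
  "integrable unit_measure f \<Longrightarrow> L1_integral E (L1_class f) = (LINT s|unit_measure. indicator E s *\<^sub>R f s)"
  unfolding L1_integral_def using E by (intro integral_indicator_cong) (simp_all add: rep_L1)

lemma L1_integral_add: "L1_integral E (x + y) = L1_integral E x + L1_integral E y"
proof -
  obtain f where f: "integrable unit_measure f" "x = L1_class f" by (rule L1_class_cases)
  obtain g where g: "integrable unit_measure g" "y = L1_class g" by (rule L1_class_cases)
  show ?thesis
    using f g integrable_mult_indicator[OF E f(1)] integrable_mult_indicator[OF E g(1)]
    by (simp add: L1_class_simps L1_integral_class scaleR_add_right)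
qed

lemma L1_integral_scaleC: "L1_integral E (c *\<^sub>C x) = c * L1_integral E x"
proof -
  obtain f where f: "integrable unit_measure f" "x = L1_class f" by (rule L1_class_cases)
  then have "L1_integral E (c *\<^sub>C x) = (LINT s|unit_measure. indicator E s *\<^sub>R (c * f s))"
    by (simp add: scaleC_L1_class L1_integral_class)
  also have "\<dots> = (LINT s|unit_measure. c * (indicator E s *\<^sub>R f s))"
    by (simp only: mult_scaleR_right)
  also have "\<dots> = c * L1_integral E x"
    unfolding f(2) L1_integral_class[OF f(1)] by (rule integral_mult_right_zero)
  finally show ?thesis .
qed

end

text \<open>The integrals over disjoint sets are the coordinates of a contraction from
  \<open>L\<^sub>1\<close> to \<open>\<ell>\<^sub>1\<close>, because the pieces of the absolute
  value add up to at most the whole.\<close>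

lemma sum_L1_integral_le:
  fixes E :: "nat \<Rightarrow> real set"
  assumes E: "\<And>i. E i \<in> sets unit_measure" "disjoint_family E"
  shows "(\<Sum>i<M. cmod (L1_integral (E i) x)) \<le> norm x"
proof -
  obtain f where f: "integrable unit_measure f" "x = L1_class f" by (rule L1_class_cases)
  have int: "integrable unit_measure (\<lambda>s. indicator (E i) s *\<^sub>R cmod (f s))" for i
    using f(1) E(1) by (intro integrable_mult_indicator) auto
  have "(\<Sum>i<M. cmod (L1_integral (E i) x)) \<le> (\<Sum>i<M. LINT s|unit_measure. indicator (E i) s *\<^sub>R cmod (f s))"
  proof (rule sum_mono)
    fix i
    have "cmod (L1_integral (E i) x) \<le> (LINT s|unit_measure. cmod (indicator (E i) s *\<^sub>R f s))"
      unfolding f(2) L1_integral_class[OF E(1) f(1)] by (rule integral_norm_bound)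
    then show "cmod (L1_integral (E i) x) \<le> (LINT s|unit_measure. indicator (E i) s *\<^sub>R cmod (f s))"
      by simp
  qed
  also have "\<dots> = (LINT s|unit_measure. (\<Sum>i<M. indicator (E i) s *\<^sub>R cmod (f s)))"
    using int by (subst Bochner_Integration.integral_sum) auto
  also have "\<dots> \<le> (LINT s|unit_measure. cmod (f s))"
  proof (rule integral_mono)
    fix s
    have "disjoint_family_on E {..<M}"
      using E(2) by (rule disjoint_family_on_mono[OF subset_UNIV])
    then have "(\<Sum>i<M. indicator (E i) s) = (indicator (\<Union>i<M. E i) s :: real)"
      by (intro indicator_UN_disjoint[symmetric]) simp_all
    then have "(\<Sum>i<M. indicator (E i) s *\<^sub>R cmod (f s)) = indicator (\<Union>i<M. E i) s * cmod (f s)"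
      by (simp only: real_scaleR_def sum_distrib_right[symmetric])
    moreover have "indicator (\<Union>i<M. E i) s * cmod (f s) \<le> cmod (f s)"
      by (simp add: indicator_def)
    ultimately show "(\<Sum>i<M. indicator (E i) s *\<^sub>R cmod (f s)) \<le> cmod (f s)"
      by (simp only:)
  qed (use f int in \<open>auto simp del: real_scaleR_def sum_indicator_scaleR sum_indicator_mult\<close>)
  also have "\<dots> = norm x"
    using f by (simp add: norm_L1_class)
  finally show ?thesis .
qed

lemma bounded_linear_L1_integral:
  assumes E: "E \<in> sets unit_measure"
  shows "bounded_linear (L1_integral E)"
proof (rule bounded_linear_intro[of _ 1])
  fix x y r
  show "L1_integral E (x + y) = L1_integral E x + L1_integral E y"
    by (rule L1_integral_add[OF E])
  show "L1_integral E (r *\<^sub>R x) = r *\<^sub>R L1_integral E x"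
    using L1_integral_scaleC[OF E, of "complex_of_real r" x] by (simp add: scaleC_of_real scaleR_conv_of_real)
  \<comment> \<open>A single set is viewed as a disjoint sequence padded with empty sets.\<close>
  have "disjoint_family (\<lambda>i::nat. if i = 0 then E else {})"
    by (auto simp: disjoint_family_on_def)
  then show "norm (L1_integral E x) \<le> norm x * 1"
    using sum_L1_integral_le[of "\<lambda>i. if i = 0 then E else {}" x 1] E by (simp split: if_splits)
qed

section \<open>Operators with countably valued kernels\<close>

lemma measurable_fibre:
  fixes c :: "real \<Rightarrow> nat"
  assumes "c \<in> measurable unit_measure (count_space UNIV)"
  shows "{s \<in> {0..1}. c s = i} \<in> sets unit_measure"
  using measurable_sets[OF assms, of "{i}"] by (simp add: vimage_def Int_def conj_commute)

lemma borel_measurable_countable_kernel: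
  fixes c :: "real \<Rightarrow> nat" and x :: "nat \<Rightarrow> L1"
  assumes "c \<in> measurable unit_measure (count_space UNIV)"
  shows "(\<lambda>s. x (c s)) \<in> borel_measurable unit_measure"
  by (rule measurable_compose[OF assms]) simp

text \<open>The bound on the partial sums of \<open>g\<close> gives absolute convergence at each
  point. The truncated series satisfy the same bound as the limit, as dominated convergence
  requires.\<close>

lemma bounded_kernel_suminf:
  fixes x :: "nat \<Rightarrow> L1" and g :: "nat \<Rightarrow> real \<Rightarrow> complex"
  assumes g: "\<And>i. g i \<in> borel_measurable unit_measure" "\<And>M s. (\<Sum>i<M. cmod (g i s)) \<le> K"
    and x: "\<And>n. norm (x n) \<le> D"
  shows "\<And>s. (\<lambda>M. \<Sum>i<M. g i s *\<^sub>C x i) \<longlonglongrightarrow> (\<Sum>i. g i s *\<^sub>C x i)"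
    and "\<And>M. bounded_kernel (\<lambda>s. \<Sum>i<M. g i s *\<^sub>C x i) (K * D)"
    and "bounded_kernel (\<lambda>s. \<Sum>i. g i s *\<^sub>C x i) (K * D)"
proof -
  have D: "0 \<le> D"
    using x[of 0] norm_ge_zero order_trans by blast
  have le: "norm (\<Sum>i<M. g i s *\<^sub>C x i) \<le> K * D" for M s
  proof -
    have "norm (\<Sum>i<M. g i s *\<^sub>C x i) \<le> (\<Sum>i<M. cmod (g i s) * D)"
      using x by (intro sum_norm_le) (simp add: norm_scaleC mult_left_mono)
    also have "\<dots> \<le> K * D"
      unfolding sum_distrib_right[symmetric] using g(2) D by (intro mult_right_mono)
    finally show ?thesis .
  qed
  show lim: "(\<lambda>M. \<Sum>i<M. g i s *\<^sub>C x i) \<longlonglongrightarrow> (\<Sum>i. g i s *\<^sub>C x i)" for s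
  proof (rule summable_LIMSEQ, rule summable_comparison_test)
    have "summable (\<lambda>i. cmod (g i s))"
      using g(2) by (intro bounded_imp_summable[of _ K]) (auto simp: lessThan_Suc_atMost[symmetric] simp del: sum.lessThan_Suc)
    then show "summable (\<lambda>i. cmod (g i s) * D)"
      by (rule summable_mult2)
    show "\<exists>N. \<forall>i\<ge>N. norm (g i s *\<^sub>C x i) \<le> cmod (g i s) * D"
      using x by (auto simp: norm_scaleC intro!: mult_left_mono)
  qed
  have meas: "(\<lambda>s. \<Sum>i<M. g i s *\<^sub>C x i) \<in> borel_measurable unit_measure" for M
  proof (rule borel_measurable_sum)
    fix i
    have "(\<lambda>z. z *\<^sub>C x i) \<in> borel_measurable borel"
      by (intro borel_measurable_continuous_onI linear_continuous_on
          bounded_bilinear.bounded_linear_left[OF bounded_bilinear_scaleC])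
    then show "(\<lambda>s. g i s *\<^sub>C x i) \<in> borel_measurable unit_measure"
      by (rule measurable_compose[OF g(1)])
  qed
  show "bounded_kernel (\<lambda>s. \<Sum>i<M. g i s *\<^sub>C x i) (K * D)" for M
    using le meas by (simp add: bounded_kernel_def)
  show "bounded_kernel (\<lambda>s. \<Sum>i. g i s *\<^sub>C x i) (K * D)"
    unfolding bounded_kernel_def
  proof (intro conjI ballI)
    show "(\<lambda>s. \<Sum>i. g i s *\<^sub>C x i) \<in> borel_measurable unit_measure"
      by (rule borel_measurable_LIMSEQ_metric[OF meas lim])
    show "norm (\<Sum>i. g i s *\<^sub>C x i) \<le> K * D" for s
      by (rule LIMSEQ_le_const2[OF tendsto_norm[OF lim]]) (use le in auto)
  qed
qed

lemma kernel_integral_tendsto: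
  fixes h :: "real \<Rightarrow> L1"
  assumes f: "integrable unit_measure f" and u: "\<And>n. bounded_kernel (u n) C" and h: "bounded_kernel h C"
    and lim: "\<And>s. s \<in> {0..1} \<Longrightarrow> (\<lambda>n. u n s) \<longlonglongrightarrow> h s"
  shows "(\<lambda>n. LINT s|unit_measure. f s *\<^sub>C u n s) \<longlonglongrightarrow> (LINT s|unit_measure. f s *\<^sub>C h s)"
proof (rule integral_dominated_convergence)
  show "(\<lambda>s. f s *\<^sub>C h s) \<in> borel_measurable unit_measure"
    "(\<lambda>s. f s *\<^sub>C u n s) \<in> borel_measurable unit_measure" for n
    by (rule borel_measurable_integrable[OF kernel_integrable[OF f h]]
        borel_measurable_integrable[OF kernel_integrable[OF f u]])+
  show "integrable unit_measure (\<lambda>s. cmod (f s) * C)"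
    using f by auto
  show "AE s in unit_measure. (\<lambda>n. f s *\<^sub>C u n s) \<longlonglongrightarrow> f s *\<^sub>C h s"
    using lim by (intro AE_I2 bounded_bilinear.tendsto[OF bounded_bilinear_scaleC] tendsto_const) auto
  show "AE s in unit_measure. norm (f s *\<^sub>C u n s) \<le> cmod (f s) * C" for n
    using u by (intro AE_I2) (auto simp: norm_scaleC bounded_kernel_def intro!: mult_left_mono)
qed

text \<open>\<open>T\<close> factors through \<open>\<ell>\<^sub>1\<close>: it integrates over the
  fibres of \<open>c\<close> and uses the results as coefficients of the vectors \<open>x i\<close>.
  Composing the first factor with \<open>S\<close> gives a bounded map into
  \<open>\<ell>\<^sub>1\<close>, which has densities \<open>g\<close> by
  \<open>functionals_density\<close>; summing \<open>g i s *\<^sub>C x i\<close> produces a kernel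
  of the product.\<close>

lemma representable_countable_kernel_mult_right:
  fixes c :: "real \<Rightarrow> nat" and x :: "nat \<Rightarrow> L1"
  assumes c: "c \<in> measurable unit_measure (count_space UNIV)" and x: "\<And>n. norm (x n) \<le> D"
    and T: "\<And>f. integrable unit_measure f \<Longrightarrow> bop_apply T (L1_class f) = (LINT s|unit_measure. f s *\<^sub>C x (c s))"
  shows "representable (T * S)"
proof -
  define E where "E i = {s \<in> {0..1}. c s = i}" for i
  have E: "E i \<in> sets unit_measure" for i
    unfolding E_def by (rule measurable_fibre[OF c])
  have disj: "disjoint_family E"
    by (auto simp: disjoint_family_on_def E_def)
  have D: "0 \<le> D"
    using x[of 0] norm_ge_zero order_trans by blast
  define \<phi> where "\<phi> i y = L1_integral (E i) (bop_apply S y)" for i y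
  have "bounded_linear (\<phi> i)" for i
    unfolding \<phi>_def by (rule bounded_linear_compose[OF bounded_linear_L1_integral[OF E] bounded_linear_bop_apply])
  moreover have "\<phi> i (k *\<^sub>C y) = k * \<phi> i y" for i k y
    by (simp add: \<phi>_def bop_apply_scaleC L1_integral_scaleC[OF E])
  moreover have "(\<Sum>i<M. cmod (\<phi> i y)) \<le> norm S * norm y" for M y
    unfolding \<phi>_def using sum_L1_integral_le[OF E disj] norm_bop_apply by (rule order_trans)
  ultimately obtain g where g: "\<And>i. g i \<in> borel_measurable unit_measure"
    "\<And>M s. (\<Sum>i<M. cmod (g i s)) \<le> 2 * norm S"
    "\<And>i f. integrable unit_measure f \<Longrightarrow> \<phi> i (L1_class f) = (LINT s|unit_measure. f s * g i s)"
    using functionals_density[of \<phi> "norm S"] by blast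
  have coord: "(\<lambda>M. \<Sum>i<M. L1_integral (E i) y *\<^sub>C x i) \<longlonglongrightarrow> bop_apply T y" for y
  proof -
    obtain f where f: "integrable unit_measure f" "y = L1_class f" by (rule L1_class_cases)
    \<comment> \<open>Cutting the kernel off after the first \<open>M\<close> values of
      \<open>c\<close> turns the partial sum into an integral against a bounded kernel.\<close>
    define u where "u M s = (if c s < M then x (c s) else 0)" for M s
    have u: "bounded_kernel (u M) D" for M
      unfolding bounded_kernel_def u_def[abs_def]
      using borel_measurable_countable_kernel[OF c, of "\<lambda>n. if n < M then x n else 0"] x D by auto
    have "(\<Sum>i<M. L1_integral (E i) y *\<^sub>C x i) = (LINT s|unit_measure. f s *\<^sub>C u M s)" for M
    proof (induction M)
      case (Suc M)
      note int = integrable_mult_indicator[OF E f(1)]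
      note lin = bounded_bilinear.bounded_linear_left[OF bounded_bilinear_scaleC, of "x M"]
      have "L1_integral (E M) y *\<^sub>C x M = (LINT s|unit_measure. (indicator (E M) s *\<^sub>R f s) *\<^sub>C x M)"
        unfolding f(2) L1_integral_class[OF E f(1)] by (rule integral_bounded_linear[OF lin int, symmetric])
      with Suc have "(\<Sum>i<Suc M. L1_integral (E i) y *\<^sub>C x i)
          = (LINT s|unit_measure. f s *\<^sub>C u M s + (indicator (E M) s *\<^sub>R f s) *\<^sub>C x M)"
        using kernel_integrable[OF f(1) u] integrable_bounded_linear[OF lin int] by simp
      also have "\<dots> = (LINT s|unit_measure. f s *\<^sub>C u (Suc M) s)"
        by (intro Bochner_Integration.integral_cong) (auto simp: u_def E_def indicator_def less_Suc_eq)
      finally show ?case .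
    qed (simp add: u_def)
    moreover have "(\<lambda>M. LINT s|unit_measure. f s *\<^sub>C u M s) \<longlonglongrightarrow> (LINT s|unit_measure. f s *\<^sub>C x (c s))"
    proof (rule kernel_integral_tendsto[OF f(1) u])
      show "bounded_kernel (\<lambda>s. x (c s)) D"
        using borel_measurable_countable_kernel[OF c] x by (simp add: bounded_kernel_def)
      show "(\<lambda>n. u n s) \<longlonglongrightarrow> x (c s)" for s
        by (rule tendsto_eventually, rule eventually_mono[OF eventually_gt_at_top[of "c s"]]) (simp add: u_def)
    qed
    ultimately show ?thesis
      using T f by simp
  qed
  note h = bounded_kernel_suminf[of g "2 * norm S" x D, OF g(1,2) x]
  show ?thesis
  proof (rule representableI[OF h(3)])
    fix f :: "real \<Rightarrow> complex" assume f: "integrable unit_measure f"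
    have "(\<Sum>i<M. \<phi> i (L1_class f) *\<^sub>C x i) = (LINT s|unit_measure. f s *\<^sub>C (\<Sum>i<M. g i s *\<^sub>C x i))" for M
    proof (induction M)
      case (Suc M)
      have "cmod (g M s) \<le> 2 * norm S" for s
      proof -
        have "cmod (g M s) \<le> (\<Sum>j<Suc M. cmod (g j s))"
          by (rule member_le_sum) auto
        also note g(2)
        finally show ?thesis .
      qed
      from integrable_mult_bounded[OF f g(1) this]
      have int: "integrable unit_measure (\<lambda>s. f s * g M s)" .
      note lin = bounded_bilinear.bounded_linear_left[OF bounded_bilinear_scaleC, of "x M"]
      have "\<phi> M (L1_class f) *\<^sub>C x M = (LINT s|unit_measure. (f s * g M s) *\<^sub>C x M)"
        unfolding g(3)[OF f] by (rule integral_bounded_linear[OF lin int, symmetric])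
      with Suc show ?case
        using kernel_integrable[OF f h(2)] integrable_bounded_linear[OF lin int]
        by (simp add: scaleC_add_right)
    qed simp
    moreover have "(\<lambda>M. LINT s|unit_measure. f s *\<^sub>C (\<Sum>i<M. g i s *\<^sub>C x i))
        \<longlonglongrightarrow> (LINT s|unit_measure. f s *\<^sub>C (\<Sum>i. g i s *\<^sub>C x i))"
      by (rule kernel_integral_tendsto[OF f h(2,3,1)])
    ultimately have "(\<lambda>M. \<Sum>i<M. \<phi> i (L1_class f) *\<^sub>C x i) \<longlonglongrightarrow> (LINT s|unit_measure. f s *\<^sub>C (\<Sum>i. g i s *\<^sub>C x i))"
      by simp
    then show "bop_apply (T * S) (L1_class f) = (LINT s|unit_measure. f s *\<^sub>C (\<Sum>i. g i s *\<^sub>C x i))"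
      unfolding \<phi>_def bop_apply_simps(3)
      using coord[of "bop_apply S (L1_class f)"] by (rule LIMSEQ_unique[rotated])
  qed
qed

section \<open>Averaging operators\<close>

text \<open>For one kernel, label \<open>s\<close> by the first point of a dense sequence within
  \<open>\<epsilon> / 2\<close> of its value; equal labels force values within
  \<open>\<epsilon>\<close>. The labels of finitely many kernels are merged by
  \<open>prod_encode\<close>, which refines all their partitions simultaneously.\<close>

lemma countable_partition_for_finite_family:
  fixes H :: "(real \<Rightarrow> L1) set"
  assumes "finite H" "\<And>h. h \<in> H \<Longrightarrow> h \<in> borel_measurable unit_measure" and \<epsilon>: "0 < \<epsilon>"
  obtains c :: "real \<Rightarrow> nat" where "c \<in> measurable unit_measure (count_space UNIV)"
    "\<And>h s t. h \<in> H \<Longrightarrow> c s = c t \<Longrightarrow> norm (h s - h t) \<le> \<epsilon>"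
proof -
  obtain D :: "L1 set" where D: "countable D" "\<And>X. open X \<Longrightarrow> X \<noteq> {} \<Longrightarrow> \<exists>d\<in>D. d \<in> X"
    using countable_dense_setE by blast
  have D_ne: "D \<noteq> {}"
    using D(2)[of UNIV] by auto
  define y where "y = from_nat_into D"
  have y: "\<exists>n. dist x (y n) < \<epsilon> / 2" for x
  proof -
    obtain d where "d \<in> D" "d \<in> ball x (\<epsilon> / 2)"
      using D(2)[of "ball x (\<epsilon> / 2)"] \<epsilon> by auto
    then show ?thesis
      using from_nat_into_surj[OF D(1)] unfolding y_def by auto
  qed
  have "\<exists>c :: real \<Rightarrow> nat. c \<in> measurable unit_measure (count_space UNIV) \<and>
      (\<forall>h\<in>H. \<forall>s t. c s = c t \<longrightarrow> norm (h s - h t) \<le> \<epsilon>)"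
    using assms(1,2)
  proof (induction H)
    case empty
    show ?case
      by (intro exI[of _ "\<lambda>_. 0"]) simp
  next
    case (insert h H)
    then obtain c :: "real \<Rightarrow> nat" where c: "c \<in> measurable unit_measure (count_space UNIV)"
      "\<And>h s t. h \<in> H \<Longrightarrow> c s = c t \<Longrightarrow> norm (h s - h t) \<le> \<epsilon>"
      by auto
    have [measurable]: "h \<in> borel_measurable unit_measure"
      using insert by simp
    define d where "d s = (LEAST n. dist (h s) (y n) < \<epsilon> / 2)" for s
    have d: "d \<in> measurable unit_measure (count_space UNIV)"
      unfolding d_def[abs_def] by measurable
    have dist_d: "dist (h s) (y (d s)) < \<epsilon> / 2" for s
      unfolding d_def by (rule LeastI_ex[OF y])
    show ?case
    proof (intro exI[of _ "\<lambda>s. prod_encode (c s, d s)"] conjI ballI allI impI)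
      have "(\<lambda>s. prod_encode (i, d s)) \<in> measurable unit_measure (count_space UNIV)" for i
        by (rule measurable_compose[OF d]) simp
      then show "(\<lambda>s. prod_encode (c s, d s)) \<in> measurable unit_measure (count_space UNIV)"
        by (rule measurable_compose_countable[OF _ c(1)])
      fix k s t assume k: "k \<in> insert h H" and "prod_encode (c s, d s) = prod_encode (c t, d t)"
      then have st: "c s = c t" "d s = d t"
        by (auto simp: prod_encode_eq)
      show "norm (k s - k t) \<le> \<epsilon>"
      proof (cases "k \<in> H")
        case False
        with k have "k = h" by simp
        moreover have "dist (h s) (h t) \<le> \<epsilon>"
          using dist_triangle2[of "h s" "h t" "y (d s)"] dist_d[of s] dist_d[of t] st by simp
        ultimately show ?thesis
          by (simp add: dist_norm)
      qed (use c st in blast)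
    qed
  qed
  then show thesis
    using that by blast
qed

text \<open>The image of the normalized indicator of \<open>E\<close> is the mean of
  \<open>h\<close> over \<open>E\<close>, and a mean of vectors from a closed ball stays in that
  ball.\<close>

lemma norm_kernel_average_le:
  assumes h: "bounded_kernel h C"
    and S: "\<And>f. integrable unit_measure f \<Longrightarrow> bop_apply S (L1_class f) = (LINT s|unit_measure. f s *\<^sub>C h s)"
    and E: "E \<in> sets unit_measure" "measure unit_measure E \<noteq> 0"
    and y: "\<And>s. s \<in> E \<Longrightarrow> norm (h s - y) \<le> \<epsilon>" and \<epsilon>: "0 \<le> \<epsilon>"
  shows "norm (bop_apply S (L1_indicator E /\<^sub>R measure unit_measure E) - y) \<le> \<epsilon>"
proof -
  let ?m = "measure unit_measure E"
  have m: "0 < ?m"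
    using E(2) by (simp add: zero_less_measure_iff)
  have int: "integrable unit_measure (indicator E :: real \<Rightarrow> complex)"
    using E by simp
  have const: "bounded_kernel (\<lambda>_. y) (norm y)"
    by (simp add: bounded_kernel_def)
  have "(LINT s|unit_measure. (indicator E s :: complex) *\<^sub>C y) = (LINT s|unit_measure. indicator E s *\<^sub>R y)"
    by (intro Bochner_Integration.integral_cong) (auto simp: indicator_def)
  also have "\<dots> = ?m *\<^sub>R y"
    using E sets.sets_into_space[OF E(1)] by (simp add: Int_absorb2)
  finally have "bop_apply S (L1_indicator E) - ?m *\<^sub>R y
      = (LINT s|unit_measure. (indicator E s :: complex) *\<^sub>C (h s - y))"
    unfolding L1_indicator_def S[OF int]
    using kernel_integrable[OF int h] kernel_integrable[OF int const] by (simp add: scaleC_diff_right)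
  \<comment> \<open>Cutting the kernel down to \<open>E\<close> makes the bound by
    \<open>\<epsilon>\<close> hold on the whole interval.\<close>
  also have "\<dots> = (LINT s|unit_measure. (indicator E s :: complex) *\<^sub>C (indicator E s *\<^sub>R (h s - y)))"
    by (intro Bochner_Integration.integral_cong) (auto simp: indicator_def)
  also have "norm \<dots> \<le> \<epsilon> * norm (L1_class (indicator E))"
    by (intro norm_kernel_integral_le int \<epsilon> AE_I2) (use y \<epsilon> in \<open>auto simp: indicator_def\<close>)
  finally have le: "norm (bop_apply S (L1_indicator E) - ?m *\<^sub>R y) \<le> \<epsilon> * ?m"
    using norm_L1_indicator[OF E(1)] by (simp add: L1_indicator_def)
  have "bop_apply S (L1_indicator E /\<^sub>R ?m) - y = (bop_apply S (L1_indicator E) - ?m *\<^sub>R y) /\<^sub>R ?m"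
    using m by (simp add: linear_scale[OF bounded_linear.linear[OF bounded_linear_bop_apply]] scaleR_diff_right)
  then have "norm (bop_apply S (L1_indicator E /\<^sub>R ?m) - y) = norm (bop_apply S (L1_indicator E) - ?m *\<^sub>R y) / ?m"
    using m by (simp add: divide_inverse mult.commute)
  also have "\<dots> \<le> \<epsilon>"
    using le m by (simp add: divide_le_eq)
  finally show ?thesis .
qed

text \<open>On a null fibre the inverse of the measure is 0, so the average is the zero vector
  there.\<close>

definition fibre_average :: "(real \<Rightarrow> nat) \<Rightarrow> nat \<Rightarrow> L1" where
  "fibre_average c n = L1_indicator {s \<in> {0..1}. c s = n} /\<^sub>R measure unit_measure {s \<in> {0..1}. c s = n}"

lemma norm_fibre_average:
  assumes "c \<in> measurable unit_measure (count_space UNIV)"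
  shows "norm (fibre_average c n) \<le> 1"
  unfolding fibre_average_def norm_scaleR norm_L1_indicator[OF measurable_fibre[OF assms]]
  by (cases "measure unit_measure {s \<in> {0..1}. c s = n} = 0") (simp_all del: atLeastAtMost_iff)

text \<open>\<open>P\<close> is the conditional expectation for the partition into fibres of
  \<open>c\<close>. Its kernel is countably valued, which makes \<open>P * S\<close> representable.
  The kernel of \<open>S * P\<close> at \<open>s\<close> is the mean of \<open>h\<close> over the
  fibre of \<open>s\<close>, which is close to \<open>h s\<close> when \<open>h\<close> oscillates
  little on fibres.\<close>

lemma averaging_operator:
  fixes c :: "real \<Rightarrow> nat"
  assumes c: "c \<in> measurable unit_measure (count_space UNIV)"
  obtains P where "norm P \<le> 1" "\<And>S. representable (P * S)"
    "\<And>S h C \<epsilon>. bounded_kernel h C \<Longrightarrow>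
      (\<And>f. integrable unit_measure f \<Longrightarrow> bop_apply S (L1_class f) = (LINT s|unit_measure. f s *\<^sub>C h s)) \<Longrightarrow>
      (\<And>s t. c s = c t \<Longrightarrow> norm (h s - h t) \<le> \<epsilon>) \<Longrightarrow> norm (S * P - S) \<le> \<epsilon>"
proof -
  define k where "k s = fibre_average c (c s)" for s
  have k: "bounded_kernel k 1"
    using borel_measurable_countable_kernel[OF c] norm_fibre_average[OF c]
    by (simp add: bounded_kernel_def k_def[abs_def])
  obtain P where P: "\<And>f. integrable unit_measure f \<Longrightarrow> bop_apply P (L1_class f) = (LINT s|unit_measure. f s *\<^sub>C k s)"
    using representable_kernel[OF k] by metis
  show thesis
  proof
    show "norm P \<le> 1"
    proof (rule norm_bop_le)
      fix x
      obtain f where f: "integrable unit_measure f" "x = L1_class f" by (rule L1_class_cases)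
      then show "norm (bop_apply P x) \<le> 1 * norm x"
        using norm_kernel_integral_le[OF f(1) AE_I2, of k 1] k by (simp add: P bounded_kernel_def)
    qed simp
    show "representable (P * S)" for S
      using c norm_fibre_average[OF c] by (rule representable_countable_kernel_mult_right) (simp add: P k_def)
    fix S h C \<epsilon>
    assume h: "bounded_kernel h C"
      and S: "\<And>f. integrable unit_measure f \<Longrightarrow> bop_apply S (L1_class f) = (LINT s|unit_measure. f s *\<^sub>C h s)"
      and close: "\<And>s t. c s = c t \<Longrightarrow> norm (h s - h t) \<le> \<epsilon>"
    have \<epsilon>: "0 \<le> \<epsilon>"
      using close[of 0 0] by simp
    \<comment> \<open>There are only countably many null fibres, so almost every point avoids all of
      them and lies in a fibre with a genuine average.\<close>
    have "AE s in unit_measure. measure unit_measure {t \<in> {0..1}. c t = n} = 0 \<longrightarrow> c s \<noteq> n" for n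
    proof (cases "measure unit_measure {t \<in> {0..1}. c t = n} = 0")
      case True
      then have "{t \<in> {0..1}. c t = n} \<in> null_sets unit_measure"
        using measurable_fibre[OF c] by (simp add: null_sets_def unit.emeasure_eq_measure)
      then have "AE s in unit_measure. s \<notin> {t \<in> {0..1}. c t = n}"
        by (rule AE_not_in)
      then show ?thesis
        using AE_space by eventually_elim auto
    qed simp
    then have "AE s in unit_measure. \<forall>n. measure unit_measure {t \<in> {0..1}. c t = n} = 0 \<longrightarrow> c s \<noteq> n"
      by (simp add: AE_all_countable)
    then have "AE s in unit_measure. norm (bop_apply S (k s) - h s) \<le> \<epsilon>"
    proof eventually_elim
      case (elim s)
      then show ?case
        unfolding k_def fibre_average_def
        by (intro norm_kernel_average_le[OF h S measurable_fibre[OF c]] \<epsilon>) (auto intro: close)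
    qed
    note le = norm_kernel_integral_le[OF _ this \<epsilon>]
    show "norm (S * P - S) \<le> \<epsilon>"
    proof (rule norm_bop_le[OF \<epsilon>])
      fix x
      obtain f where f: "integrable unit_measure f" "x = L1_class f" by (rule L1_class_cases)
      have "bop_apply (S * P - S) x = (LINT s|unit_measure. f s *\<^sub>C (bop_apply S (k s) - h s))"
        using f kernel_integrable[OF f(1) h] kernel_integrable[OF f(1) bounded_kernel_bop_apply[OF k]]
        by (simp add: P S bop_apply_kernel_integral[OF _ k] scaleC_diff_right)
      with le[OF f(1)] f(2) show "norm (bop_apply (S * P - S) x) \<le> \<epsilon> * norm x"
        by simp
    qed
  qed
qed

section \<open>Representable operators are far from the identity\<close>

text \<open>Lebesgue measure has no atoms: the measure of \<open>E\<close> to the left of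
  \<open>x\<close> is a 1-Lipschitz function of \<open>x\<close>, so the intermediate value theorem
  cuts \<open>E\<close> into two halves.\<close>

lemma split_positive_measure:
  assumes E: "E \<in> sets unit_measure" "measure unit_measure E \<noteq> 0"
  obtains A B where "A \<in> sets unit_measure" "B \<in> sets unit_measure" "A \<subseteq> E" "B \<subseteq> E" "A \<inter> B = {}"
    "measure unit_measure A \<noteq> 0" "measure unit_measure B \<noteq> 0"
proof -
  define F where "F x = measure unit_measure (E \<inter> {0..x})" for x
  have borel: "{0..1} \<inter> B \<in> sets unit_measure" if "B \<in> sets borel" for B :: "real set"
    using that by (auto simp: sets_restrict_space)
  have sets: "E \<inter> {0..x} \<in> sets unit_measure" for x
  proof -
    have "E \<inter> {0..x} = E \<inter> ({0..1} \<inter> {0..x})"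
      using sets.sets_into_space[OF E(1)] by auto
    then show ?thesis
      using sets.Int[OF E(1) borel[of "{0..x}"]] by simp
  qed
  have F_le: "F x \<le> F y" "F y \<le> F x + (y - x)" if "x \<le> y" for x y
  proof -
    show "F x \<le> F y"
      unfolding F_def using that by (intro unit.finite_measure_mono sets) auto
    have "F y \<le> measure unit_measure ((E \<inter> {0..x}) \<union> ({0..1} \<inter> {x<..y}))"
      unfolding F_def using sets.sets_into_space[OF E(1)]
      by (intro unit.finite_measure_mono sets.Un sets borel) auto
    also have "\<dots> \<le> F x + measure unit_measure ({0..1} \<inter> {x<..y})"
      unfolding F_def by (intro measure_Un_le sets borel) simp
    also have "measure unit_measure ({0..1} \<inter> {x<..y}) = measure lborel ({0..1} \<inter> {x<..y})"
      by (rule measure_restrict_space) auto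
    also have "\<dots> \<le> measure lborel {x<..y}"
      using that by (intro measure_mono_fmeasurable fmeasurableI) auto
    finally show "F y \<le> F x + (y - x)"
      using that by simp
  qed
  have "continuous_on {0..1} F"
  proof (rule continuous_onI)
    fix x e :: real assume "0 < e"
    then show "\<exists>d>0. \<forall>x'\<in>{0..1}. dist x' x < d \<longrightarrow> dist (F x') (F x) \<le> e"
      using F_le by (intro exI[of _ e]) (smt (verit) dist_real_def)
  qed
  moreover have "F 0 = 0"
  proof -
    have "F 0 \<le> measure unit_measure ({0..1} \<inter> {0})"
      unfolding F_def by (intro unit.finite_measure_mono borel) auto
    also have "\<dots> = measure lborel ({0..1} \<inter> {0::real})"
      by (rule measure_restrict_space) auto
    finally show ?thesis
      by (simp add: F_def antisym)
  qed
  moreover have "F 1 = measure unit_measure E"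
    unfolding F_def using sets.sets_into_space[OF E(1)] by (simp add: Int_absorb2)
  ultimately obtain x where x: "F x = measure unit_measure E / 2"
    using IVT'[of F 0 "measure unit_measure E / 2" 1] by auto
  show thesis
  proof
    show "E \<inter> {0..x} \<in> sets unit_measure" "E - (E \<inter> {0..x}) \<in> sets unit_measure"
      by (rule sets sets.Diff[OF E(1) sets])+
    show "measure unit_measure (E \<inter> {0..x}) \<noteq> 0"
      using x E(2) by (simp add: F_def)
    have "measure unit_measure (E - (E \<inter> {0..x})) = measure unit_measure E - F x"
      unfolding F_def by (intro unit.finite_measure_Diff E sets) auto
    then show "measure unit_measure (E - (E \<inter> {0..x})) \<noteq> 0"
      using x E(2) by simp
  qed auto
qed

text \<open>For functions with disjoint supports the absolute value of the difference is the sum of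
  the absolute values, and each average has norm 1.\<close>

lemma norm_diff_disjoint_averages:
  assumes "A \<in> sets unit_measure" "B \<in> sets unit_measure" "A \<inter> B = {}"
    "measure unit_measure A \<noteq> 0" "measure unit_measure B \<noteq> 0"
  shows "norm (L1_indicator A /\<^sub>R measure unit_measure A - L1_indicator B /\<^sub>R measure unit_measure B) = 2"
proof -
  let ?a = "inverse (measure unit_measure A)" and ?b = "inverse (measure unit_measure B)"
  have pos: "0 \<le> ?a" "0 \<le> ?b" by auto
  have int: "integrable unit_measure (indicator A :: real \<Rightarrow> complex)" "integrable unit_measure (indicator B :: real \<Rightarrow> complex)"
    using assms by auto
  have "L1_indicator A /\<^sub>R measure unit_measure A - L1_indicator B /\<^sub>R measure unit_measure B
      = L1_class (\<lambda>s. of_real ?a * indicator A s - of_real ?b * indicator B s)"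
    unfolding scaleC_of_real[symmetric] L1_indicator_def
    using int by (simp add: scaleC_L1_class L1_class_simps del: of_real_inverse)
  also have "norm \<dots> = (LINT s|unit_measure. ?a * indicator A s + ?b * indicator B s)"
  proof (subst norm_L1_class)
    have "cmod (of_real ?a * indicator A s - of_real ?b * indicator B s) = ?a * indicator A s + ?b * indicator B s" for s
      using assms(3) pos by (auto simp: indicator_def norm_inverse)
    then show "(LINT s|unit_measure. cmod (of_real ?a * indicator A s - of_real ?b * indicator B s))
        = (LINT s|unit_measure. ?a * indicator A s + ?b * indicator B s)"
      by (simp only:)
  qed (use int in auto)
  also have "\<dots> = 2"
    using assms sets.sets_into_space[OF assms(1)] sets.sets_into_space[OF assms(2)]
    by (subst Bochner_Integration.integral_add) (auto simp: Int_absorb2)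
  finally show ?thesis .
qed

text \<open>On a fibre where the kernel oscillates by at most 1/4, \<open>U\<close> sends every
  normalized indicator to within 1/4 of one vector \<open>h r\<close>. If \<open>U\<close> moved
  each of them by at most 1/4, all would lie within 1/2 of \<open>h r\<close>, while two disjoint
  ones are at distance 2.\<close>

lemma representable_not_near_identity:
  assumes U: "representable U"
  shows "\<exists>x. norm (bop_apply U x - x) > 1/4 * norm x"
proof (rule ccontr)
  assume "\<not> ?thesis"
  then have near: "norm (bop_apply U x - x) \<le> 1/4 * norm x" for x
    by (simp add: not_less)
  obtain h C where h: "bounded_kernel h C"
    "\<And>f. integrable unit_measure f \<Longrightarrow> bop_apply U (L1_class f) = (LINT s|unit_measure. f s *\<^sub>C h s)"
    using representableE[OF U] by metis
  then have "h \<in> borel_measurable unit_measure"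
    by (simp add: bounded_kernel_def)
  then obtain c :: "real \<Rightarrow> nat" where c: "c \<in> measurable unit_measure (count_space UNIV)"
    "\<And>s t. c s = c t \<Longrightarrow> norm (h s - h t) \<le> 1/4"
    using countable_partition_for_finite_family[of "{h}" "1/4"]
    by (metis finite.emptyI finite_insert singletonD singletonI zero_less_divide_1_iff zero_less_numeral)
  define E where "E n = {s \<in> {0..1}. c s = n}" for n
  have E: "E n \<in> sets unit_measure" for n
    unfolding E_def by (rule measurable_fibre[OF c(1)])
  \<comment> \<open>Countably many null fibres could not cover the unit interval.\<close>
  have "\<exists>n. measure unit_measure (E n) \<noteq> 0"
  proof (rule ccontr)
    assume "\<not> ?thesis"
    then have "E n \<in> null_sets unit_measure" for n
      using E by (simp add: null_sets_def unit.emeasure_eq_measure)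
    then have "(\<Union>n. E n) \<in> null_sets unit_measure"
      by (rule null_sets_UN)
    moreover have "(\<Union>n. E n) = {0..1}"
      by (auto simp: E_def)
    ultimately show False
      by (simp add: null_sets_def emeasure_restrict_space)
  qed
  then obtain n where n: "measure unit_measure (E n) \<noteq> 0" by blast
  obtain A B where AB: "A \<in> sets unit_measure" "B \<in> sets unit_measure" "A \<subseteq> E n" "B \<subseteq> E n" "A \<inter> B = {}"
    "measure unit_measure A \<noteq> 0" "measure unit_measure B \<noteq> 0"
    using split_positive_measure[OF E n] .
  then have "A \<noteq> {}" by auto
  then obtain r where r: "r \<in> A" by blast
  have close: "norm (L1_indicator G /\<^sub>R measure unit_measure G - h r) \<le> 1/2"
    if G: "G \<in> sets unit_measure" "G \<subseteq> E n" "measure unit_measure G \<noteq> 0" for G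
  proof -
    let ?g = "L1_indicator G /\<^sub>R measure unit_measure G"
    have "norm ?g = 1"
      using G by (simp add: norm_L1_indicator)
    then have "norm (?g - bop_apply U ?g) \<le> 1/4"
      using near[of ?g] by (simp add: norm_minus_commute)
    moreover have "norm (bop_apply U ?g - h r) \<le> 1/4"
    proof (rule norm_kernel_average_le[OF h G(1,3)])
      show "norm (h s - h r) \<le> 1/4" if "s \<in> G" for s
        by (rule c(2)) (use that G(2) r AB(3) in \<open>auto simp: E_def\<close>)
    qed simp_all
    ultimately show ?thesis
      using norm_triangle_ineq[of "?g - bop_apply U ?g" "bop_apply U ?g - h r"] by simp
  qed
  have "2 = norm (L1_indicator A /\<^sub>R measure unit_measure A - L1_indicator B /\<^sub>R measure unit_measure B)"
    using norm_diff_disjoint_averages AB by simp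
  also have "\<dots> \<le> norm (L1_indicator A /\<^sub>R measure unit_measure A - h r)
      + norm (L1_indicator B /\<^sub>R measure unit_measure B - h r)"
    by (rule order_trans[OF _ norm_triangle_ineq4]) simp
  also have "\<dots> \<le> 1"
    using close[of A] close[of B] AB by simp
  finally show False by simp
qed

section \<open>Approximate diagonals\<close>

text \<open>The bound 2 leaves room to approximate vectors of the unit ball by points of a dense set
  without rescaling them; points of larger norm are replaced by 0.\<close>

lemma range_dense_unit_ball:
  obtains x :: "nat \<Rightarrow> L1" where "\<And>n. norm (x n) \<le> 2" "\<And>y. norm y \<le> 1 \<Longrightarrow> y \<in> closure (range x)"
proof -
  obtain D :: "L1 set" where D: "countable D" "\<And>X. open X \<Longrightarrow> X \<noteq> {} \<Longrightarrow> \<exists>d\<in>D. d \<in> X"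
    using countable_dense_setE by blast
  define x where "x n = (if norm (from_nat_into D n) \<le> 2 then from_nat_into D n else 0)" for n
  show thesis
  proof
    show "norm (x n) \<le> 2" for n
      by (simp add: x_def)
    fix y :: L1 assume y: "norm y \<le> 1"
    show "y \<in> closure (range x)"
      unfolding closure_approachable
    proof (intro allI impI)
      fix e :: real assume "0 < e"
      then have "ball y (min e 1) \<noteq> {}"
        by auto
      from D(2)[OF open_ball this] obtain d where d: "d \<in> D" "dist y d < min e 1"
        by auto
      have "norm d \<le> 2"
        using d(2) y norm_triangle_ineq2[of d y] by (simp add: dist_norm norm_minus_commute)
      moreover obtain n where "from_nat_into D n = d"
        using from_nat_into_surj[OF D(1) d(1)] by blast
      ultimately have "x n = d"
        by (simp add: x_def)
      with d(2) show "\<exists>z\<in>range x. dist z y < e"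
        by (intro bexI[of _ d]) (auto simp: dist_commute)
    qed
  qed
qed

lemma nonnull_fibres:
  obtains c :: "real \<Rightarrow> nat" where "c \<in> measurable unit_measure (count_space UNIV)"
    "\<And>n. measure unit_measure {s \<in> {0..1}. c s = n} \<noteq> 0"
proof
  \<comment> \<open>The fibre of \<open>n\<close> contains the interval from 1/(n+2), excluded, to
    1/(n+1), where the floor of 1/s is n+1. The subtraction of 1 lets the values start at 0; the
    point 0 falls into fibre 0 because 1/0 is 0.\<close>
  let ?c = "\<lambda>s :: real. nat \<lfloor>1 / s\<rfloor> - 1"
  show c: "?c \<in> measurable unit_measure (count_space UNIV)"
    by (intro measurable_restrict_space1) simp
  fix n
  have sub: "{1 / real (n + 2) <.. 1 / real (n + 1)} \<subseteq> {s \<in> {0..1}. ?c s = n}"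
  proof
    fix s assume s: "s \<in> {1 / real (n + 2) <.. 1 / real (n + 1)}"
    then have "0 < s"
      by (auto intro: less_trans[rotated])
    moreover have "s \<le> 1"
      using s by (auto intro: order_trans)
    moreover have "\<lfloor>1 / s\<rfloor> = int (n + 1)"
      using s \<open>0 < s\<close> by (intro floor_unique) (auto simp: field_simps)
    ultimately show "s \<in> {s \<in> {0..1}. ?c s = n}"
      by (simp add: nat_add_distrib)
  qed
  then have "{1 / real (n + 2) <.. 1 / real (n + 1)} \<subseteq> {0..1}"
    by blast
  then have "measure unit_measure {1 / real (n + 2) <.. 1 / real (n + 1)}
      = measure lborel {1 / real (n + 2) <.. 1 / real (n + 1)}"
    by (intro measure_restrict_space) auto
  also have "\<dots> > 0"
  proof -
    have "1 / real (n + 2) < 1 / real (n + 1)"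
      by (intro divide_strict_left_mono) auto
    then show ?thesis by simp
  qed
  finally have "0 < measure unit_measure {1 / real (n + 2) <.. 1 / real (n + 1)}" .
  also have "\<dots> \<le> measure unit_measure {s \<in> {0..1}. ?c s = n}"
    using sub by (rule unit.finite_measure_mono[OF _ measurable_fibre[OF c]])
  finally show "measure unit_measure {s \<in> {0..1}. ?c s = n} \<noteq> 0"
    by simp
qed

text \<open>The operator is the composition of the averages over the fibres of \<open>c\<close>, which map \<open>L\<^sub>1\<close> onto
  \<open>\<ell>\<^sub>1\<close>, with a quotient map of \<open>\<ell>\<^sub>1\<close> onto \<open>L\<^sub>1\<close>.\<close>

lemma representable_detecting_identity:
  obtains T where "representable T" "\<And>S. representable (T * S)"
    "\<And>U \<epsilon> y. norm (U * T - T) \<le> \<epsilon> \<Longrightarrow> norm (bop_apply U y - y) \<le> \<epsilon> * norm y"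
proof -
  obtain x :: "nat \<Rightarrow> L1" where x: "\<And>n. norm (x n) \<le> 2" "\<And>y. norm y \<le> 1 \<Longrightarrow> y \<in> closure (range x)"
    using range_dense_unit_ball by blast
  obtain c :: "real \<Rightarrow> nat" where c: "c \<in> measurable unit_measure (count_space UNIV)"
    "\<And>n. measure unit_measure {s \<in> {0..1}. c s = n} \<noteq> 0"
    using nonnull_fibres by blast
  have h: "bounded_kernel (\<lambda>s. x (c s)) 2"
    using borel_measurable_countable_kernel[OF c(1)] x(1) by (simp add: bounded_kernel_def)
  obtain T where T: "representable T"
    "\<And>f. integrable unit_measure f \<Longrightarrow> bop_apply T (L1_class f) = (LINT s|unit_measure. f s *\<^sub>C x (c s))"
    using representable_kernel[OF h] by metis
  show thesis
  proof
    show "representable T" by (fact T(1))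
    show "representable (T * S)" for S
      by (rule representable_countable_kernel_mult_right[OF c(1) x(1) T(2)])
    fix U \<epsilon> y assume U: "norm (U * T - T) \<le> \<epsilon>"
    \<comment> \<open>The kernel is constant on each fibre, so its mean there is exactly
      \<open>x n\<close>.\<close>
    have T_avg: "bop_apply T (fibre_average c n) = x n" for n
    proof -
      have "norm (bop_apply T (fibre_average c n) - x n) \<le> 0"
        unfolding fibre_average_def
        by (rule norm_kernel_average_le[OF h T(2) measurable_fibre[OF c(1)] c(2)]) auto
      then show ?thesis by simp
    qed
    \<comment> \<open>Testing \<open>U * T - T\<close> on the fibre averages shows that
      \<open>U\<close> nearly fixes each \<open>x n\<close>; this closed condition then extends to
      the unit ball.\<close>
    have range: "range x \<subseteq> {z. norm (bop_apply U z - z) \<le> \<epsilon>}"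
    proof safe
      fix n
      have "norm (bop_apply (U * T - T) (fibre_average c n)) \<le> norm (U * T - T) * norm (fibre_average c n)"
        by (rule norm_bop_apply)
      also have "\<dots> \<le> \<epsilon> * 1"
        using U norm_fibre_average[OF c(1)] by (intro mult_mono) (auto intro: order_trans[OF norm_ge_zero])
      finally show "norm (bop_apply U (x n) - x n) \<le> \<epsilon>"
        by (simp add: T_avg)
    qed
    have "closed {z. norm (bop_apply U z - z) \<le> \<epsilon>}"
      by (intro closed_Collect_le continuous_intros linear_continuous_on bounded_linear_bop_apply)
    from closure_minimal[OF range this] x(2)
    have ball: "norm (bop_apply U z - z) \<le> \<epsilon>" if "norm z \<le> 1" for z
      using that by blast
    show "norm (bop_apply U y - y) \<le> \<epsilon> * norm y"
    proof (cases "y = 0")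
      case True
      then show ?thesis
        using linear_0[OF bounded_linear.linear[OF bounded_linear_bop_apply[of U]]] by simp
    next
      case False
      let ?z = "y /\<^sub>R norm y"
      have "bop_apply U y - y = norm y *\<^sub>R (bop_apply U ?z - ?z)"
        using False by (simp add: linear_scale[OF bounded_linear.linear[OF bounded_linear_bop_apply]] scaleR_diff_right)
      then have "norm (bop_apply U y - y) = norm y * norm (bop_apply U ?z - ?z)"
        by (simp only: norm_scaleR abs_norm_cancel)
      also have "\<dots> \<le> norm y * \<epsilon>"
        using False by (intro mult_left_mono ball) auto
      finally show ?thesis
        by (simp add: mult.commute)
    qed
  qed
qed

section \<open>A right approximate unit and the contradiction\<close>

lemma representable_zero: "representable 0"
  by (rule representableI[of "\<lambda>_. 0" 0]) (auto simp: bounded_kernel_def)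

lemma representable_sum_mset: "(\<And>p. p \<in># M \<Longrightarrow> representable (F p)) \<Longrightarrow> representable (\<Sum>p\<in>#M. F p)"
  by (induction M) (auto simp: representable_zero representable_add)

text \<open>Since \<open>K\<close> is finite, one partition makes all the kernels nearly constant on
  its fibres, and the averaging operator of that partition serves every member of
  \<open>K\<close>.\<close>

lemma right_approximate_unit:
  assumes "finite K" "\<And>S. S \<in> K \<Longrightarrow> representable S" "0 < \<epsilon>"
  obtains P where "norm P \<le> 1" "\<And>S. representable (P * S)" "\<And>S. S \<in> K \<Longrightarrow> norm (S * P - S) \<le> \<epsilon>"
proof -
  have "\<exists>h C. bounded_kernel h C \<and> (\<forall>f. integrable unit_measure f \<longrightarrow>
      bop_apply S (L1_class f) = (LINT s|unit_measure. f s *\<^sub>C h s))" if "S \<in> K" for S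
    using representableE[OF assms(2)[OF that]] by metis
  then obtain h C where h: "\<And>S. S \<in> K \<Longrightarrow> bounded_kernel (h S) (C S)"
    "\<And>S f. S \<in> K \<Longrightarrow> integrable unit_measure f \<Longrightarrow>
      bop_apply S (L1_class f) = (LINT s|unit_measure. f s *\<^sub>C h S s)"
    by metis
  obtain c :: "real \<Rightarrow> nat" where c: "c \<in> measurable unit_measure (count_space UNIV)"
    "\<And>k s t. k \<in> h ` K \<Longrightarrow> c s = c t \<Longrightarrow> norm (k s - k t) \<le> \<epsilon>"
    using countable_partition_for_finite_family[of "h ` K" \<epsilon>] assms h(1)
    by (auto simp: bounded_kernel_def)
  obtain P where P: "norm P \<le> 1" "\<And>S. representable (P * S)"
    "\<And>S h C \<epsilon>. bounded_kernel h C \<Longrightarrow>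
      (\<And>f. integrable unit_measure f \<Longrightarrow> bop_apply S (L1_class f) = (LINT s|unit_measure. f s *\<^sub>C h s)) \<Longrightarrow>
      (\<And>s t. c s = c t \<Longrightarrow> norm (h s - h t) \<le> \<epsilon>) \<Longrightarrow> norm (S * P - S) \<le> \<epsilon>"
    using averaging_operator[OF c(1)] by blast
  show thesis
  proof
    show "norm (S * P - S) \<le> \<epsilon>" if "S \<in> K" for S
      by (rule P(3)[OF h(1)[OF that] h(2)[OF that]]) (use that c(2) in auto)
  qed (fact P)+
qed

text \<open>The sum of the norms of \<open>G p\<close> does not involve \<open>P\<close>, so a
  suitable \<open>\<delta>\<close> can be fixed before \<open>P\<close> is chosen.\<close>

lemma norm_sum_mset_mult_diff_le:
  fixes F :: "'p \<Rightarrow> 'a::complex_banach_algebra"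
  assumes "\<And>p. p \<in># M \<Longrightarrow> norm (F p * P - F p) \<le> \<delta>"
  shows "norm ((\<Sum>p\<in>#M. F p * P * G p) - (\<Sum>p\<in>#M. F p * G p)) \<le> \<delta> * (\<Sum>p\<in>#M. norm (G p))"
  using assms
proof (induction M)
  case (add p M)
  have "norm ((F p * P - F p) * G p) \<le> \<delta> * norm (G p)"
    using add.prems[of p] by (intro order_trans[OF norm_mult_ineq mult_right_mono]) auto
  moreover have "norm ((\<Sum>p\<in>#M. F p * P * G p) - (\<Sum>p\<in>#M. F p * G p)) \<le> \<delta> * (\<Sum>p\<in>#M. norm (G p))"
    using add by simp
  ultimately have "norm ((F p * P - F p) * G p + ((\<Sum>p\<in>#M. F p * P * G p) - (\<Sum>p\<in>#M. F p * G p)))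
      \<le> \<delta> * norm (G p) + \<delta> * (\<Sum>p\<in>#M. norm (G p))"
    by (rule norm_triangle_mono)
  then show ?case
    by (simp add: algebra_simps)
qed simp

text \<open>The order of choices matters: \<open>T\<close> comes first, then \<open>M\<close> from
  the diagonal for \<open>T\<close>, then \<open>P\<close> for the finitely many first factors in
  \<open>M\<close>, and finally \<open>U\<close>. Three errors of size at most 1/12 add up to the
  constant 1/4 of \<open>representable_not_near_identity\<close>.\<close>

lemma no_approximate_diagonal:
  fixes \<theta> :: "'a::complex_banach_algebra \<Rightarrow> L1 bop"
  assumes \<theta>: "contractive_homomorphism \<theta>" and A: "complex_subalgebra A"
    and rep: "\<And>T. representable T \<Longrightarrow> \<exists>t\<in>A. \<theta> t = T"
  shows "\<not> has_approximate_diagonal A"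
proof
  assume "has_approximate_diagonal A"
  then obtain F :: "('a, 'a) completed_tensor filter" and d where d: "approximate_diagonal A F d"
    unfolding has_approximate_diagonal_def by blast
  obtain T where T: "representable T" "\<And>S. representable (T * S)"
    "\<And>U \<epsilon> y. norm (U * T - T) \<le> \<epsilon> \<Longrightarrow> norm (bop_apply U y - y) \<le> \<epsilon> * norm y"
    using representable_detecting_identity by metis
  obtain t where t: "t \<in> A" "\<theta> t = T"
    using rep[OF T(1)] by blast
  obtain M where M:
    "\<And>P. norm P \<le> 1 \<Longrightarrow> norm (T * (\<Sum>(a, b)\<in>#M. \<theta> a * P * \<theta> b) - (\<Sum>(a, b)\<in>#M. \<theta> a * P * \<theta> b) * T) < 1/12"
    "norm (T * (\<Sum>(a, b)\<in>#M. \<theta> a * \<theta> b) - T) < 1/12"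
    using contractive_homomorphism.approximate_diagonal_imp_commuting_sum[OF \<theta> A d t(1), of "1/12"]
    unfolding t(2) by auto
  define N where "N = (\<Sum>(a, b)\<in>#M. norm (\<theta> b))"
  have N: "0 \<le> N"
    unfolding N_def by (induction M) auto
  \<comment> \<open>Adding 1 to \<open>N\<close> keeps the denominator positive when all second
    factors vanish.\<close>
  define \<delta> where "\<delta> = 1 / (12 * (N + 1))"
  have \<delta>: "0 < \<delta>" "\<delta> * N \<le> 1/12"
    using N by (auto simp: \<delta>_def field_simps)
  \<comment> \<open>The operators \<open>\<theta> a\<close> are arbitrary, but multiplication by
    \<open>T\<close> on the left makes them representable and thus approximable through
    \<open>P\<close>.\<close>
  have "finite ((\<lambda>p. T * \<theta> (fst p)) ` set_mset M)"
    "\<And>S. S \<in> (\<lambda>p. T * \<theta> (fst p)) ` set_mset M \<Longrightarrow> representable S"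
    using T(2) by auto
  from right_approximate_unit[OF this \<delta>(1)]
  obtain P where P: "norm P \<le> 1" "\<And>S. representable (P * S)"
    "\<And>S. S \<in> (\<lambda>p. T * \<theta> (fst p)) ` set_mset M \<Longrightarrow> norm (S * P - S) \<le> \<delta>"
    by blast
  define U where "U = (\<Sum>(a, b)\<in>#M. \<theta> a * P * \<theta> b)"
  \<comment> \<open>Each term is read as \<open>\<theta> a * (P * \<theta> b)\<close>: the inner
    product is representable by the choice of \<open>P\<close>, and left multiplication preserves
    this.\<close>
  have "representable U"
    unfolding U_def using P(2)
    by (intro representable_sum_mset) (auto simp: mult.assoc intro: representable_mult_left)
  have "norm ((\<Sum>p\<in>#M. (T * \<theta> (fst p)) * P * \<theta> (snd p)) - (\<Sum>p\<in>#M. (T * \<theta> (fst p)) * \<theta> (snd p)))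
      \<le> \<delta> * (\<Sum>p\<in>#M. norm (\<theta> (snd p)))"
    using P(3) by (intro norm_sum_mset_mult_diff_le) force
  also have "(\<Sum>p\<in>#M. (T * \<theta> (fst p)) * P * \<theta> (snd p)) = T * U"
    by (simp add: U_def sum_mset_distrib_left case_prod_unfold mult.assoc)
  also have "(\<Sum>p\<in>#M. (T * \<theta> (fst p)) * \<theta> (snd p)) = T * (\<Sum>(a, b)\<in>#M. \<theta> a * \<theta> b)"
    by (simp add: sum_mset_distrib_left case_prod_unfold mult.assoc)
  also have "\<delta> * (\<Sum>p\<in>#M. norm (\<theta> (snd p))) \<le> 1/12"
    using \<delta>(2) by (simp add: N_def case_prod_unfold)
  finally have "norm (T * U - T * (\<Sum>(a, b)\<in>#M. \<theta> a * \<theta> b)) \<le> 1/12" .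
  moreover have "norm (T * U - U * T) < 1/12"
    using M(1)[OF P(1)] by (simp add: U_def)
  moreover have "norm (U * T - T) \<le> norm (T * U - U * T)
      + norm (T * U - T * (\<Sum>(a, b)\<in>#M. \<theta> a * \<theta> b)) + norm (T * (\<Sum>(a, b)\<in>#M. \<theta> a * \<theta> b) - T)"
  proof -
    \<comment> \<open>The three errors come from the commutator, from inserting \<open>P\<close>,
      and from the product of the diagonal.\<close>
    have "U * T - T = - (T * U - U * T) + (T * U - T * (\<Sum>(a, b)\<in>#M. \<theta> a * \<theta> b))
        + (T * (\<Sum>(a, b)\<in>#M. \<theta> a * \<theta> b) - T)"
      by (simp add: algebra_simps)
    then show ?thesis
      by (metis (no_types, lifting) norm_minus_cancel norm_triangle_mono order_refl)
  qed
  ultimately have "norm (U * T - T) \<le> 1/4"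
    using M(2) by linarith
  from T(3)[OF this] have "norm (bop_apply U y - y) \<le> 1/4 * norm y" for y .
  then show False
    using representable_not_near_identity[OF \<open>representable U\<close>] by (meson not_less)
qed

section \<open>Subalgebras and their unitizations\<close>

lemma not_amenable:
  fixes A :: "L1 bop set"
  assumes A: "complex_subalgebra A" and rep: "{T. representable T} \<subseteq> A"
  shows "\<not> amenable A"
proof -
  \<comment> \<open>Amenability already supplies an approximate diagonal of \<open>A\<close> itself,
    so the identity map is the homomorphism to use.\<close>
  have "contractive_homomorphism (\<lambda>T :: L1 bop. T)"
    by unfold_locales auto
  from no_approximate_diagonal[OF this A] rep show ?thesis
    unfolding amenable_def has_approximate_diagonal_def by blast
qed

text \<open>The unitization acts on \<open>L\<^sub>1\<close> with its adjoined unit as the identity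
  operator \<open>I\<close>. This action is not injective when \<open>A\<close> contains
  \<open>I\<close>, but it is a contractive homomorphism whose image of the unitization contains all
  representable operators.\<close>

lemma not_approximately_amenable:
  fixes A :: "L1 bop set"
  assumes A: "complex_subalgebra A" and rep: "{T. representable T} \<subseteq> A"
  shows "\<not> approximately_amenable A"
proof -
  obtain I :: "L1 bop" where I: "\<And>x. bop_apply I x = x"
    by (rule bop_exists[of "\<lambda>x. x" 1]) auto
  have [simp]: "I * S = S" "S * I = S" for S
    by (auto intro: bop_eqI simp: I)
  have "norm I \<le> 1"
    by (rule norm_bop_le) (simp_all add: I)
  have "contractive_homomorphism (\<lambda>x :: L1 bop unitization. vector_part x + scalar_part x *\<^sub>C I)"
  proof
    fix x y :: "L1 bop unitization" and k
    show "vector_part (x + y) + scalar_part (x + y) *\<^sub>C I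
        = vector_part x + scalar_part x *\<^sub>C I + (vector_part y + scalar_part y *\<^sub>C I)"
      by (simp add: unitization_ops scaleC_add_left)
    show "vector_part (k *\<^sub>C x) + scalar_part (k *\<^sub>C x) *\<^sub>C I = k *\<^sub>C (vector_part x + scalar_part x *\<^sub>C I)"
      by (simp add: unitization_ops scaleC_add_right)
    show "vector_part (x * y) + scalar_part (x * y) *\<^sub>C I
        = (vector_part x + scalar_part x *\<^sub>C I) * (vector_part y + scalar_part y *\<^sub>C I)"
      by (simp add: unitization_ops distrib_left distrib_right mult_scaleC_left mult_scaleC_right
          scaleC_add_right add_ac mult.commute)
    have "norm (scalar_part x *\<^sub>C I) \<le> cmod (scalar_part x) * 1"
      unfolding norm_scaleC using \<open>norm I \<le> 1\<close> by (intro mult_left_mono) auto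
    then show "norm (vector_part x + scalar_part x *\<^sub>C I) \<le> norm x"
      using norm_triangle_ineq[of "vector_part x" "scalar_part x *\<^sub>C I"] by (simp add: norm_unitization_def)
  qed
  moreover have "complex_subalgebra (unitization_set A)"
    using A unfolding complex_subalgebra_def complex_subspace_def unitization_set_def
    by (simp add: unitization_ops)
  moreover have "\<exists>t\<in>unitization_set A. vector_part t + scalar_part t *\<^sub>C I = T" if "representable T" for T
    using that rep by (intro bexI[of _ "Unitization T 0"]) (auto simp: unitization_set_def)
  ultimately show ?thesis
    unfolding approximately_amenable_def by (rule no_approximate_diagonal)
qed

theorem mainTheorem1:
  shows "(\<forall>A :: L1 bop set.
            closed A \<and> complex_subalgebra A \<and> {T. representable T} \<subseteq> A \<longrightarrow>
              \<not> approximately_amenable A \<and> \<not> amenable A) \<and>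
         \<not> approximately_amenable (UNIV :: L1 bop set) \<and> \<not> amenable (UNIV :: L1 bop set)"
proof -
  have "complex_subalgebra (UNIV :: L1 bop set)"
    by (simp add: complex_subalgebra_def complex_subspace_def)
  then show ?thesis
    using not_amenable not_approximately_amenable by blast
qed

end
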